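(* Suppose $p>1$. There is an event of probability $1$ such that, for every realization $\{X_i\}$ in this event, the following holds. (1) The minimum values of $L_n$ converge to the minimum of $F$: $$\lim_{n\to\infty}\ \min_{\gamma\in\Omega_n^l(a,b)}L_n(\gamma)=\min_{\gamma\in\Omega(a,b)}F(\gamma).$$ (2) Let $\gamma_n\in\operatorname{argmin}L_n$ be any sequence of optimal paths ($n$ large). Every subsequence of $\{\gamma_n\}$ has a further subsequence $\{\gamma_{n_k}\}$ that converges uniformly to some $\gamma\in\operatorname{argmin}F$, i.e. $\lim_{k\to\infty}\sup_{0\le t\le1}|\gamma_{n_k}(t)-\gamma(t)|=0$. (3) If in addition $\gamma$ is the unique minimizer of $F$ on $\Omega(a,b)$, then the whole sequence $\gamma_n$ converges uniformly to $\gamma$.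
   Context: Let $d\ge1$ and let $D\subset\mathbb R^d$ be the closure of a nonempty open, bounded, convex set; $|\cdot|$ is the Euclidean norm. The function $f:D\times\mathbb R^d\to[0,\infty)$ satisfies, for some $p\ge1$: (A0) $f$ is continuous on $D\times\mathbb R^d$ and $C^1$ on $D\times(\mathbb R^d\setminus\{0\})$; (A1) $f(x,v)$ is convex in $v$; (A2) $f(x,\lambda v)=\lambda^pf(x,v)$ for $\lambda>0$; (A3) there are $m_1,m_2>0$ with $m_1|v|^p\le f(x,v)\le m_2|v|^p$ for all $x\in D$, $v\in\mathbb R^d$. Fix $a,b\in D$. $\Omega(a,b)$ is the set of Lipschitz paths $\gamma:[0,1]\to D$ with $\gamma(0)=a$, $\gamma(1)=b$, and $F(\gamma)=\int_0^1f(\gamma(t),\dot\gamma(t))\,dt$ for $\gamma\in\Omega(a,b)$ (the minimum of $F$ on $\Omega(a,b)$ is attained). Let $X_1,X_2,\dots$ be i.i.d. points in $D$ whose law has Lebesgue density $\rho$ satisfying $c_0\le\rho(x)\le c_0^{-1}$ for all $x\in D$ and some $c_0>0$. Put $\mathcal X_n=\{X_1,\dots,X_n\}$. Let $\epsilon_n>0$ satisfy $\lim_n\epsilon_n=0$ and $\limsup_{n\to\infty}\frac{(\log n)^{1/d}}{n^{1/d}}\frac1{\epsilon_n}=0$. The graph $\mathcal G_n(a,b)$ has vertex set $\mathcal X_n\cup\{a,b\}$, with an edge between $u,v$ iff $0<|u-v|<\epsilon_n$. $V_n(a,b)$ is the set of paths $\mathbf v=(v_0,\dots,v_m)$ ($m\ge1$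 steps, $m$ arbitrary) of vertices with $v_0=a$, $v_m=b$ and an edge between $v_i$ and $v_{i+1}$ for $0\le i<m$; almost surely $V_n(a,b)\neq\emptyset$ for all large $n$. For $u,v\in D$ let $l_{u,v}(t)=(1-t)u+tv$. For $\mathbf v=(v_0,\dots,v_m)\in V_n(a,b)$ let $l_{\mathbf v}\in\Omega(a,b)$ be the piecewise linear path $l_{\mathbf v}(t)=l_{v_i,v_{i+1}}(mt-i)$ for $i/m\le t\le(i+1)/m$. Put $\Omega_n^l(a,b)=\{l_{\mathbf v}:\mathbf v\in V_n(a,b)\}$, and let $L_n$ be the restriction of $F$ to $\Omega^l_n(a,b)$. *)

theory Defs
  imports "HOL-Probability.Probability"
begin

text \<open>The derivative is taken within \<^term>\<open>S\<close>, so that the definition also makes sense at boundary points. It is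
  meant for sets (such as convex sets with nonempty interior) for which the derivative within
  \<^term>\<open>S\<close> is unique.\<close>

definition C1_on :: "('a::real_normed_vector \<Rightarrow> 'b::real_normed_vector) \<Rightarrow> 'a set \<Rightarrow> bool" where
  "C1_on g S \<longleftrightarrow> (\<exists>g' :: 'a \<Rightarrow> ('a \<Rightarrow>\<^sub>L 'b).
      continuous_on S g' \<and> (\<forall>z\<in>S. (g has_derivative blinfun_apply (g' z)) (at z within S)))"

text \<open>A path on $[0,1]$ is a total function on the reals, of which only the restriction to
  $[0,1]$ is significant.\<close>

definition lipschitz_paths :: "'a::metric_space set \<Rightarrow> 'a \<Rightarrow> 'a \<Rightarrow> (real \<Rightarrow> 'a) set" where
  "lipschitz_paths D a b =
     {\<gamma>. (\<exists>L. L-lipschitz_on {0..1} \<gamma>) \<and> \<gamma> ` {0..1} \<subseteq> D \<and> \<gamma> 0 = a \<and> \<gamma> 1 = b}"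

text \<open>By Rademacher's theorem the velocity of a Lipschitz path exists almost everywhere; the
  Henstock-Kurzweil integral ignores the arbitrary values of \<^const>\<open>vector_derivative\<close> on the
  exceptional null set. The derivative within $[0,1]$ depends on the path on $[0,1]$ only.\<close>

definition path_action ::
    "('a::real_normed_vector \<Rightarrow> 'a \<Rightarrow> real) \<Rightarrow> (real \<Rightarrow> 'a) \<Rightarrow> real" where
  "path_action f \<gamma> =
     integral {0..1} (\<lambda>t. f (\<gamma> t) (vector_derivative \<gamma> (at t within {0..1})))"

definition argmin_on :: "('a \<Rightarrow> 'b::ord) \<Rightarrow> 'a set \<Rightarrow> 'a set" where
  "argmin_on g S = {x. is_arg_min g (\<lambda>x. x \<in> S) x}"

definition graph_paths :: "'a::real_normed_vector set \<Rightarrow> real \<Rightarrow> 'a \<Rightarrow> 'a \<Rightarrow> 'a list set" where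
  "graph_paths V e a b =
     {vs. 2 \<le> length vs \<and> set vs \<subseteq> V \<and> hd vs = a \<and> last vs = b \<and>
          (\<forall>i < length vs - 1. 0 < norm (vs ! i - vs ! Suc i) \<and> norm (vs ! i - vs ! Suc i) < e)}"

text \<open>With $m$ one less than the length of the list, the segment used at time $t$ is
  number $\lfloor mt \rfloor$, except that the last one is used at $t=1$; see
  \<open>pl_path_on_segment\<close>.\<close>

definition pl_path :: "'a::real_normed_vector list \<Rightarrow> real \<Rightarrow> 'a" where
  "pl_path vs t =
     (let m = length vs - 1; i = min (nat \<lfloor>real m * t\<rfloor>) (m - 1)
      in linepath (vs ! i) (vs ! Suc i) (real m * t - real i))"

lemma pl_path_on_segment:
  fixes vs :: "'a::real_normed_vector list"
  assumes m: "m = length vs - 1" and i: "i < m"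
    and t: "real i / real m \<le> t" "t \<le> real (Suc i) / real m"
  shows "pl_path vs t = linepath (vs ! i) (vs ! Suc i) (real m * t - real i)"
proof -
  have m0: "real m > 0" using i by simp
  have lo: "real i \<le> real m * t" using t(1) m0 by (simp add: field_simps)
  have hi: "real m * t \<le> real i + 1" using t(2) m0 by (simp add: field_simps)
  show ?thesis
  proof (cases "real m * t = real i + 1")
    case True
    then have fl: "nat \<lfloor>real m * t\<rfloor> = Suc i" by (simp add: nat_add_distrib)
    show ?thesis
    proof (cases "Suc i = m")
      case True
      then have "min (nat \<lfloor>real m * t\<rfloor>) (m - 1) = i" using fl by simp
      then show ?thesis unfolding pl_path_def Let_def m[symmetric] by (simp only:)
    next
      case False
      then have "min (nat \<lfloor>real m * t\<rfloor>) (m - 1) = Suc i" using fl i by simp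
      then show ?thesis
        using True unfolding pl_path_def Let_def m[symmetric] by (simp add: linepath_def)
    qed
  next
    case False
    then have "\<lfloor>real m * t\<rfloor> = int i" using lo hi by (intro floor_unique) auto
    then have "min (nat \<lfloor>real m * t\<rfloor>) (m - 1) = i" using i by simp
    then show ?thesis unfolding pl_path_def Let_def m[symmetric] by (simp only:)
  qed
qed

definition pl_graph_paths ::
    "'a::real_normed_vector set \<Rightarrow> real \<Rightarrow> 'a \<Rightarrow> 'a \<Rightarrow> (real \<Rightarrow> 'a) set" where
  "pl_graph_paths P e a b = pl_path ` graph_paths (P \<union> {a, b}) e a b"

end

theory Submission
  imports Defs "HOL-Complex_Analysis.Great_Picard"
begin

text \<open>
  The \<^term>\<open>p\<close>-th root \<open>g\<close> of the integrand \<open>f\<close> is homogeneous of degree one and subadditive in the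
  velocity, so it is a (not necessarily symmetric) Finsler norm and defines a distance, called \<open>geo_dist\<close>
  below. By Jensen's inequality a path from \<open>a\<close> to \<open>b\<close> has action at least \<open>geo_dist a b powr p\<close>, and a
  path along which distances grow at the constant rate \<open>geo_dist a b\<close> attains this value. So the
  minimization of the action is a question about the metric space \<open>D\<close> with the distance \<open>geo_dist\<close>, in
  which existence of minimizers is the existence of geodesics (\<open>geodesic_exists\<close>), a consequence of the
  compactness of \<open>D\<close>.

  The metric point of view also gives the compactness of minimizing sequences
  (\<open>minimizing_sequence_subconverges\<close>). As \<open>p > 1\<close>, the strict convexity of the power function turns an
  action close to \<open>geo_dist a b powr p\<close> into a speed close to constant (\<open>geo_dist_le_of_excess\<close>), that is, into
  an upper bound for the distances between any two points of the path that survives uniform limits.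
  A limit path is then a geodesic: it is Lipschitz, and it is a minimizer. Paths in the graph are
  Lipschitz paths, so once the minimal actions on the graphs converge to \<open>geo_dist a b powr p\<close>, all three
  assertions follow.

  For this convergence it is enough to find good paths in the graph. A geodesic sampled with steps
  comparable to \<open>\<epsilon> n\<close> can be moved to sample points that are much closer to it than \<open>\<epsilon> n\<close>, and the
  velocities hardly change (\<open>recovery\<close>). Almost surely such sample points exist simultaneously near
  all points of \<open>D\<close> (\<open>sample_eventually_dense\<close>): a ball with radius a fixed fraction of \<open>\<epsilon> n\<close> has
  mass of order \<open>\<epsilon> n ^ d\<close>, which is much larger than \<open>ln n / n\<close>, so that the probability that all
  of \<open>n\<close> points miss one of polynomially many balls is summable.

  The link between action and distance uses velocities of Lipschitz paths, which exist almost
  everywhere by Vitali's covering theorem (\<open>lipschitz_differentiable_ae\<close>). Integrals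
  of the velocity are limits of integrals of difference quotients (\<open>integral_along_lipschitz_path\<close>).
\<close>

section \<open>Lipschitz paths are differentiable almost everywhere\<close>

lemma emeasure_disjoint_UN_le:
  assumes C: "countable C" "disjoint_family_on B C"
    and sets: "sets \<mu> = sets borel" "sets \<nu> = sets borel" "\<And>i. i \<in> C \<Longrightarrow> B i \<in> sets borel"
    and le: "\<And>i. i \<in> C \<Longrightarrow> emeasure \<mu> (B i) \<le> k * emeasure \<nu> (B i)"
  shows "emeasure \<mu> (\<Union>i\<in>C. B i) \<le> k * emeasure \<nu> (\<Union>i\<in>C. B i)"
proof -
  have "emeasure \<mu> (\<Union>i\<in>C. B i) = (\<integral>\<^sup>+i. emeasure \<mu> (B i) \<partial>count_space C)"
    using C sets by (intro emeasure_UN_countable) auto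
  also have "\<dots> \<le> (\<integral>\<^sup>+i. k * emeasure \<nu> (B i) \<partial>count_space C)"
    using le by (intro nn_integral_mono) simp
  also have "\<dots> = k * (\<integral>\<^sup>+i. emeasure \<nu> (B i) \<partial>count_space C)"
    by (rule nn_integral_cmult) simp
  also have "(\<integral>\<^sup>+i. emeasure \<nu> (B i) \<partial>count_space C) = emeasure \<nu> (\<Union>i\<in>C. B i)"
    using C sets by (intro emeasure_UN_countable[symmetric]) auto
  finally show ?thesis .
qed

text \<open>Vitali's covering theorem in the form used for differentiating measures: from arbitrarily
  small balls on which \<^term>\<open>\<mu>\<close> is at most \<^term>\<open>k\<close> times \<^term>\<open>\<nu>\<close> a disjoint countable family is
  selected that still covers \<^term>\<open>S\<close> up to a null set, and the inequality adds up over it.\<close>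

lemma Vitali_measure_le:
  fixes S :: "'a::euclidean_space set"
  assumes T: "open T" "S \<subseteq> T"
    and fine: "\<And>x d. x \<in> S \<Longrightarrow> 0 < d \<Longrightarrow> \<exists>c r. x \<in> ball c r \<and> r < d \<and> R c r"
    and sets: "sets \<mu> = sets borel" "sets \<nu> = sets borel"
    and le: "\<And>c r. 0 < r \<Longrightarrow> R c r \<Longrightarrow> emeasure \<mu> (ball c r) \<le> k * emeasure \<nu> (ball c r)"
  obtains V where "open V" "V \<subseteq> T" "negligible (S - V)" "emeasure \<mu> V \<le> k * emeasure \<nu> V"
proof -
  define K where "K = {i. ball (fst i) (snd i) \<subseteq> T \<and> 0 < snd i \<and> R (fst i) (snd i)}"
  have cover: "\<exists>i. i \<in> K \<and> x \<in> ball (fst i) (snd i) \<and> snd i < d" if x: "x \<in> S" and d: "0 < d" for x d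
  proof -
    obtain \<delta> where \<delta>: "\<delta> > 0" "ball x \<delta> \<subseteq> T" using T x open_contains_ball by blast
    obtain c r where cr: "x \<in> ball c r" "r < min d (\<delta> / 2)" "R c r"
      using fine[of x "min d (\<delta> / 2)"] x d \<delta>(1) by auto
    have "r > 0" using cr(1) by (metis ball_empty empty_iff not_less)
    moreover have "dist x z < \<delta>" if "dist c z < r" for z
      using dist_triangle[of x z c] that cr(1,2) by (simp add: dist_commute)
    then have "ball c r \<subseteq> T" using \<delta>(2) by auto
    ultimately show ?thesis using cr unfolding K_def by (intro exI[of _ "(c, r)"]) auto
  qed
  obtain C where C: "countable C" "C \<subseteq> K"
    "pairwise (\<lambda>i j. disjnt (ball (fst i) (snd i)) (ball (fst j) (snd j))) C"
    "negligible (S - (\<Union>i\<in>C. ball (fst i) (snd i)))"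
    by (rule Vitali_covering_theorem_balls[of S K fst snd]) (use cover in auto)
  have CD: "ball (fst i) (snd i) \<subseteq> T \<and> 0 < snd i \<and> R (fst i) (snd i)" if "i \<in> C" for i
    using subsetD[OF C(2) that] unfolding K_def by (simp only: mem_Collect_eq)
  have disj: "disjoint_family_on (\<lambda>i. ball (fst i) (snd i)) C"
    using C(3) unfolding disjoint_family_on_def pairwise_def disjnt_def by auto
  show ?thesis
  proof (rule that)
    show "open (\<Union>i\<in>C. ball (fst i) (snd i))" "(\<Union>i\<in>C. ball (fst i) (snd i)) \<subseteq> T"
      using CD by blast+
    show "emeasure \<mu> (\<Union>i\<in>C. ball (fst i) (snd i)) \<le> k * emeasure \<nu> (\<Union>i\<in>C. ball (fst i) (snd i))"
      using CD by (intro emeasure_disjoint_UN_le[OF C(1) disj sets] le) auto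
  qed (rule C(4))
qed

lemma emeasure_interval_measure_ball:
  fixes u :: "real \<Rightarrow> real"
  assumes "mono u" "continuous_on UNIV u" "0 < r"
  shows "emeasure (interval_measure u) (ball c r) = ennreal (u (c + r) - u (c - r))"
proof -
  have Icc: "emeasure (interval_measure u) {x..y} = ennreal (u y - u x)" if "x \<le> y" for x y
    using assms that by (intro emeasure_interval_measure_Icc) (auto dest: monoD)
  have N: "{c - r, c + r} \<in> null_sets (interval_measure u)"
    using Icc[of "c-r" "c-r"] Icc[of "c+r" "c+r"]
    by (subst insert_is_Un) (intro null_sets.Un; simp add: null_sets_def)
  have "emeasure (interval_measure u) (ball c r) = emeasure (interval_measure u) (ball c r \<union> {c - r, c + r})"
    using N by (subst emeasure_Un_null_set) auto
  also have "ball c r \<union> {c - r, c + r} = {c - r .. c + r}"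
    using assms(3) by (auto simp: ball_eq_greaterThanLessThan)
  finally show ?thesis using Icc[of "c-r" "c+r"] assms(3) by simp
qed

text \<open>Lebesgue's argument, run with the Stieltjes measure of \<^term>\<open>u\<close>. Where small difference
  quotients below \<^term>\<open>p\<close> occur, an almost full open set has Stieltjes measure at most \<^term>\<open>p\<close>
  times its length; inside that set the quotients above \<^term>\<open>q\<close> force Stieltjes measure at least
  \<^term>\<open>q\<close> times the length of the exceptional set. So the length \<open>l\<close> of a bounded part of that set
  satisfies \<open>q l \<le> p l\<close>. Intervals are written as open balls so that the set is visibly
  Borel, being a countable intersection of open sets.\<close>

lemma negligible_oscillating_quotients:
  fixes u :: "real \<Rightarrow> real"
  assumes u: "mono u" "continuous_on UNIV u" and pq: "p < q"
  shows "negligible {x. \<forall>d>0. (\<exists>c r. x \<in> ball c r \<and> r < d \<and> u (c + r) - u (c - r) < p * (2 * r))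
      \<and> (\<exists>c r. x \<in> ball c r \<and> r < d \<and> q * (2 * r) < u (c + r) - u (c - r))}" (is "negligible ?E")
proof (cases "0 < p")
  case False
  \<comment> \<open>A nondecreasing function has no negative difference quotients.\<close>
  have "?E = {}"
  proof (safe, goal_cases)
    case (1 x)
    then obtain c r where cr: "x \<in> ball c r" "u (c + r) - u (c - r) < p * (2 * r)"
      using zero_less_one by blast
    have "r > 0" using cr(1) by (metis ball_empty empty_iff not_less)
    then have "u (c - r) \<le> u (c + r)" "p * (2 * r) \<le> 0"
      using monoD[OF u(1), of "c - r" "c + r"] False by (simp_all add: mult_nonpos_nonneg)
    then show ?case using cr(2) by linarith
  qed
  then show ?thesis by (simp only: negligible_empty)
next
  case p: True
  then have q: "q > 0" using pq by simp
  let ?\<mu> = "interval_measure u"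
  let ?lo = "\<lambda>c r. u (c + r) - u (c - r) < p * (2 * r)"
  let ?hi = "\<lambda>c r. q * (2 * r) < u (c + r) - u (c - r)"
  define W where "W R d = (\<Union>(c,r) \<in> {(c,r). r < d \<and> R c r}. ball c r)"
    for R :: "real \<Rightarrow> real \<Rightarrow> bool" and d :: real
  have "?E = (\<Inter>n. W ?lo (inverse (real (Suc n))) \<inter> W ?hi (inverse (real (Suc n))))" (is "_ = ?W")
  proof
    have "x \<in> W ?lo d \<inter> W ?hi d" if "x \<in> ?E" "d > 0" for x d
    proof -
      obtain c r c' r' where "x \<in> ball c r" "r < d" "?lo c r" "x \<in> ball c' r'" "r' < d" "?hi c' r'"
        using \<open>x \<in> ?E\<close> \<open>d > 0\<close> by blast
      then show ?thesis unfolding W_def by blast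
    qed
    then show "?E \<subseteq> ?W" by (intro subsetI INT_I) simp
    show "?W \<subseteq> ?E"
    proof
      fix x assume x: "x \<in> ?W"
      have "\<exists>c r. x \<in> ball c r \<and> r < d \<and> R c r"
        if xW: "\<And>n. x \<in> W R (inverse (real (Suc n)))" and d: "0 < d" for R d
      proof -
        obtain n where n: "inverse (real (Suc n)) < d" using reals_Archimedean d by blast
        obtain c r where "x \<in> ball c r" "r < inverse (real (Suc n))" "R c r"
          using xW[of n] unfolding W_def by blast
        then show ?thesis using n by (meson less_trans)
      qed
      from this[of ?lo] this[of ?hi] show "x \<in> ?E" using x by blast
    qed
  qed
  moreover have "open (W R d)" for R d unfolding W_def by auto
  ultimately have E_borel: "?E \<in> sets borel" by auto
  have lam: "emeasure lborel (ball c r) = ennreal (2 * r)" if "r > 0" for c r :: real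
    using that by (simp add: ball_eq_greaterThanLessThan)
  have "negligible (?E \<inter> cbox a b)" for a b
  proof -
    define S where "S = ?E \<inter> cbox a b"
    have ED: "(\<exists>c r. x \<in> ball c r \<and> r < d \<and> ?lo c r) \<and> (\<exists>c r. x \<in> ball c r \<and> r < d \<and> ?hi c r)"
      if "x \<in> S" "d > 0" for x d
      using that unfolding S_def by blast
    have Sb: "S \<in> sets borel" unfolding S_def using E_borel by auto
    have "emeasure lborel S \<le> emeasure lborel (cbox a b)"
      unfolding S_def by (intro emeasure_mono) auto
    also have "\<dots> < \<infinity>" using emeasure_lborel_cbox_finite by blast
    finally have Sfin: "emeasure lborel S < \<infinity>" .
    then have Sm: "S \<in> lmeasurable" and Sl: "emeasure lebesgue S = emeasure lborel S"
      using Sb by (auto simp: fmeasurable_def)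
    have ineq: "q * measure lborel S \<le> p * (measure lborel S + e)" if e: "e > 0" for e :: real
    proof -
      obtain T where T: "open T" "S \<subseteq> T" "T - S \<in> lmeasurable" "emeasure lebesgue (T - S) < ennreal e"
        using sets_lebesgue_outer_open[OF _ e, of S] Sm by (auto simp: fmeasurableD)
      obtain V where V: "open V" "V \<subseteq> T" "negligible (S - V)" "emeasure ?\<mu> V \<le> ennreal p * emeasure lborel V"
      proof (rule Vitali_measure_le[OF T(1,2), of ?lo ?\<mu> lborel "ennreal p"])
        fix c r :: real assume "0 < r" "?lo c r"
        then show "emeasure ?\<mu> (ball c r) \<le> ennreal p * emeasure lborel (ball c r)"
          using p by (simp add: lam emeasure_interval_measure_ball[OF u] ennreal_mult'[symmetric] ennreal_leI)
      qed (use ED in auto)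
      obtain V' where V': "open V'" "V' \<subseteq> V" "negligible (S \<inter> V - V')"
        "emeasure lborel V' \<le> ennreal (1/q) * emeasure ?\<mu> V'"
      proof (rule Vitali_measure_le[OF V(1), of "S \<inter> V" ?hi lborel ?\<mu> "ennreal (1/q)"])
        fix c r :: real assume cr: "0 < r" "?hi c r"
        then have "2 * r \<le> (1/q) * (u (c + r) - u (c - r))" using q by (simp add: field_simps)
        then show "emeasure lborel (ball c r) \<le> ennreal (1/q) * emeasure ?\<mu> (ball c r)"
          using cr q by (simp only: lam emeasure_interval_measure_ball[OF u] ennreal_mult'[symmetric])
            (simp add: ennreal_leI ennreal_mult'[symmetric])
      qed (use ED in auto)
      have "negligible ((S - V) \<union> (S \<inter> V - V'))" using V(3) V'(3) by auto
      then have neg: "negligible (S - V')" by (rule negligible_subset) auto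
      have "S - V' \<in> null_sets lborel"
        using neg Sb V'(1) by (auto simp: negligible_iff_null_sets null_sets_def)
      then have "emeasure lborel (V' \<union> (S - V')) = emeasure lborel V'"
        using V'(1) by (intro emeasure_Un_null_set) auto
      then have "emeasure lborel S \<le> emeasure lborel V'"
        using emeasure_mono[of S "V' \<union> (S - V')" lborel] Sb V'(1) by auto
      also note V'(4)
      also have "emeasure ?\<mu> V' \<le> emeasure ?\<mu> V" using V(1) V'(2) by (intro emeasure_mono) auto
      also note V(4)
      also have "emeasure lborel V \<le> emeasure lborel T" using T V by (intro emeasure_mono) auto
      also have "emeasure lborel T = emeasure lborel (S \<union> (T - S))" using T by (simp add: Un_absorb1)
      also have "\<dots> \<le> emeasure lborel S + emeasure lborel (T - S)"
        using T Sb by (intro emeasure_subadditive) auto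
      also have "emeasure lborel (T - S) = emeasure lebesgue (T - S)" using T Sb by simp
      also have "\<dots> \<le> ennreal e" using T by simp
      finally have fin: "emeasure lborel S \<le> ennreal (1/q) * (ennreal p * (emeasure lborel S + ennreal e))"
        by (simp add: mult_left_mono add_left_mono)
      have "emeasure lborel S = ennreal (measure lborel S)"
        using Sfin by (simp add: emeasure_eq_ennreal_measure)
      then have "ennreal (measure lborel S) \<le> ennreal ((1/q) * (p * (measure lborel S + e)))"
        using fin p q e by (simp add: ennreal_mult'[symmetric] ennreal_plus[symmetric] del: ennreal_plus)
      then have "measure lborel S \<le> (1/q) * (p * (measure lborel S + e))"
        using p q e by (subst (asm) ennreal_le_iff) (auto intro!: divide_nonneg_nonneg mult_nonneg_nonneg add_nonneg_nonneg)
      then show ?thesis using q by (simp add: field_simps)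
    qed
    have "q * measure lborel S \<le> p * measure lborel S + e" if "e > 0" for e :: real
      using ineq[of "e / p"] that p by (simp add: distrib_left)
    then have "q * measure lborel S \<le> p * measure lborel S" by (rule field_le_epsilon)
    then have "measure lborel S \<le> 0"
      using pq by (metis linorder_not_le mult_strict_right_mono)
    then have "measure lborel S = 0" by (simp add: measure_le_0_iff)
    then have "emeasure lborel S = 0" using Sfin by (simp add: emeasure_eq_ennreal_measure)
    then show ?thesis using Sl Sb unfolding S_def[symmetric]
      by (simp add: negligible_iff_null_sets null_sets_def)
  qed
  then show ?thesis using negligible_on_intervals[of ?E] by blast
qed

text \<open>A difference quotient at \<^term>\<open>x\<close> belongs to an interval that has \<^term>\<open>x\<close> as an endpoint.
  Widening the interval a little moves \<^term>\<open>x\<close> into its interior, and continuity preserves a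
  strict inequality.\<close>

lemma open_ball_small_quotient:
  fixes u :: "real \<Rightarrow> real"
  assumes u: "continuous_on UNIV u" and x: "a \<le> x" "x \<le> b" and ab: "b - a < d"
    and lt: "u b - u a < p * (b - a)"
  shows "\<exists>c r. x \<in> ball c r \<and> r < d \<and> u (c + r) - u (c - r) < p * (2 * r)"
proof -
  define \<phi> where "\<phi> e = p * (b - a + 2 * e) - (u (b + e) - u (a - e))" for e
  have [continuous_intros]: "continuous_on UNIV (\<lambda>e. u (b + e))" "continuous_on UNIV (\<lambda>e. u (a - e))"
    by (auto intro!: continuous_on_compose2[OF u] continuous_intros)
  have "continuous_on UNIV \<phi>" unfolding \<phi>_def by (intro continuous_intros)
  then have "(\<phi> \<longlongrightarrow> \<phi> 0) (at_right 0)"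
    by (simp add: continuous_on_eq_continuous_at isCont_def filterlim_at_split)
  moreover have "\<phi> 0 > 0" using lt unfolding \<phi>_def by simp
  ultimately have "\<forall>\<^sub>F e in at_right 0. \<phi> e > 0" by (rule order_tendstoD)
  moreover have "\<forall>\<^sub>F e in at_right 0. e \<in> {0<..<d - (b - a)}"
    using ab by (intro eventually_at_right_real) simp
  ultimately have "\<forall>\<^sub>F e in at_right 0. \<phi> e > 0 \<and> e < d - (b - a) \<and> e > 0"
    by eventually_elim auto
  then obtain e where e: "\<phi> e > 0" "e < d - (b - a)" "e > 0"
    using eventually_happens'[of "at_right (0::real)"] by (auto simp: trivial_limit_at_right_real)
  define c r where "c = (a + b) / 2" and "r = (b - a) / 2 + e"
  have cr: "c + r = b + e" "c - r = a - e" unfolding c_def r_def by (auto simp: field_simps)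
  have "x \<in> ball c r" using cr e x by (simp add: ball_eq_greaterThanLessThan)
  moreover have "r < d" using e(2) ab x unfolding r_def by (simp add: field_simps)
  moreover have "2 * r = b - a + 2 * e" unfolding r_def by simp
  then have "u (c + r) - u (c - r) < p * (2 * r)" using e(1) unfolding \<phi>_def cr by simp
  ultimately show ?thesis by blast
qed

text \<open>The two levels are rational so that only countably many pairs of them have to be considered.\<close>

lemma bounded_not_tendsto_oscillates:
  fixes f :: "'a \<Rightarrow> real"
  assumes F: "F \<noteq> bot" and bd: "\<forall>\<^sub>F x in F. \<bar>f x\<bar> \<le> L" and nl: "\<nexists>l. (f \<longlongrightarrow> l) F"
  shows "\<exists>p q. p \<in> \<rat> \<and> q \<in> \<rat> \<and> p < q \<and> (\<exists>\<^sub>F x in F. f x < p) \<and> (\<exists>\<^sub>F x in F. q < f x)"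
proof -
  let ?l = "Liminf F (\<lambda>x. ereal (f x))" and ?u = "Limsup F (\<lambda>x. ereal (f x))"
  have le: "?l \<le> ?u" by (rule Liminf_le_Limsup[OF F])
  have "?l \<noteq> ?u"
  proof
    assume eq: "?l = ?u"
    have "ereal (- L) \<le> ?l" by (rule Liminf_bounded) (use bd in eventually_elim, auto)
    moreover have "?u \<le> ereal L" by (rule Limsup_bounded) (use bd in eventually_elim, auto)
    then have "?l \<le> ereal L" using eq by simp
    ultimately have "\<exists>r. ?l = ereal r" by (cases ?l) auto
    then obtain r where r: "?l = ereal r" by blast
    have "((\<lambda>x. ereal (f x)) \<longlongrightarrow> ereal r) F"
      using tendsto_iff_Liminf_eq_Limsup[OF F] r eq by metis
    then have "(f \<longlongrightarrow> r) F" by simp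
    then show False using nl by blast
  qed
  then have lt: "?l < ?u" using le by simp
  obtain s :: real where s: "?l < ereal s" "ereal s < ?u" using ereal_dense2[OF lt] by auto
  obtain p0 :: real where p0: "?l < ereal p0" "ereal p0 < ereal s" using ereal_dense2[OF s(1)] by auto
  obtain q0 :: real where q0: "ereal s < ereal q0" "ereal q0 < ?u" using ereal_dense2[OF s(2)] by auto
  obtain p where p: "p \<in> \<rat>" "p0 < p" "p < s" using Rats_dense_in_real[of p0 s] p0 by auto
  obtain q where q: "q \<in> \<rat>" "s < q" "q < q0" using Rats_dense_in_real[of s q0] q0 by auto
  have "\<exists>\<^sub>F x in F. f x < p"
  proof (rule ccontr)
    assume "\<not> (\<exists>\<^sub>F x in F. f x < p)"
    then have "\<forall>\<^sub>F x in F. ereal p \<le> ereal (f x)" by (simp add: not_frequently not_less)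
    then have "ereal p \<le> ?l" by (rule Liminf_bounded)
    then have "ereal p < ereal p0" using p0 by (metis le_less_trans)
    then show False using p by simp
  qed
  moreover have "\<exists>\<^sub>F x in F. q < f x"
  proof (rule ccontr)
    assume "\<not> (\<exists>\<^sub>F x in F. q < f x)"
    then have "\<forall>\<^sub>F x in F. ereal (f x) \<le> ereal q" by (simp add: not_frequently not_less)
    then have "?u \<le> ereal q" by (rule Limsup_bounded)
    then have "ereal q0 < ereal q" using q0 by (metis less_le_trans)
    then show False using q by simp
  qed
  ultimately show ?thesis using p q by force
qed

lemma mono_lipschitz_differentiable_ae:
  fixes u :: "real \<Rightarrow> real"
  assumes mono: "mono u" and lip: "L-lipschitz_on UNIV u"
  shows "negligible {x. \<not> u differentiable (at x)}"
proof -
  define E where "E p q = {x. \<forall>d>0. (\<exists>c r. x \<in> ball c r \<and> r < d \<and> u (c + r) - u (c - r) < p * (2 * r))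
      \<and> (\<exists>c r. x \<in> ball c r \<and> r < d \<and> q * (2 * r) < u (c + r) - u (c - r))}" for p q
  let ?I = "{(p,q). p \<in> \<rat> \<and> q \<in> \<rat> \<and> p < (q::real)}"
  have cont: "continuous_on UNIV u" using lip by (rule lipschitz_on_continuous_on)
  have "?I \<subseteq> \<rat> \<times> \<rat>" by auto
  then have "countable ?I" by (rule countable_subset) (intro countable_SIGMA countable_rat)
  then have "countable ((\<lambda>i. E (fst i) (snd i)) ` ?I)" by (rule countable_image)
  then have "negligible (\<Union>i\<in>?I. E (fst i) (snd i))"
  proof (rule negligible_countable_Union)
    fix S assume "S \<in> (\<lambda>i. E (fst i) (snd i)) ` ?I"
    then obtain i where "fst i < snd i" "S = E (fst i) (snd i)" by auto
    then show "negligible S"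
      unfolding E_def using negligible_oscillating_quotients[OF mono cont] by blast
  qed
  moreover have "{x. \<not> u differentiable (at x)} \<subseteq> (\<Union>i\<in>?I. E (fst i) (snd i))"
  proof
    fix x assume "x \<in> {x. \<not> u differentiable (at x)}"
    then have nd: "\<not> u differentiable (at x)" by simp
    define dq where "dq h = (u (x + h) - u x) / h" for h
    have "\<nexists>l. (dq \<longlongrightarrow> l) (at 0)"
    proof
      assume "\<exists>l. (dq \<longlongrightarrow> l) (at 0)"
      then obtain l where "(u has_field_derivative l) (at x)" unfolding dq_def DERIV_def by blast
      then show False using nd by (meson differentiable_def has_field_derivative_imp_has_derivative)
    qed
    moreover have "\<bar>dq h\<bar> \<le> L" for h
      using lipschitz_onD[OF lip, of "x + h" x] lipschitz_on_nonneg[OF lip]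
      by (cases "h = 0") (auto simp: dq_def dist_real_def field_simps)
    ultimately obtain p q where pq: "p \<in> \<rat>" "q \<in> \<rat>" "p < q"
      "\<exists>\<^sub>F h in at 0. dq h < p" "\<exists>\<^sub>F h in at 0. q < dq h"
      using bounded_not_tendsto_oscillates[of "at 0" dq L] by auto
    have "x \<in> E p q"
      unfolding E_def
    proof (intro CollectI allI impI conjI)
      fix d :: real assume d: "d > 0"
      then have ev: "\<forall>\<^sub>F h in at 0. \<bar>h\<bar> < d \<and> h \<noteq> (0::real)"
        by (auto simp: eventually_at dist_real_def intro!: exI[of _ d])
      have "\<exists>h. dq h < p \<and> \<bar>h\<bar> < d \<and> h \<noteq> 0"
        using frequently_ex[OF frequently_eventually_frequently[OF pq(4) ev]] .
      then obtain h where h: "dq h < p" "\<bar>h\<bar> < d" "h \<noteq> 0" by blast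
      show "\<exists>c r. x \<in> ball c r \<and> r < d \<and> u (c + r) - u (c - r) < p * (2 * r)"
      proof (cases "h > 0")
        case True
        then show ?thesis using h
          by (intro open_ball_small_quotient[OF cont, of x x "x + h"]) (auto simp: dq_def field_simps)
      next
        case False
        then show ?thesis using h
          by (intro open_ball_small_quotient[OF cont, of "x + h" x x]) (auto simp: dq_def field_simps)
      qed
      have "\<exists>h. q < dq h \<and> \<bar>h\<bar> < d \<and> h \<noteq> 0"
        using frequently_ex[OF frequently_eventually_frequently[OF pq(5) ev]] .
      then obtain h where h: "q < dq h" "\<bar>h\<bar> < d" "h \<noteq> 0" by blast
      have cont': "continuous_on UNIV (\<lambda>x. - u x)" using cont by (intro continuous_intros)
      have "\<exists>c r. x \<in> ball c r \<and> r < d \<and> - u (c + r) - - u (c - r) < - q * (2 * r)"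
      proof (cases "h > 0")
        case True
        then show ?thesis using h
          by (intro open_ball_small_quotient[OF cont', of x x "x + h"]) (auto simp: dq_def field_simps)
      next
        case False
        then show ?thesis using h
          by (intro open_ball_small_quotient[OF cont', of "x + h" x x]) (auto simp: dq_def field_simps)
      qed
      then show "\<exists>c r. x \<in> ball c r \<and> r < d \<and> q * (2 * r) < u (c + r) - u (c - r)" by force
    qed
    then show "x \<in> (\<Union>i\<in>?I. E (fst i) (snd i))" using pq by force
  qed
  ultimately show ?thesis by (rule negligible_subset)
qed

text \<open>Adding \<^term>\<open>\<lambda>t. L * t\<close> to a coordinate of an \<^term>\<open>L\<close>-Lipschitz path makes it nondecreasing.\<close>

lemma lipschitz_differentiable_ae:
  fixes \<eta> :: "real \<Rightarrow> 'a::euclidean_space"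
  assumes lip: "L-lipschitz_on UNIV \<eta>"
  shows "negligible {t. \<not> \<eta> differentiable (at t)}"
proof -
  have L: "L \<ge> 0" using lip by (rule lipschitz_on_nonneg)
  have comp: "negligible {t. \<not> (\<lambda>t. \<eta> t \<bullet> b) differentiable (at t)}" if b: "b \<in> Basis" for b
  proof -
    have diff: "\<bar>\<eta> x \<bullet> b - \<eta> y \<bullet> b\<bar> \<le> L * \<bar>x - y\<bar>" for x y
    proof -
      have "\<bar>(\<eta> x - \<eta> y) \<bullet> b\<bar> \<le> norm (\<eta> x - \<eta> y)" using b by (rule Basis_le_norm)
      also have "\<dots> \<le> L * \<bar>x - y\<bar>" using lipschitz_onD[OF lip, of x y] by (simp add: dist_norm)
      finally show ?thesis by (simp add: inner_diff_left)
    qed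
    define v where "v t = \<eta> t \<bullet> b + L * t" for t
    have "mono v"
    proof (rule monoI)
      fix x y :: real assume "x \<le> y"
      then show "v x \<le> v y" using diff[of x y] unfolding v_def by (simp add: abs_le_iff algebra_simps)
    qed
    moreover have "(2 * L)-lipschitz_on UNIV v"
    proof (rule lipschitz_onI)
      fix x y :: real
      have "\<bar>v x - v y\<bar> \<le> \<bar>\<eta> x \<bullet> b - \<eta> y \<bullet> b\<bar> + \<bar>L * (x - y)\<bar>"
        unfolding v_def by (simp add: algebra_simps abs_le_iff) linarith
      then show "dist (v x) (v y) \<le> 2 * L * dist x y"
        using diff[of x y] L by (simp add: dist_real_def abs_mult)
    qed (use L in simp)
    ultimately have "negligible {t. \<not> v differentiable (at t)}" by (rule mono_lipschitz_differentiable_ae)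
    moreover have "(\<lambda>t. \<eta> t \<bullet> b) differentiable (at t)" if "v differentiable (at t)" for t
    proof -
      have "(\<lambda>t. v t - L * t) differentiable (at t)" using that by (intro derivative_intros) auto
      then show ?thesis unfolding v_def by simp
    qed
    ultimately show ?thesis by (elim negligible_subset) auto
  qed
  have "{t. \<not> \<eta> differentiable (at t)} \<subseteq> (\<Union>b\<in>Basis. {t. \<not> (\<lambda>t. \<eta> t \<bullet> b) differentiable (at t)})"
    using differentiable_componentwise_within[of \<eta> _ UNIV] by auto
  moreover have "negligible (\<Union>b\<in>(Basis::'a set). {t. \<not> (\<lambda>t. \<eta> t \<bullet> b) differentiable (at t)})"
    using comp by (intro negligible_Union) auto
  ultimately show ?thesis using negligible_subset by blast
qed

lemma has_vector_derivative_quotient_tendsto: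
  assumes "(\<gamma> has_vector_derivative v) (at t)"
  shows "((\<lambda>h. (\<gamma> (t + h) - \<gamma> t) /\<^sub>R h) \<longlongrightarrow> v) (at 0)"
proof -
  have "((\<lambda>h. norm (\<gamma> (t + h) - \<gamma> t - h *\<^sub>R v) / norm h) \<longlongrightarrow> 0) (at 0)"
    using assms unfolding has_vector_derivative_def has_derivative_at by blast
  moreover have "\<forall>\<^sub>F h in at 0. norm (\<gamma> (t + h) - \<gamma> t - h *\<^sub>R v) / norm h
      = norm ((\<gamma> (t + h) - \<gamma> t) /\<^sub>R h - v)"
  proof (rule eventually_mono)
    show "\<forall>\<^sub>F h in at 0. h \<noteq> (0::real)" by (rule eventually_neq_at_within)
    fix h :: real assume h: "h \<noteq> 0"
    have "(\<gamma> (t + h) - \<gamma> t) /\<^sub>R h - v = (\<gamma> (t + h) - \<gamma> t - h *\<^sub>R v) /\<^sub>R h"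
      using h by (simp add: scaleR_right_diff_distrib)
    then show "norm (\<gamma> (t + h) - \<gamma> t - h *\<^sub>R v) / norm h = norm ((\<gamma> (t + h) - \<gamma> t) /\<^sub>R h - v)"
      by (simp add: divide_inverse mult.commute)
  qed
  ultimately have "((\<lambda>h. norm ((\<gamma> (t + h) - \<gamma> t) /\<^sub>R h - v)) \<longlongrightarrow> 0) (at 0)"
    by (rule Lim_transform_eventually)
  then show ?thesis using LIM_zero_cancel tendsto_norm_zero_iff by blast
qed

text \<open>The constant extension beyond the end times, for which difference quotients with a fixed step
  make sense up to time \<open>1\<close>.\<close>

definition clamp_path :: "(real \<Rightarrow> 'a) \<Rightarrow> real \<Rightarrow> 'a" where
  "clamp_path \<eta> t = \<eta> (max 0 (min 1 t))"

definition forward_quotient :: "(real \<Rightarrow> 'a::real_vector) \<Rightarrow> nat \<Rightarrow> real \<Rightarrow> 'a" where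
  "forward_quotient \<eta> k t =
     real (Suc k) *\<^sub>R (clamp_path \<eta> (t + 1 / real (Suc k)) - clamp_path \<eta> t)"

abbreviation velocity :: "(real \<Rightarrow> 'a::real_normed_vector) \<Rightarrow> real \<Rightarrow> 'a" where
  "velocity \<eta> t \<equiv> vector_derivative \<eta> (at t within {0..1})"

lemma clamp_path_simp: "t \<in> {0..1} \<Longrightarrow> clamp_path \<eta> t = \<eta> t"
  by (simp add: clamp_path_def)

lemma clamp_path_in: "clamp_path \<eta> t \<in> \<eta> ` {0..1}"
  by (auto simp: clamp_path_def)

lemma lipschitz_clamp_path:
  assumes "L-lipschitz_on {0..1} \<eta>"
  shows "L-lipschitz_on UNIV (clamp_path \<eta>)"
proof (rule lipschitz_onI)
  fix x y :: real
  have "dist (clamp_path \<eta> x) (clamp_path \<eta> y) \<le> L * dist (max 0 (min 1 x)) (max 0 (min 1 y))"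
    unfolding clamp_path_def by (rule lipschitz_onD[OF assms]) auto
  also have "\<dots> \<le> L * dist x y"
    using lipschitz_on_nonneg[OF assms] by (intro mult_left_mono) (auto simp: dist_real_def)
  finally show "dist (clamp_path \<eta> x) (clamp_path \<eta> y) \<le> L * dist x y" .
qed (rule lipschitz_on_nonneg[OF assms])

lemma norm_forward_quotient_le:
  fixes \<eta> :: "real \<Rightarrow> 'a::real_normed_vector"
  assumes "L-lipschitz_on {0..1} \<eta>"
  shows "norm (forward_quotient \<eta> k t) \<le> L"
proof -
  have "dist (clamp_path \<eta> (t + 1 / real (Suc k))) (clamp_path \<eta> t) \<le> L * dist (t + 1 / real (Suc k)) t"
    by (rule lipschitz_onD[OF lipschitz_clamp_path[OF assms]]) auto
  then show ?thesis
    unfolding forward_quotient_def norm_scaleR dist_norm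
    by (simp add: pos_le_divide_eq mult.commute del: of_nat_Suc)
qed

lemma lipschitz_velocity_ae:
  fixes \<eta> :: "real \<Rightarrow> 'a::euclidean_space"
  assumes lip: "L-lipschitz_on {0..1} \<eta>"
  obtains N where "negligible N" "0 \<in> N" "1 \<in> N"
    "\<And>t. t \<in> {0..1} \<Longrightarrow> t \<notin> N \<Longrightarrow> (clamp_path \<eta> has_vector_derivative velocity \<eta> t) (at t)"
    "\<And>t. t \<in> {0..1} \<Longrightarrow> t \<notin> N \<Longrightarrow> (\<lambda>k. forward_quotient \<eta> k t) \<longlonglongrightarrow> velocity \<eta> t"
proof -
  define N where "N = {t. \<not> clamp_path \<eta> differentiable (at t)} \<union> {0, 1}"
  have "negligible N"
    unfolding N_def using lipschitz_differentiable_ae[OF lipschitz_clamp_path[OF lip]]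
    by (intro negligible_Un) auto
  moreover have D: "(clamp_path \<eta> has_vector_derivative velocity \<eta> t) (at t)"
    if t: "t \<in> {0..1}" "t \<notin> N" for t
  proof -
    obtain v where v: "(clamp_path \<eta> has_vector_derivative v) (at t)"
      using t unfolding N_def vector_derivative_works by (auto simp: vector_derivative_works)
    then have "(clamp_path \<eta> has_vector_derivative v) (at t within {0..1})"
      by (rule has_vector_derivative_at_within)
    then have "(\<eta> has_vector_derivative v) (at t within {0..1})"
      using t(1) by (rule has_vector_derivative_transform[rotated 2]) (simp_all add: clamp_path_simp)
    then have "velocity \<eta> t = v"
      using t(1) vector_derivative_within_cbox[of 0 1 t \<eta> v] by (simp add: cbox_interval)
    then show ?thesis using v by simp
  qed
  moreover have "(\<lambda>k. forward_quotient \<eta> k t) \<longlonglongrightarrow> velocity \<eta> t" if t: "t \<in> {0..1}" "t \<notin> N" for t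
  proof -
    have "((\<lambda>h. (clamp_path \<eta> (t + h) - clamp_path \<eta> t) /\<^sub>R h) \<longlongrightarrow> velocity \<eta> t) (at 0)"
      by (rule has_vector_derivative_quotient_tendsto[OF D[OF t]])
    moreover have "filterlim (\<lambda>k. 1 / real (Suc k)) (at 0) sequentially"
      by (intro filterlim_atI) (use LIMSEQ_inverse_real_of_nat in \<open>auto simp: inverse_eq_divide\<close>)
    ultimately have "((\<lambda>k. (clamp_path \<eta> (t + 1 / real (Suc k)) - clamp_path \<eta> t) /\<^sub>R (1 / real (Suc k))) \<longlongrightarrow> velocity \<eta> t) sequentially"
      by (rule filterlim_compose)
    then show ?thesis unfolding forward_quotient_def by (simp del: of_nat_Suc)
  qed
  ultimately show ?thesis using that[of N] unfolding N_def by blast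
qed

text \<open>Almost everywhere the velocity is the limit of the uniformly bounded forward quotients, which
  are continuous in time. Dominated convergence therefore gives the integrability of functions of
  position and velocity together with a formula for the integral; that formula plays the
  role of the fundamental theorem of calculus in what follows.\<close>

lemma integral_along_lipschitz_path:
  fixes \<eta> :: "real \<Rightarrow> 'a::euclidean_space" and h :: "'a \<Rightarrow> 'a \<Rightarrow> real"
  assumes lip: "L-lipschitz_on {0..1} \<eta>" and D: "\<eta> ` {0..1} \<subseteq> D"
    and h: "continuous_on (D \<times> UNIV) (\<lambda>(x, v). h x v)"
    and st: "0 \<le> s" "t \<le> 1"
  shows "(\<lambda>\<tau>. h (\<eta> \<tau>) (forward_quotient \<eta> k \<tau>)) integrable_on {s..t}"
    and "(\<lambda>\<tau>. h (\<eta> \<tau>) (velocity \<eta> \<tau>)) integrable_on {s..t}"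
    and "(\<lambda>k. integral {s..t} (\<lambda>\<tau>. h (\<eta> \<tau>) (forward_quotient \<eta> k \<tau>)))
           \<longlonglongrightarrow> integral {s..t} (\<lambda>\<tau>. h (\<eta> \<tau>) (velocity \<eta> \<tau>))"
proof -
  obtain N where N: "negligible N"
    and lim: "\<And>t. t \<in> {0..1} \<Longrightarrow> t \<notin> N \<Longrightarrow> (\<lambda>k. forward_quotient \<eta> k t) \<longlonglongrightarrow> velocity \<eta> t"
    using lipschitz_velocity_ae[OF lip] by metis
  have sub: "{s..t} \<subseteq> {0..1}" using st by auto
  have c\<eta>: "continuous_on {s..t} \<eta>"
    using lipschitz_on_continuous_on[OF lip] sub continuous_on_subset by blast
  have cc: "continuous_on UNIV (clamp_path \<eta>)"
    by (rule lipschitz_on_continuous_on[OF lipschitz_clamp_path[OF lip]])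
  have cq: "continuous_on {s..t} (forward_quotient \<eta> k)" for k
    unfolding forward_quotient_def
    by (intro continuous_intros continuous_on_compose2[OF cc]) auto
  have int: "(\<lambda>\<tau>. h (\<eta> \<tau>) (forward_quotient \<eta> k \<tau>)) integrable_on {s..t}" for k
  proof -
    have "continuous_on {s..t} (\<lambda>\<tau>. case (\<eta> \<tau>, forward_quotient \<eta> k \<tau>) of (x, v) \<Rightarrow> h x v)"
      by (rule continuous_on_compose2[OF h]) (use D sub in \<open>auto intro!: continuous_intros c\<eta> cq\<close>)
    then show ?thesis using integrable_continuous_real by auto
  qed
  then show "(\<lambda>\<tau>. h (\<eta> \<tau>) (forward_quotient \<eta> k \<tau>)) integrable_on {s..t}" .
  let ?K = "(\<eta> ` {0..1}) \<times> cball (0::'a) L"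
  have "compact ?K"
    by (intro compact_Times compact_continuous_image lipschitz_on_continuous_on[OF lip] compact_cball) auto
  moreover have "continuous_on ?K (\<lambda>(x, v). h x v)"
    using D by (intro continuous_on_subset[OF h]) auto
  ultimately have "bounded ((\<lambda>(x, v). h x v) ` ?K)"
    using compact_continuous_image compact_imp_bounded by blast
  then obtain B where B: "\<And>y. y \<in> (\<lambda>(x, v). h x v) ` ?K \<Longrightarrow> norm y \<le> B" unfolding bounded_iff by blast
  define F where "F k \<tau> = (if \<tau> \<in> N then 0 else h (\<eta> \<tau>) (forward_quotient \<eta> k \<tau>))" for k \<tau>
  define G where "G \<tau> = (if \<tau> \<in> N then 0 else h (\<eta> \<tau>) (velocity \<eta> \<tau>))" for \<tau>
  have B0: "0 \<le> B"
  proof -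
    have "(\<eta> 0, 0) \<in> ?K" using lipschitz_on_nonneg[OF lip] by auto
    then have "norm (h (\<eta> 0) 0) \<le> B" using B by force
    then show ?thesis using norm_ge_zero order_trans by blast
  qed
  have F1: "F k integrable_on {s..t}" for k
    by (rule integrable_spike[OF int N]) (simp add: F_def)
  have F2: "norm (F k \<tau>) \<le> B" if "\<tau> \<in> {s..t}" for k \<tau>
  proof (cases "\<tau> \<in> N")
    case False
    have "(\<eta> \<tau>, forward_quotient \<eta> k \<tau>) \<in> ?K"
      using that sub norm_forward_quotient_le[OF lip] by auto
    then have "h (\<eta> \<tau>) (forward_quotient \<eta> k \<tau>) \<in> (\<lambda>(x, v). h x v) ` ?K" by force
    then show ?thesis using B False unfolding F_def by auto
  qed (simp add: F_def B0)
  have F3: "(\<lambda>k. F k \<tau>) \<longlonglongrightarrow> G \<tau>" if "\<tau> \<in> {s..t}" for \<tau>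
  proof (cases "\<tau> \<in> N")
    case False
    have "continuous_on UNIV (\<lambda>v. case (\<eta> \<tau>, v) of (x, v) \<Rightarrow> h x v)"
      by (rule continuous_on_compose2[OF h]) (use D sub that in \<open>auto intro!: continuous_intros\<close>)
    then have isc: "isCont (h (\<eta> \<tau>)) (velocity \<eta> \<tau>)"
      by (simp add: continuous_on_eq_continuous_at)
    have "(\<lambda>k. forward_quotient \<eta> k \<tau>) \<longlonglongrightarrow> velocity \<eta> \<tau>"
      using False that sub by (intro lim) auto
    then have "(\<lambda>k. h (\<eta> \<tau>) (forward_quotient \<eta> k \<tau>)) \<longlonglongrightarrow> h (\<eta> \<tau>) (velocity \<eta> \<tau>)"
      by (rule isCont_tendsto_compose[OF isc])
    then show ?thesis using False unfolding F_def G_def by simp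
  qed (simp add: F_def G_def)
  have dc1: "G integrable_on {s..t}"
    by (rule dominated_convergence(1)[OF F1 integrable_const_ivl F2 F3])
  have dc2: "(\<lambda>k. integral {s..t} (F k)) \<longlonglongrightarrow> integral {s..t} G"
    by (rule dominated_convergence(2)[OF F1 integrable_const_ivl F2 F3])
  show "(\<lambda>\<tau>. h (\<eta> \<tau>) (velocity \<eta> \<tau>)) integrable_on {s..t}"
    by (rule integrable_spike[OF dc1 N]) (simp add: G_def)
  have "integral {s..t} (F k) = integral {s..t} (\<lambda>\<tau>. h (\<eta> \<tau>) (forward_quotient \<eta> k \<tau>))" for k
    by (rule integral_spike[OF N]) (simp add: F_def)
  moreover have "integral {s..t} G = integral {s..t} (\<lambda>\<tau>. h (\<eta> \<tau>) (velocity \<eta> \<tau>))"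
    by (rule integral_spike[OF N]) (simp add: G_def)
  ultimately show "(\<lambda>k. integral {s..t} (\<lambda>\<tau>. h (\<eta> \<tau>) (forward_quotient \<eta> k \<tau>)))
      \<longlonglongrightarrow> integral {s..t} (\<lambda>\<tau>. h (\<eta> \<tau>) (velocity \<eta> \<tau>))"
    using dc2 by simp
qed

section \<open>The Finsler distance\<close>

text \<open>Each \<^term>\<open>g x\<close> is a norm, except that \<^term>\<open>g x (- v)\<close> may differ from \<^term>\<open>g x v\<close>. The
  distances below are therefore not symmetric, and the order of their arguments is the direction of
  travel.\<close>

locale finsler =
  fixes D :: "'a::euclidean_space set" and g :: "'a \<Rightarrow> 'a \<Rightarrow> real" and c1 c2 :: real
  assumes compact_D: "compact D" and convex_D: "convex D"
    and g_cont: "continuous_on (D \<times> UNIV) (\<lambda>(x, v). g x v)"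
    and g_scale: "\<And>x c v. x \<in> D \<Longrightarrow> 0 \<le> c \<Longrightarrow> g x (c *\<^sub>R v) = c * g x v"
    and g_add: "\<And>x u v. x \<in> D \<Longrightarrow> g x (u + v) \<le> g x u + g x v"
    and c1_pos: "0 < c1" and c2_pos: "0 < c2"
    and g_lower: "\<And>x v. x \<in> D \<Longrightarrow> c1 * norm v \<le> g x v"
    and g_upper: "\<And>x v. x \<in> D \<Longrightarrow> g x v \<le> c2 * norm v"
begin

lemma g_nonneg: "x \<in> D \<Longrightarrow> 0 \<le> g x v"
  using g_lower[of x v] c1_pos by (meson less_imp_le mult_nonneg_nonneg norm_ge_zero order_trans)

text \<open>Uniform continuity on the compact set of unit velocities, extended by homogeneity.\<close>

lemma g_modulus:
  assumes "0 < e"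
  obtains \<delta> where "0 < \<delta>"
    "\<And>x z v. x \<in> D \<Longrightarrow> z \<in> D \<Longrightarrow> dist x z < \<delta> \<Longrightarrow> g z v \<le> g x v + e * norm v"
proof -
  let ?K = "D \<times> sphere (0::'a) 1"
  have "compact ?K" by (intro compact_Times compact_D compact_sphere)
  moreover have "continuous_on ?K (\<lambda>(x, v). g x v)"
    by (rule continuous_on_subset[OF g_cont]) auto
  ultimately have "uniformly_continuous_on ?K (\<lambda>(x, v). g x v)"
    using compact_uniformly_continuous by blast
  then obtain \<delta> where \<delta>: "\<delta> > 0" "\<And>y y'. y \<in> ?K \<Longrightarrow> y' \<in> ?K \<Longrightarrow> dist y' y < \<delta> \<Longrightarrow>
      dist ((\<lambda>(x, v). g x v) y') ((\<lambda>(x, v). g x v) y) < e"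
    unfolding uniformly_continuous_on_def using assms by meson
  have "g z v \<le> g x v + e * norm v" if xz: "x \<in> D" "z \<in> D" "dist x z < \<delta>" for x z v
  proof (cases "v = 0")
    case True
    then show ?thesis using g_scale[of x 0 0] g_scale[of z 0 0] xz by simp
  next
    case False
    define w where "w = v /\<^sub>R norm v"
    have w: "norm w = 1" "v = norm v *\<^sub>R w" using False unfolding w_def by auto
    have "dist (g z w) (g x w) < e"
      using \<delta>(2)[of "(x, w)" "(z, w)"] xz w(1) by (simp add: dist_Pair_Pair dist_commute)
    then have "g z w \<le> g x w + e" by (simp add: dist_real_def)
    then have "norm v * g z w \<le> norm v * (g x w + e)" by (intro mult_left_mono) auto
    moreover have "g z v = norm v * g z w" "g x v = norm v * g x w"
      using g_scale[of z "norm v" w] g_scale[of x "norm v" w] w(2) xz by simp_all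
    ultimately show ?thesis by (simp add: algebra_simps)
  qed
  then show ?thesis using that \<delta>(1) by blast
qed

text \<open>An upper bound for the length of the straight segment, equal to it to first order as the segment
  shrinks. The supremum over the segment decreases on a subsegment, so a part of a segment costs at
  most its proportional share (\<open>seg_cost_linepath\<close>); this turns chains into paths.\<close>

definition seg_cost :: "'a \<Rightarrow> 'a \<Rightarrow> real" where
  "seg_cost x y = (SUP z\<in>closed_segment x y. g z (y - x))"

lemma segment_in_D: "x \<in> D \<Longrightarrow> y \<in> D \<Longrightarrow> closed_segment x y \<subseteq> D"
  by (rule closed_segment_subset[OF _ _ convex_D])

lemma linepath_in_D: "x \<in> D \<Longrightarrow> y \<in> D \<Longrightarrow> 0 \<le> t \<Longrightarrow> t \<le> 1 \<Longrightarrow> linepath x y t \<in> D"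
  using segment_in_D[of x y] linepath_in_path[of t x y] by auto

lemma seg_cost_ge:
  assumes "x \<in> D" "y \<in> D" "z \<in> closed_segment x y"
  shows "g z (y - x) \<le> seg_cost x y"
  unfolding seg_cost_def
proof (rule cSUP_upper[OF assms(3)])
  show "bdd_above ((\<lambda>z. g z (y - x)) ` closed_segment x y)"
    using segment_in_D[OF assms(1,2)] g_upper[of _ "y - x"] by (auto intro!: bdd_aboveI2)
qed

lemma seg_cost_le:
  assumes "\<And>z. z \<in> closed_segment x y \<Longrightarrow> g z (y - x) \<le> C"
  shows "seg_cost x y \<le> C"
  unfolding seg_cost_def by (rule cSUP_least) (use assms in auto)

lemma seg_cost_bounds:
  assumes "x \<in> D" "y \<in> D"
  shows "c1 * norm (y - x) \<le> seg_cost x y" "seg_cost x y \<le> c2 * norm (y - x)"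
proof -
  show "c1 * norm (y - x) \<le> seg_cost x y"
    using seg_cost_ge[OF assms, of x] g_lower[of x "y - x"] assms by simp
  show "seg_cost x y \<le> c2 * norm (y - x)"
    using segment_in_D[OF assms] g_upper[of _ "y - x"] by (intro seg_cost_le) auto
qed

lemma seg_cost_linepath:
  assumes "x \<in> D" "y \<in> D" "0 \<le> s" "s \<le> t" "t \<le> 1"
  shows "seg_cost (linepath x y s) (linepath x y t) \<le> (t - s) * seg_cost x y"
proof (rule seg_cost_le)
  fix z assume z: "z \<in> closed_segment (linepath x y s) (linepath x y t)"
  have "closed_segment (linepath x y s) (linepath x y t) \<subseteq> closed_segment x y"
    using assms by (intro closed_segment_subset linepath_in_path) auto
  then have zz: "z \<in> closed_segment x y" using z by blast
  have "linepath x y t - linepath x y s = (t - s) *\<^sub>R (y - x)"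
    unfolding linepath_def by (simp add: algebra_simps)
  then have "g z (linepath x y t - linepath x y s) = (t - s) * g z (y - x)"
    using g_scale[of z "t - s" "y - x"] assms zz segment_in_D[OF assms(1,2)] by auto
  also have "\<dots> \<le> (t - s) * seg_cost x y"
    using assms seg_cost_ge[OF assms(1,2) zz] by (intro mult_left_mono) auto
  finally show "g z (linepath x y t - linepath x y s) \<le> (t - s) * seg_cost x y" .
qed

lemma seg_cost_local:
  assumes "0 < e"
  obtains \<delta> where "0 < \<delta>"
    "\<And>x y. x \<in> D \<Longrightarrow> y \<in> D \<Longrightarrow> dist x y < \<delta> \<Longrightarrow> seg_cost x y \<le> g x (y - x) + e * norm (y - x)"
proof -
  obtain \<delta> where \<delta>: "0 < \<delta>"
    "\<And>x z v. x \<in> D \<Longrightarrow> z \<in> D \<Longrightarrow> dist x z < \<delta> \<Longrightarrow> g z v \<le> g x v + e * norm v"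
    using g_modulus[OF assms] by metis
  have "seg_cost x y \<le> g x (y - x) + e * norm (y - x)" if "x \<in> D" "y \<in> D" "dist x y < \<delta>" for x y
  proof (rule seg_cost_le)
    fix z assume z: "z \<in> closed_segment x y"
    then have "z \<in> D" using segment_in_D that by blast
    moreover have "dist x z \<le> dist x y"
      using segment_bound(1)[OF z] by (simp add: dist_norm norm_minus_commute)
    ultimately show "g z (y - x) \<le> g x (y - x) + e * norm (y - x)" using \<delta>(2) that by auto
  qed
  then show ?thesis using that \<delta>(1) by blast
qed

text \<open>\<open>reach x y S\<close>: a polygonal chain in \<^term>\<open>D\<close> leads from \<^term>\<open>x\<close> to \<^term>\<open>y\<close> at total cost
  \<^term>\<open>S\<close>. The infimum of these costs is the path distance of \<^term>\<open>g\<close>; that it is also a lower bound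
  for the length of every Lipschitz path is the content of \<open>geo_dist_le_integral\<close> below.\<close>

inductive reach :: "'a \<Rightarrow> 'a \<Rightarrow> real \<Rightarrow> bool" where
  refl: "reach x x 0"
| step: "reach x y S \<Longrightarrow> z \<in> D \<Longrightarrow> reach x z (S + seg_cost y z)"

definition geo_dist :: "'a \<Rightarrow> 'a \<Rightarrow> real" where
  "geo_dist x y = Inf {S. reach x y S}"

lemma reach_in_D: "reach x y S \<Longrightarrow> x \<in> D \<Longrightarrow> y \<in> D"
  by (induction rule: reach.induct) auto

lemma reach_ge: "reach x y S \<Longrightarrow> x \<in> D \<Longrightarrow> c1 * norm (y - x) \<le> S"
proof (induction rule: reach.induct)
  case (step x y S z)
  have "y \<in> D" using step by (auto intro: reach_in_D)
  then have "c1 * norm (z - y) \<le> seg_cost y z" using step by (intro seg_cost_bounds) auto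
  moreover have "c1 * norm (z - x) \<le> c1 * norm (y - x) + c1 * norm (z - y)"
    using norm_triangle_ineq[of "y - x" "z - y"] c1_pos
    by (simp add: distrib_left[symmetric] mult_left_mono)
  ultimately show ?case using step by linarith
qed simp

lemma reach_trans: "reach y z T \<Longrightarrow> reach x y S \<Longrightarrow> reach x z (S + T)"
proof (induction rule: reach.induct)
  case (step y z T w)
  then show ?case using reach.step[of x z "S + T" w] by (simp add: add.assoc)
qed simp

lemma reach_segment: "y \<in> D \<Longrightarrow> reach x y (seg_cost x y)"
  using reach.step[OF reach.refl, of y x] by simp

lemma geo_dist_le_reach:
  assumes "x \<in> D" "reach x y S"
  shows "geo_dist x y \<le> S"
  unfolding geo_dist_def
proof (rule cInf_lower)
  show "bdd_below {S. reach x y S}"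
    using reach_ge[OF _ assms(1), of y] by (auto intro!: bdd_belowI)
qed (use assms in simp)

lemma geo_dist_greatest:
  assumes "y \<in> D" "\<And>S. reach x y S \<Longrightarrow> C \<le> S"
  shows "C \<le> geo_dist x y"
  unfolding geo_dist_def using assms reach_segment[OF assms(1), of x] by (intro cInf_greatest) auto

lemma geo_dist_approx:
  assumes "y \<in> D" "0 < e"
  obtains S where "reach x y S" "S < geo_dist x y + e"
proof -
  have "\<exists>S. reach x y S \<and> S < geo_dist x y + e"
  proof (rule ccontr)
    assume "\<not> (\<exists>S. reach x y S \<and> S < geo_dist x y + e)"
    then have "geo_dist x y + e \<le> geo_dist x y" by (intro geo_dist_greatest[OF assms(1)]) (auto simp: not_less)
    then show False using assms by simp
  qed
  then show ?thesis using that by blast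
qed

lemma geo_dist_le_seg_cost: "x \<in> D \<Longrightarrow> y \<in> D \<Longrightarrow> geo_dist x y \<le> seg_cost x y"
  by (intro geo_dist_le_reach reach_segment)

lemma geo_dist_upper: "x \<in> D \<Longrightarrow> y \<in> D \<Longrightarrow> geo_dist x y \<le> c2 * dist x y"
  using geo_dist_le_seg_cost seg_cost_bounds(2) by (fastforce simp: dist_norm norm_minus_commute)

lemma geo_dist_lower: "x \<in> D \<Longrightarrow> y \<in> D \<Longrightarrow> c1 * dist x y \<le> geo_dist x y"
  using reach_ge[of x y] by (intro geo_dist_greatest) (auto simp: dist_norm norm_minus_commute)

lemma geo_dist_nonneg: "x \<in> D \<Longrightarrow> y \<in> D \<Longrightarrow> 0 \<le> geo_dist x y"
  using geo_dist_lower[of x y] c1_pos by (meson less_imp_le mult_nonneg_nonneg zero_le_dist order_trans)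

lemma geo_dist_refl: "x \<in> D \<Longrightarrow> geo_dist x x = 0"
  using geo_dist_upper[of x x] geo_dist_nonneg[of x x] by simp

lemma geo_dist_triangle:
  assumes "x \<in> D" "y \<in> D" "z \<in> D"
  shows "geo_dist x z \<le> geo_dist x y + geo_dist y z"
proof (rule field_le_epsilon)
  fix e :: real assume "0 < e"
  then obtain S T where "reach x y S" "S < geo_dist x y + e/2" "reach y z T" "T < geo_dist y z + e/2"
    using geo_dist_approx[of y "e/2" x] geo_dist_approx[of z "e/2" y] assms by (metis half_gt_zero)
  then show "geo_dist x z \<le> geo_dist x y + geo_dist y z + e"
    using geo_dist_le_reach[OF assms(1) reach_trans, of y z T S] by linarith
qed

text \<open>Infinitesimally the distance is at least \<^term>\<open>g\<close>. A chain of cost less than \<^term>\<open>c1 * \<delta>\<close> never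
  leaves the \<^term>\<open>\<delta>\<close>-ball around its start \<^term>\<open>x\<close>, so \<^term>\<open>g\<close> may be evaluated at \<^term>\<open>x\<close> along
  all of it with a small relative error, and then subadditivity bounds the sum from below by the
  value of \<^term>\<open>g x\<close> at the total displacement.\<close>

lemma geo_dist_local:
  assumes e: "0 < e"
  obtains \<delta> where "0 < \<delta>"
    "\<And>x y. x \<in> D \<Longrightarrow> y \<in> D \<Longrightarrow> dist x y < \<delta> \<Longrightarrow> g x (y - x) \<le> geo_dist x y + e * norm (y - x)"
proof -
  \<comment> \<open>A relative error \<open>k\<close> in a distance of at most \<open>c2 * norm (y - x)\<close> is an error
    \<open>e * norm (y - x)\<close>.\<close>
  define k where "k = e / c2"
  have k: "k > 0" using e c2_pos by (simp add: k_def)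
  obtain \<delta>0 where \<delta>0: "0 < \<delta>0"
    "\<And>x z v. x \<in> D \<Longrightarrow> z \<in> D \<Longrightarrow> dist x z < \<delta>0 \<Longrightarrow> g z v \<le> g x v + (k * c1) * norm v"
    using g_modulus[of "k * c1"] k c1_pos by (metis mult_pos_pos)
  have short: "g x (y - x) \<le> (1 + k) * S" if "reach x y S" "x \<in> D" "S < c1 * \<delta>0" for x y S
    using that
  proof (induction rule: reach.induct)
    case (refl x)
    then show ?case using g_scale[of x 0 0] by simp
  next
    case (step x y S z)
    have yD: "y \<in> D" using step by (auto intro: reach_in_D)
    have l: "c1 * norm (z - y) \<le> seg_cost y z" "g y (z - y) \<le> seg_cost y z"
      using seg_cost_bounds(1)[OF yD, of z] seg_cost_ge[OF yD, of z y] step by auto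
    have "0 \<le> c1 * norm (z - y)" using c1_pos by simp
    then have S: "S < c1 * \<delta>0" using step.prems(2) l(1) by linarith
    have "c1 * norm (y - x) \<le> S" using step by (intro reach_ge) auto
    then have "c1 * norm (y - x) < c1 * \<delta>0" using S by linarith
    then have "norm (y - x) < \<delta>0" using c1_pos by simp
    then have "g x (z - y) \<le> g y (z - y) + k * c1 * norm (z - y)"
      using step yD by (intro \<delta>0(2)) (auto simp: dist_norm)
    also have "\<dots> \<le> seg_cost y z + k * seg_cost y z"
      using l k by (intro add_mono) (simp_all add: mult.assoc)
    finally have "g x (z - y) \<le> (1 + k) * seg_cost y z" by (simp add: algebra_simps)
    moreover have "g x (z - x) \<le> g x (y - x) + g x (z - y)"
      using g_add[of x "y - x" "z - y"] step by simp
    moreover have "g x (y - x) \<le> (1 + k) * S" using step S by simp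
    ultimately show ?case by (simp add: algebra_simps)
  qed
  \<comment> \<open>With this choice every chain of cost at least \<open>c1 * \<delta>0\<close> already costs more than
    \<open>g x (y - x)\<close>.\<close>
  define \<delta> where "\<delta> = c1 * \<delta>0 / c2"
  have "g x (y - x) \<le> geo_dist x y + e * norm (y - x)" if xy: "x \<in> D" "y \<in> D" "dist x y < \<delta>" for x y
  proof -
    have "g x (y - x) / (1 + k) \<le> geo_dist x y"
    proof (rule geo_dist_greatest[OF xy(2)])
      fix S assume S: "reach x y S"
      have S0: "0 \<le> S"
        using reach_ge[OF S xy(1)] c1_pos by (meson less_imp_le mult_nonneg_nonneg norm_ge_zero order_trans)
      have "g x (y - x) \<le> (1 + k) * S"
      proof (cases "S < c1 * \<delta>0")
        case False
        have "g x (y - x) \<le> c2 * dist x y"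
          using g_upper[OF xy(1), of "y - x"] by (simp add: dist_norm norm_minus_commute)
        also have "\<dots> \<le> c1 * \<delta>0" using xy(3) c2_pos unfolding \<delta>_def by (simp add: field_simps)
        also have "\<dots> \<le> S" using False by simp
        also have "S \<le> (1 + k) * S" using k S0 by (simp add: distrib_right)
        finally show ?thesis .
      qed (use short S xy in auto)
      then show "g x (y - x) / (1 + k) \<le> S" using k by (simp add: field_simps)
    qed
    then have "g x (y - x) \<le> geo_dist x y + k * geo_dist x y" using k by (simp add: field_simps)
    also have "k * geo_dist x y \<le> k * (c2 * dist x y)"
      using k geo_dist_upper[OF xy(1,2)] by (intro mult_left_mono) auto
    also have "\<dots> = e * norm (y - x)" using c2_pos by (simp add: k_def dist_norm norm_minus_commute)
    finally show ?thesis by simp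
  qed
  moreover have "\<delta> > 0" using \<delta>0(1) c1_pos c2_pos by (simp add: \<delta>_def)
  ultimately show ?thesis using that by blast
qed

text \<open>Each segment is traversed in a time equal to its cost. The speed is measured with the distance
  itself, so concatenation needs only the triangle inequality.\<close>

lemma reach_unit_speed_path:
  assumes "reach x y S" "x \<in> D"
  shows "\<exists>\<eta>. \<eta> 0 = x \<and> \<eta> S = y \<and> \<eta> ` {0..S} \<subseteq> D \<and>
    (\<forall>s t. 0 \<le> s \<longrightarrow> s \<le> t \<longrightarrow> t \<le> S \<longrightarrow> geo_dist (\<eta> s) (\<eta> t) \<le> t - s)"
  using assms
proof (induction rule: reach.induct)
  case (refl x)
  then show ?case by (intro exI[of _ "\<lambda>_. x"]) (auto simp: geo_dist_refl)
next
  case (step x y S z)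
  then obtain \<eta> where \<eta>: "\<eta> 0 = x" "\<eta> S = y" "\<eta> ` {0..S} \<subseteq> D"
    "\<And>s t. 0 \<le> s \<Longrightarrow> s \<le> t \<Longrightarrow> t \<le> S \<Longrightarrow> geo_dist (\<eta> s) (\<eta> t) \<le> t - s" by blast
  have yD: "y \<in> D" and zD: "z \<in> D" using step by (auto intro: reach_in_D)
  have S0: "0 \<le> S"
    using reach_ge[OF step(1)] step c1_pos by (meson less_imp_le mult_nonneg_nonneg norm_ge_zero order_trans)
  define T where "T = seg_cost y z"
  show ?case
  proof (cases "T = 0")
    case True
    then have "c1 * norm (z - y) \<le> 0" using seg_cost_bounds(1)[OF yD zD] by (simp add: T_def)
    then have "z = y" using c1_pos by (simp add: mult_le_0_iff)
    then show ?thesis using \<eta> True unfolding T_def by auto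
  next
    case False
    have "0 \<le> T"
      using seg_cost_bounds(1)[OF yD zD] c1_pos unfolding T_def
      by (meson less_imp_le mult_nonneg_nonneg norm_ge_zero order_trans)
    then have T: "T > 0" using False by simp
    define \<theta> where "\<theta> t = (if t \<le> S then \<eta> t else linepath y z ((t - S) / T))" for t
    have frac: "0 \<le> (t - S) / T" "(t - S) / T \<le> 1" if "S \<le> t" "t \<le> S + T" for t
      using that T by (auto simp: field_simps)
    have \<theta>_seg: "\<theta> t = linepath y z ((t - S) / T)" if "S \<le> t" for t
      using that \<eta>(2) unfolding \<theta>_def by (auto simp: linepath_def)
    have \<theta>_in: "\<theta> t \<in> D" if "0 \<le> t" "t \<le> S + T" for t
      using that \<eta>(3) linepath_in_D[OF yD zD frac] unfolding \<theta>_def by auto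
    have seg: "geo_dist (\<theta> s) (\<theta> t) \<le> t - s" if "S \<le> s" "s \<le> t" "t \<le> S + T" for s t
    proof -
      have "geo_dist (\<theta> s) (\<theta> t) \<le> seg_cost (\<theta> s) (\<theta> t)"
        using that S0 by (intro geo_dist_le_seg_cost \<theta>_in) auto
      also have "\<dots> \<le> ((t - S) / T - (s - S) / T) * seg_cost y z"
        using that frac[of s] frac[of t] T
        by (simp only: \<theta>_seg[of s] \<theta>_seg[of t] order_trans[OF that(1,2)])
           (intro seg_cost_linepath[OF yD zD]; simp add: divide_right_mono)
      also have "\<dots> = t - s" using T unfolding T_def[symmetric] by (simp add: field_simps)
      finally show ?thesis .
    qed
    have "geo_dist (\<theta> s) (\<theta> t) \<le> t - s" if st: "0 \<le> s" "s \<le> t" "t \<le> S + T" for s t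
    proof -
      consider "t \<le> S" | "S \<le> s" | "s < S" "S < t" by linarith
      then show ?thesis
      proof cases
        case 1
        then show ?thesis using \<eta>(4)[of s t] st unfolding \<theta>_def by auto
      next
        case 2
        then show ?thesis using seg st by blast
      next
        case 3
        have "geo_dist (\<theta> s) (\<theta> t) \<le> geo_dist (\<theta> s) (\<theta> S) + geo_dist (\<theta> S) (\<theta> t)"
          using st 3 S0 T by (intro geo_dist_triangle \<theta>_in) auto
        also have "geo_dist (\<theta> s) (\<theta> S) \<le> S - s" using \<eta>(4)[of s S] 3 st unfolding \<theta>_def by auto
        also have "geo_dist (\<theta> S) (\<theta> t) \<le> t - S" using seg[of S t] 3 st by auto
        finally show ?thesis by simp
      qed
    qed
    moreover have "\<theta> 0 = x" "\<theta> (S + T) = z"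
      using \<eta>(1) S0 T unfolding \<theta>_def by (auto simp: linepath_def)
    ultimately show ?thesis using \<theta>_in unfolding T_def[symmetric] by (intro exI[of _ \<theta>]) auto
  qed
qed

lemma lipschitz_of_geo_dist_le:
  assumes "\<gamma> ` {0..1} \<subseteq> D" "0 \<le> B"
    and "\<And>s t. 0 \<le> s \<Longrightarrow> s \<le> t \<Longrightarrow> t \<le> 1 \<Longrightarrow> geo_dist (\<gamma> s) (\<gamma> t) \<le> B * (t - s)"
  shows "(B / c1)-lipschitz_on {0..1} \<gamma>"
proof (rule lipschitz_onI)
  have *: "dist (\<gamma> s) (\<gamma> t) \<le> B / c1 * (t - s)" if "0 \<le> s" "s \<le> t" "t \<le> 1" for s t
  proof -
    have "c1 * dist (\<gamma> s) (\<gamma> t) \<le> B * (t - s)"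
      using geo_dist_lower[of "\<gamma> s" "\<gamma> t"] assms(3)[OF that] assms(1) that by (force simp: image_subset_iff)
    then show ?thesis using c1_pos by (simp add: field_simps)
  qed
  fix s t :: real assume "s \<in> {0..1}" "t \<in> {0..1}"
  then show "dist (\<gamma> s) (\<gamma> t) \<le> B / c1 * dist s t"
    using *[of s t] *[of t s] by (cases "s \<le> t") (auto simp: dist_commute dist_real_def)
qed (use assms c1_pos in simp)

lemma geo_dist_limit_le:
  assumes lim: "(\<lambda>n. x n) \<longlonglongrightarrow> x'" "(\<lambda>n. y n) \<longlonglongrightarrow> y'"
    and D: "\<And>n. x n \<in> D" "\<And>n. y n \<in> D"
    and le: "\<And>e. 0 < e \<Longrightarrow> \<forall>\<^sub>F n in sequentially. geo_dist (x n) (y n) \<le> B + e"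
  shows "geo_dist x' y' \<le> B"
proof (rule field_le_epsilon)
  fix e :: real assume e: "0 < e"
  have cl: "closed D" using compact_D by (rule compact_imp_closed)
  have x'y': "x' \<in> D" "y' \<in> D" using closed_sequentially[OF cl] lim D by blast+
  define d where "d = e / (4 * c2)"
  have d: "d > 0" "c2 * d = e / 4" using e c2_pos by (auto simp: d_def)
  have "\<forall>\<^sub>F n in sequentially. dist (x n) x' < d" "\<forall>\<^sub>F n in sequentially. dist (y n) y' < d"
    using lim d tendstoD by blast+
  moreover have "\<forall>\<^sub>F n in sequentially. geo_dist (x n) (y n) \<le> B + e / 2" using le[of "e/2"] e by simp
  ultimately have "\<forall>\<^sub>F n in sequentially. dist (x n) x' < d \<and> dist (y n) y' < d \<and> geo_dist (x n) (y n) \<le> B + e / 2"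
    by eventually_elim simp
  then obtain n where n: "dist (x n) x' < d" "dist (y n) y' < d" "geo_dist (x n) (y n) \<le> B + e / 2"
    using eventually_happens'[of sequentially] by auto
  have "geo_dist x' y' \<le> geo_dist x' (x n) + geo_dist (x n) (y n) + geo_dist (y n) y'"
    using geo_dist_triangle[of x' "x n" y'] geo_dist_triangle[of "x n" "y n" y'] D x'y' by fastforce
  moreover have "geo_dist x' (x n) \<le> c2 * d" "geo_dist (y n) y' \<le> c2 * d"
    using geo_dist_upper[of x' "x n"] geo_dist_upper[of "y n" y'] D x'y' n(1,2) c2_pos
    by (smt (verit) dist_commute mult_left_mono)+
  ultimately show "geo_dist x' y' \<le> B + e" using n(3) d(2) by linarith
qed

text \<open>Chains of nearly minimal cost, run at constant speed in unit time, are uniformly Lipschitz; by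
  the Arzela--Ascoli theorem they have a limit point, and the speed bound passes to the limit because
  the distance is continuous.\<close>

lemma geodesic_exists:
  assumes ab: "a \<in> D" "b \<in> D"
  obtains \<gamma> where "\<gamma> 0 = a" "\<gamma> 1 = b" "\<gamma> ` {0..1} \<subseteq> D"
    "\<And>s t. 0 \<le> s \<Longrightarrow> s \<le> t \<Longrightarrow> t \<le> 1 \<Longrightarrow> geo_dist (\<gamma> s) (\<gamma> t) \<le> geo_dist a b * (t - s)"
proof -
  define A where "A = geo_dist a b"
  have A0: "0 \<le> A" unfolding A_def by (rule geo_dist_nonneg[OF ab])
  have "\<exists>S. reach a b S \<and> S < A + 1 / real (Suc n)" for n
    using geo_dist_approx[OF ab(2), of "1 / real (Suc n)" a] unfolding A_def by (metis of_nat_0_less_iff zero_less_Suc zero_less_divide_1_iff)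
  then obtain S where S: "\<And>n. reach a b (S n)" "\<And>n. S n < A + 1 / real (Suc n)" by metis
  have SA: "A \<le> S n" for n unfolding A_def using geo_dist_le_reach[OF ab(1) S(1)] .
  have "\<exists>\<eta>. \<eta> 0 = a \<and> \<eta> (S n) = b \<and> \<eta> ` {0..S n} \<subseteq> D \<and>
    (\<forall>s t. 0 \<le> s \<longrightarrow> s \<le> t \<longrightarrow> t \<le> S n \<longrightarrow> geo_dist (\<eta> s) (\<eta> t) \<le> t - s)" for n
    by (rule reach_unit_speed_path[OF S(1) ab(1)])
  then obtain \<eta> where \<eta>: "\<And>n. \<eta> n 0 = a" "\<And>n. \<eta> n (S n) = b" "\<And>n. \<eta> n ` {0..S n} \<subseteq> D"
    "\<And>n s t. 0 \<le> s \<Longrightarrow> s \<le> t \<Longrightarrow> t \<le> S n \<Longrightarrow> geo_dist (\<eta> n s) (\<eta> n t) \<le> t - s" by metis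
  have S0: "0 \<le> S n" for n using A0 SA[of n] by linarith
  define \<gamma> where "\<gamma> n t = \<eta> n (S n * t)" for n t
  have \<gamma>_in: "\<gamma> n t \<in> D" if "0 \<le> t" "t \<le> 1" for n t
  proof -
    have "S n * t \<in> {0..S n}" using S0[of n] that by (auto simp: mult_left_le)
    then show ?thesis using \<eta>(3)[of n] unfolding \<gamma>_def by blast
  qed
  have \<gamma>_geo_dist: "geo_dist (\<gamma> n s) (\<gamma> n t) \<le> S n * (t - s)" if "0 \<le> s" "s \<le> t" "t \<le> 1" for n s t
    using \<eta>(4)[of "S n * s" "S n * t" n] that S0[of n] unfolding \<gamma>_def
    by (simp add: mult_left_mono mult_left_le right_diff_distrib)
  have S1: "S n \<le> A + 1" for n
    using S(2)[of n] by (smt (verit) of_nat_Suc of_nat_0_le_iff divide_le_eq_1)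
  have lip: "((A + 1) / c1)-lipschitz_on {0..1} (\<gamma> n)" for n
  proof (rule lipschitz_of_geo_dist_le)
    fix s t :: real assume st: "0 \<le> s" "s \<le> t" "t \<le> 1"
    show "geo_dist (\<gamma> n s) (\<gamma> n t) \<le> (A + 1) * (t - s)"
      using \<gamma>_geo_dist[OF st, of n] mult_right_mono[OF S1[of n], of "t - s"] st by linarith
  qed (use \<gamma>_in A0 in auto)
  obtain K where K: "\<And>x. x \<in> D \<Longrightarrow> norm x \<le> K"
    using compact_imp_bounded[OF compact_D] unfolding bounded_iff by blast
  define L where "L = (A + 1) / c1"
  have L: "L > 0" using A0 c1_pos by (simp add: L_def)
  obtain \<gamma>' k where k: "continuous_on {0..1} \<gamma>'" "strict_mono (k :: nat \<Rightarrow> nat)"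
    "\<And>e. 0 < e \<Longrightarrow> \<exists>N. \<forall>n x. n \<ge> N \<and> x \<in> {0..1} \<longrightarrow> norm (\<gamma> (k n) x - \<gamma>' x) < e"
  proof (rule Arzela_Ascoli[of "{0..1::real}" \<gamma> K])
    fix x e :: real assume xe: "x \<in> {0..1}" "0 < e"
    show "\<exists>d>0. \<forall>n y. y \<in> {0..1} \<and> norm (x - y) < d \<longrightarrow> norm (\<gamma> n x - \<gamma> n y) < e"
    proof (intro exI[of _ "e / L"] conjI allI impI)
      fix n y assume y: "y \<in> {0..1} \<and> norm (x - y) < e / L"
      have "norm (\<gamma> n x - \<gamma> n y) \<le> L * norm (x - y)"
        using lipschitz_onD[OF lip[of n, folded L_def] xe(1), of y] y by (simp add: dist_norm)
      also have "\<dots> < e" using y L by (simp add: field_simps)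
      finally show "norm (\<gamma> n x - \<gamma> n y) < e" .
    qed (use xe L in simp)
  qed (use K \<gamma>_in in auto)
  have lim: "(\<lambda>n. \<gamma> (k n) t) \<longlonglongrightarrow> \<gamma>' t" if "0 \<le> t" "t \<le> 1" for t
    unfolding LIMSEQ_iff using k(3) that by (meson atLeastAtMost_iff)
  have "\<gamma>' 0 = a" using LIMSEQ_unique[OF lim[of 0]] \<eta>(1) by (simp add: \<gamma>_def)
  moreover have "\<gamma>' 1 = b" using LIMSEQ_unique[OF lim[of 1]] \<eta>(2) by (simp add: \<gamma>_def)
  moreover have "\<gamma>' ` {0..1} \<subseteq> D"
    using closed_sequentially[OF compact_imp_closed[OF compact_D]] lim \<gamma>_in by fastforce
  moreover have "geo_dist (\<gamma>' s) (\<gamma>' t) \<le> A * (t - s)" if st: "0 \<le> s" "s \<le> t" "t \<le> 1" for s t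
  proof (rule geo_dist_limit_le[OF lim[of s] lim[of t]])
    fix e :: real assume e: "0 < e"
    have "\<forall>\<^sub>F n in sequentially. 1 / real (Suc n) < e"
      using order_tendstoD(2)[OF LIMSEQ_inverse_real_of_nat e] by (simp add: inverse_eq_divide)
    then have "\<forall>\<^sub>F n in sequentially. 1 / real (Suc (k n)) < e"
      using eventually_subseq[OF k(2)] by blast
    then show "\<forall>\<^sub>F n in sequentially. geo_dist (\<gamma> (k n) s) (\<gamma> (k n) t) \<le> A * (t - s) + e"
    proof eventually_elim
      case (elim n)
      have "S (k n) * (t - s) \<le> (A + e) * (t - s)"
        using S(2)[of "k n"] elim st by (intro mult_right_mono) auto
      also have "\<dots> \<le> A * (t - s) + e" using st e by (simp add: distrib_right mult_left_le)
      finally show ?case using \<gamma>_geo_dist[OF st, of "k n"] by linarith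
    qed
  qed (use \<gamma>_in st in auto)
  ultimately show ?thesis using that unfolding A_def by blast
qed

end

section \<open>Action and distance\<close>

text \<open>The power function lies above its tangents: this is Young's inequality for
  \<^term>\<open>x * y powr (p - 1)\<close>.\<close>

lemma powr_tangent_le:
  fixes x y p :: real
  assumes "1 < p" "0 \<le> x" "0 \<le> y"
  shows "y powr p + p * y powr (p - 1) * (x - y) \<le> x powr p"
proof -
  define q where "q = p / (p - 1)"
  have q: "q > 1" "1 / p + 1 / q = 1" "(p - 1) * q = p" "p / q = p - 1"
    using assms(1) unfolding q_def by (auto simp: field_simps)
  have y: "y powr (p - 1) * y = y powr p"
    using assms by (cases "y = 0") (auto simp: powr_mult_base mult.commute[of _ y])
  have "x * y powr (p - 1) \<le> x powr p / p + (y powr (p - 1)) powr q / q"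
    using assms q by (intro Youngs_inequality) auto
  also have "(y powr (p - 1)) powr q = y powr p" by (simp add: powr_powr q(3))
  finally have "p * (x * y powr (p - 1)) \<le> p * (x powr p / p + y powr p / q)"
    using assms(1) by (intro mult_left_mono) auto
  also have "\<dots> = x powr p + (p / q) * y powr p" using assms(1) by (simp add: field_simps)
  also have "\<dots> = x powr p + (p - 1) * y powr p" by (simp only: q(4))
  finally have "p * (x * y powr (p - 1)) \<le> x powr p + (p - 1) * y powr p" .
  then show ?thesis using y by (simp add: algebra_simps)
qed

lemma integral_forward_difference:
  fixes \<phi> :: "real \<Rightarrow> real"
  assumes c: "continuous_on UNIV \<phi>" and st: "s \<le> t" and h: "0 \<le> h"
  shows "integral {s..t} (\<lambda>\<tau>. \<phi> (\<tau> + h) - \<phi> \<tau>) = integral {t..t+h} \<phi> - integral {s..s+h} \<phi>"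
proof -
  have int: "\<phi> integrable_on {x..y}" for x y
    by (intro integrable_continuous_real continuous_on_subset[OF c]) auto
  have ch: "continuous_on {s..t} (\<lambda>\<tau>. \<phi> (\<tau> + h))"
    by (rule continuous_on_compose2[OF c]) (auto intro!: continuous_intros)
  have "integral {s..t} (\<lambda>\<tau>. \<phi> (\<tau> + h)) = integral {s + h..t + h} \<phi>"
    using integral_shift[of s h t \<phi>] continuous_on_subset[OF c] by (simp add: o_def)
  moreover have "integral {s..s+h} \<phi> + integral {s+h..t+h} \<phi> = integral {s..t+h} \<phi>"
    using st h by (intro Henstock_Kurzweil_Integration.integral_combine int) auto
  moreover have "integral {s..t} \<phi> + integral {t..t+h} \<phi> = integral {s..t+h} \<phi>"
    using st h by (intro Henstock_Kurzweil_Integration.integral_combine int) auto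
  moreover have "integral {s..t} (\<lambda>\<tau>. \<phi> (\<tau> + h) - \<phi> \<tau>) = integral {s..t} (\<lambda>\<tau>. \<phi> (\<tau> + h)) - integral {s..t} \<phi>"
    by (intro Henstock_Kurzweil_Integration.integral_diff int integrable_continuous_real ch)
  ultimately show ?thesis by linarith
qed

text \<open>The integrand of the action is the \<^term>\<open>p\<close>-th power of the Finsler norm.\<close>

locale finsler_action = finsler D g c1 c2 for D :: "'a::euclidean_space set" and g c1 c2 +
  fixes f :: "'a \<Rightarrow> 'a \<Rightarrow> real" and p :: real
  assumes p_gt_1: "1 < p" and f_eq: "\<And>x v. x \<in> D \<Longrightarrow> f x v = g x v powr p"
    and f_cont: "continuous_on (D \<times> UNIV) (\<lambda>(x, v). f x v)"
begin

lemma path_action_le_ae: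
  assumes lip: "L-lipschitz_on {0..1} \<eta>" and D: "\<eta> ` {0..1} \<subseteq> D" and N: "negligible N"
    and le: "\<And>t. t \<in> {0..1} \<Longrightarrow> t \<notin> N \<Longrightarrow> f (\<eta> t) (velocity \<eta> t) \<le> C"
  shows "path_action f \<eta> \<le> C"
proof -
  let ?f = "\<lambda>t. f (\<eta> t) (velocity \<eta> t)"
  let ?F = "\<lambda>t. if t \<in> N then C else ?f t"
  have int: "?f integrable_on {0..1}"
    by (rule integral_along_lipschitz_path(2)[OF lip D f_cont]) auto
  have "path_action f \<eta> = integral {0..1} ?F"
    unfolding path_action_def by (rule integral_spike[OF N]) simp
  also have "\<dots> \<le> integral {0..1} (\<lambda>_::real. C)"
  proof (rule integral_le)
    show "?F integrable_on {0..1}" by (rule integrable_spike[OF int N]) simp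
  qed (use le in auto)
  finally show ?thesis by simp
qed

lemma path_action_ge_ae:
  assumes lip: "L-lipschitz_on {0..1} \<eta>" and D: "\<eta> ` {0..1} \<subseteq> D" and N: "negligible N"
    and le: "\<And>t. t \<in> {0..1} \<Longrightarrow> t \<notin> N \<Longrightarrow> C \<le> f (\<eta> t) (velocity \<eta> t)"
  shows "C \<le> path_action f \<eta>"
proof -
  let ?f = "\<lambda>t. f (\<eta> t) (velocity \<eta> t)"
  let ?F = "\<lambda>t. if t \<in> N then C else ?f t"
  have int: "?f integrable_on {0..1}"
    by (rule integral_along_lipschitz_path(2)[OF lip D f_cont]) auto
  have "integral {0..1} (\<lambda>_::real. C) \<le> integral {0..1} ?F"
  proof (rule integral_le)
    show "?F integrable_on {0..1}" by (rule integrable_spike[OF int N]) simp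
  qed (use le in auto)
  also have "integral {0..1} ?F = path_action f \<eta>"
    unfolding path_action_def by (rule integral_spike[OF N, symmetric]) simp
  finally show ?thesis by simp
qed

text \<open>A Lipschitz path is at least as long as the distance that it travels. The function
  \<open>\<phi> \<tau> = geo_dist (\<eta> s) (\<eta> \<tau>)\<close> has forward difference quotients bounded by \<^term>\<open>g\<close> of the forward
  quotients of the path, up to an error that vanishes with the step. Integrating these quotients over
  \<^term>\<open>{s..t}\<close> leaves two averages of \<open>\<phi>\<close>, one at each end, which tend to \<open>\<phi> t\<close> and \<open>\<phi> s = 0\<close>.\<close>

lemma geo_dist_le_integral:
  assumes lip: "L-lipschitz_on {0..1} \<eta>" and D: "\<eta> ` {0..1} \<subseteq> D"
    and st: "0 \<le> s" "s \<le> t" "t \<le> 1"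
  shows "geo_dist (\<eta> s) (\<eta> t) \<le> integral {s..t} (\<lambda>\<tau>. g (\<eta> \<tau>) (velocity \<eta> \<tau>))"
proof -
  let ?I = "integral {s..t} (\<lambda>\<tau>. g (\<eta> \<tau>) (velocity \<eta> \<tau>))"
  let ?c = "clamp_path \<eta>"
  have L: "0 \<le> L" by (rule lipschitz_on_nonneg[OF lip])
  have clip: "L-lipschitz_on UNIV ?c" by (rule lipschitz_clamp_path[OF lip])
  have cD: "?c \<tau> \<in> D" for \<tau> using clamp_path_in[of \<eta> \<tau>] D by blast
  define \<phi> where "\<phi> \<tau> = geo_dist (\<eta> s) (?c \<tau>)" for \<tau>
  have sD: "\<eta> s \<in> D" using D st by auto
  have step: "\<phi> \<tau> - \<phi> \<sigma> \<le> c2 * L * dist \<sigma> \<tau>" for \<sigma> \<tau>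
  proof -
    have "\<phi> \<tau> \<le> \<phi> \<sigma> + geo_dist (?c \<sigma>) (?c \<tau>)" unfolding \<phi>_def by (intro geo_dist_triangle sD cD)
    also have "geo_dist (?c \<sigma>) (?c \<tau>) \<le> c2 * dist (?c \<sigma>) (?c \<tau>)" by (intro geo_dist_upper cD)
    also have "\<dots> \<le> c2 * (L * dist \<sigma> \<tau>)"
      using lipschitz_onD[OF clip] c2_pos by (intro mult_left_mono) auto
    finally show ?thesis by simp
  qed
  have "(c2 * L)-lipschitz_on UNIV \<phi>"
  proof (rule lipschitz_onI)
    show "dist (\<phi> x) (\<phi> y) \<le> c2 * L * dist x y" for x y
      using step[of x y] step[of y x] by (simp add: dist_real_def abs_le_iff abs_minus_commute)
  qed (use c2_pos L in simp)
  then have c\<phi>: "continuous_on UNIV \<phi>" by (rule lipschitz_on_continuous_on)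
  have int\<phi>: "\<phi> integrable_on {x..y}" for x y
    by (intro integrable_continuous_real continuous_on_subset[OF c\<phi>]) auto
  show ?thesis
  proof (rule field_le_epsilon)
    fix e :: real assume e: "0 < e"
    \<comment> \<open>The error \<open>e'\<close> is relative to the Euclidean speed, which is at most \<open>L\<close>.\<close>
    define e' where "e' = e / (L + 1)"
    have e': "e' > 0" "e' * L \<le> e" using e L by (auto simp: e'_def field_simps)
    obtain \<delta> where \<delta>: "0 < \<delta>"
      "\<And>x y. x \<in> D \<Longrightarrow> y \<in> D \<Longrightarrow> dist x y < \<delta> \<Longrightarrow> seg_cost x y \<le> g x (y - x) + e' * norm (y - x)"
      using seg_cost_local[OF e'(1)] by metis
    let ?q = "\<lambda>k. integral {s..t} (\<lambda>\<tau>. g (\<eta> \<tau>) (forward_quotient \<eta> k \<tau>))"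
    let ?h = "\<lambda>k. 1 / real (Suc k)"
    have key: "\<phi> t - 2 * c2 * L * ?h k \<le> ?q k + e" if small: "L * ?h k < \<delta>" for k
    proof -
      let ?n = "real (Suc k)" and ?d = "?h k"
      have n: "?n > 0" "?d > 0" "?n * ?d = 1" by auto
      have pt: "?n * (\<phi> (\<tau> + ?d) - \<phi> \<tau>) \<le> g (\<eta> \<tau>) (forward_quotient \<eta> k \<tau>) + e" if \<tau>: "\<tau> \<in> {s..t}" for \<tau>
      proof -
        let ?x = "?c \<tau>" and ?y = "?c (\<tau> + ?d)"
        have x: "?x = \<eta> \<tau>" using \<tau> st by (intro clamp_path_simp) auto
        have "dist ?x ?y \<le> L * ?d"
          using lipschitz_onD[OF clip, of \<tau> "\<tau> + ?d"] n by (simp add: dist_real_def)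
        then have "dist ?x ?y < \<delta>" using small by linarith
        then have "geo_dist ?x ?y \<le> g ?x (?y - ?x) + e' * norm (?y - ?x)"
          using geo_dist_le_seg_cost[of ?x ?y] \<delta>(2)[of ?x ?y] cD by fastforce
        moreover have "\<phi> (\<tau> + ?d) - \<phi> \<tau> \<le> geo_dist ?x ?y"
          using geo_dist_triangle[OF sD cD[of \<tau>] cD[of "\<tau> + ?d"]] unfolding \<phi>_def by linarith
        ultimately have "?n * (\<phi> (\<tau> + ?d) - \<phi> \<tau>) \<le> ?n * (g ?x (?y - ?x) + e' * norm (?y - ?x))"
          using n by (intro mult_left_mono) linarith+
        also have "\<dots> = g ?x (forward_quotient \<eta> k \<tau>) + e' * norm (forward_quotient \<eta> k \<tau>)"
        proof -
          have "g ?x (forward_quotient \<eta> k \<tau>) = ?n * g ?x (?y - ?x)"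
            "norm (forward_quotient \<eta> k \<tau>) = ?n * norm (?y - ?x)"
            unfolding forward_quotient_def by (simp_all only: g_scale[OF cD of_nat_0_le_iff] norm_scaleR abs_of_nat)
          then show ?thesis by (simp only: distrib_left mult.left_commute)
        qed
        also have "e' * norm (forward_quotient \<eta> k \<tau>) \<le> e' * L"
          using e' norm_forward_quotient_le[OF lip] by (intro mult_left_mono) auto
        finally show ?thesis using e'(2) x by simp
      qed
      have shift: "continuous_on {s..t} (\<lambda>\<tau>. \<phi> (\<tau> + ?d))"
        by (rule continuous_on_compose2[OF c\<phi>]) (auto intro!: continuous_intros)
      have gint: "(\<lambda>\<tau>. g (\<eta> \<tau>) (forward_quotient \<eta> k \<tau>)) integrable_on {s..t}"
        by (rule integral_along_lipschitz_path(1)[OF lip D g_cont]) (use st in auto)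
      have "?n * (integral {t..t+?d} \<phi> - integral {s..s+?d} \<phi>)
          = ?n * integral {s..t} (\<lambda>\<tau>. \<phi> (\<tau> + ?d) - \<phi> \<tau>)"
        using integral_forward_difference[OF c\<phi> st(2), of ?d] n by simp
      also have "\<dots> = integral {s..t} (\<lambda>\<tau>. ?n * (\<phi> (\<tau> + ?d) - \<phi> \<tau>))" by simp
      also have "\<dots> \<le> integral {s..t} (\<lambda>\<tau>. g (\<eta> \<tau>) (forward_quotient \<eta> k \<tau>) + e)"
      proof (rule integral_le)
        show "(\<lambda>\<tau>. ?n * (\<phi> (\<tau> + ?d) - \<phi> \<tau>)) integrable_on {s..t}"
          by (intro integrable_continuous_real continuous_intros shift continuous_on_subset[OF c\<phi>]) auto
        show "(\<lambda>\<tau>. g (\<eta> \<tau>) (forward_quotient \<eta> k \<tau>) + e) integrable_on {s..t}"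
          by (intro integrable_add gint) auto
      qed (use pt in auto)
      also have "\<dots> = ?q k + (t - s) * e"
        using st by (subst Henstock_Kurzweil_Integration.integral_add[OF gint]) auto
      also have "\<dots> \<le> ?q k + e" using st e by (simp add: mult_left_le_one_le)
      finally have A: "?n * (integral {t..t+?d} \<phi> - integral {s..s+?d} \<phi>) \<le> ?q k + e" .
      have split: "d * (\<phi> t - 2 * c2 * L * d) = d * (\<phi> t - c2 * L * d) - d * (c2 * L * d)" for d
        by (simp add: algebra_simps)
      have "integral {t..t+?d} (\<lambda>_. \<phi> t - c2 * L * ?d) \<le> integral {t..t+?d} \<phi>"
      proof (rule integral_le)
        fix \<tau> assume "\<tau> \<in> {t..t+?d}"
        then have "dist \<tau> t \<le> ?d" by (auto simp: dist_real_def)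
        then have "c2 * L * dist \<tau> t \<le> c2 * L * ?d" using c2_pos L by (intro mult_left_mono) auto
        then show "\<phi> t - c2 * L * ?d \<le> \<phi> \<tau>" using step[of t \<tau>] by linarith
      qed (use int\<phi> in auto)
      then have "?d * (\<phi> t - c2 * L * ?d) \<le> integral {t..t+?d} \<phi>" using n by simp
      moreover have "integral {s..s+?d} \<phi> \<le> integral {s..s+?d} (\<lambda>_. c2 * L * ?d)"
      proof (rule integral_le)
        fix \<tau> assume "\<tau> \<in> {s..s+?d}"
        then have "dist s \<tau> \<le> ?d" by (auto simp: dist_real_def)
        then have "c2 * L * dist s \<tau> \<le> c2 * L * ?d" using c2_pos L by (intro mult_left_mono) auto
        moreover have "\<phi> s = 0" unfolding \<phi>_def using st sD by (simp add: clamp_path_simp geo_dist_refl)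
        ultimately show "\<phi> \<tau> \<le> c2 * L * ?d" using step[of \<tau> s] by linarith
      qed (use int\<phi> in auto)
      then have "integral {s..s+?d} \<phi> \<le> ?d * (c2 * L * ?d)" using n by simp
      ultimately have "?d * (\<phi> t - 2 * c2 * L * ?d) \<le> integral {t..t+?d} \<phi> - integral {s..s+?d} \<phi>"
        unfolding split by linarith
      then have "?n * (?d * (\<phi> t - 2 * c2 * L * ?d)) \<le> ?n * (integral {t..t+?d} \<phi> - integral {s..s+?d} \<phi>)"
        by (rule mult_left_mono) simp
      then have "\<phi> t - 2 * c2 * L * ?d \<le> ?n * (integral {t..t+?d} \<phi> - integral {s..s+?d} \<phi>)"
        by (simp only: mult.assoc[symmetric] n(3) mult_1_left)
      then show ?thesis using A by linarith
    qed
    have hlim: "?h \<longlonglongrightarrow> 0" using LIMSEQ_inverse_real_of_nat by (simp add: inverse_eq_divide)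
    have "(\<lambda>k. \<phi> t - 2 * c2 * L * ?h k) \<longlonglongrightarrow> \<phi> t - 2 * c2 * L * 0"
      by (intro tendsto_intros hlim)
    moreover have "(\<lambda>k. ?q k + e) \<longlonglongrightarrow> ?I + e"
      by (intro tendsto_intros integral_along_lipschitz_path(3)[OF lip D g_cont]) (use st in auto)
    moreover have "\<forall>\<^sub>F k in sequentially. L * ?h k < \<delta>"
      using order_tendstoD(2)[OF tendsto_mult_right_zero[OF hlim] \<delta>(1)] .
    then have "\<forall>\<^sub>F k in sequentially. \<phi> t - 2 * c2 * L * ?h k \<le> ?q k + e"
      by eventually_elim (rule key)
    ultimately have "\<phi> t - 2 * c2 * L * 0 \<le> ?I + e"
      by (intro tendsto_le[OF sequentially_bot])
    then show "geo_dist (\<eta> s) (\<eta> t) \<le> ?I + e" unfolding \<phi>_def using st by (simp add: clamp_path_simp)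
  qed
qed

text \<open>The gap in the tangent inequality for the speed at the point \<^term>\<open>A\<close>, the average speed that
  every path needs at least. Its linear part integrates to a nonnegative number because the length is
  at least \<^term>\<open>A\<close>, so the integral of the gap is at most the excess of the action over
  \<^term>\<open>A powr p\<close>.\<close>

lemma excess_integral:
  assumes lip: "L-lipschitz_on {0..1} \<eta>" and D: "\<eta> ` {0..1} \<subseteq> D"
  defines "A \<equiv> geo_dist (\<eta> 0) (\<eta> 1)"
  defines "ex \<equiv> \<lambda>t. f (\<eta> t) (velocity \<eta> t) - A powr p - p * A powr (p - 1) * (g (\<eta> t) (velocity \<eta> t) - A)"
  shows "ex integrable_on {0..1}" "\<And>t. t \<in> {0..1} \<Longrightarrow> 0 \<le> ex t"
    "integral {0..1} ex \<le> path_action f \<eta> - A powr p"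
proof -
  have A: "0 \<le> A" unfolding A_def using D by (intro geo_dist_nonneg) auto
  let ?g = "\<lambda>t. g (\<eta> t) (velocity \<eta> t)" and ?f = "\<lambda>t. f (\<eta> t) (velocity \<eta> t)"
  have gint: "?g integrable_on {0..1}" and fint: "?f integrable_on {0..1}"
    using integral_along_lipschitz_path(2)[OF lip D g_cont, of 0 1]
      integral_along_lipschitz_path(2)[OF lip D f_cont, of 0 1] by auto
  show int: "ex integrable_on {0..1}"
    unfolding ex_def by (intro integrable_diff integrable_on_mult_right gint fint) auto
  show "0 \<le> ex t" if "t \<in> {0..1}" for t
  proof -
    have "\<eta> t \<in> D" using D that by auto
    then show ?thesis
      using powr_tangent_le[OF p_gt_1, of "?g t" A] g_nonneg[of "\<eta> t"] A unfolding ex_def by (simp add: f_eq)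
  qed
  have ex: "ex = (\<lambda>t. ?f t - (A powr p + p * A powr (p - 1) * (?g t - A)))"
    unfolding ex_def by (simp add: algebra_simps)
  have g1: "(\<lambda>t. ?g t - A) integrable_on {0..1}" by (intro integrable_diff gint) auto
  have "integral {0..1} ex = integral {0..1} ?f - (A powr p + p * A powr (p - 1) * (integral {0..1} ?g - A))"
  proof -
    have "integral {0..1} ex = integral {0..1} ?f - integral {0..1} (\<lambda>t. A powr p + p * A powr (p - 1) * (?g t - A))"
      unfolding ex by (intro Henstock_Kurzweil_Integration.integral_diff fint integrable_add integrable_on_mult_right g1) auto
    also have "integral {0..1} (\<lambda>t. A powr p + p * A powr (p - 1) * (?g t - A))
        = integral {0..1} (\<lambda>t::real. A powr p) + integral {0..1} (\<lambda>t. p * A powr (p - 1) * (?g t - A))"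
      by (intro Henstock_Kurzweil_Integration.integral_add integrable_on_mult_right g1) auto
    also have "integral {0..1} (\<lambda>t. p * A powr (p - 1) * (?g t - A)) = p * A powr (p - 1) * integral {0..1} (\<lambda>t. ?g t - A)"
      by simp
    also have "integral {0..1} (\<lambda>t. ?g t - A) = integral {0..1} ?g - integral {0..1} (\<lambda>t::real. A)"
      by (intro Henstock_Kurzweil_Integration.integral_diff gint) auto
    finally show ?thesis by simp
  qed
  moreover have "A \<le> integral {0..1} ?g" unfolding A_def by (rule geo_dist_le_integral[OF lip D]) auto
  then have "0 \<le> p * A powr (p - 1) * (integral {0..1} ?g - A)" using p_gt_1 by simp
  ultimately show "integral {0..1} ex \<le> path_action f \<eta> - A powr p"
    unfolding path_action_def by linarith
qed

lemma path_action_ge_geo_dist: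
  assumes lip: "L-lipschitz_on {0..1} \<eta>" and D: "\<eta> ` {0..1} \<subseteq> D"
  shows "geo_dist (\<eta> 0) (\<eta> 1) powr p \<le> path_action f \<eta>"
proof -
  have "0 \<le> integral {0..1} (\<lambda>t. f (\<eta> t) (velocity \<eta> t) - geo_dist (\<eta> 0) (\<eta> 1) powr p -
      p * geo_dist (\<eta> 0) (\<eta> 1) powr (p - 1) * (g (\<eta> t) (velocity \<eta> t) - geo_dist (\<eta> 0) (\<eta> 1)))"
    using excess_integral(2)[OF lip D] by (intro Henstock_Kurzweil_Integration.integral_nonneg excess_integral(1)[OF lip D]) auto
  then show ?thesis using excess_integral(3)[OF lip D] by linarith
qed

text \<open>Speed beyond \<^term>\<open>B\<close> is paid for in excess action: as the slope of the power function at
  \<^term>\<open>B\<close> is strictly larger than at \<^term>\<open>A\<close>, the speed is at most \<^term>\<open>B\<close> plus a constant times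
  the gap in the tangent inequality. This is where \<^prop>\<open>1 < p\<close> enters: paths of nearly minimal
  action must move at nearly constant speed.\<close>

lemma geo_dist_le_of_excess:
  assumes lip: "L-lipschitz_on {0..1} \<eta>" and D: "\<eta> ` {0..1} \<subseteq> D"
    and st: "0 \<le> s" "s \<le> t" "t \<le> 1"
  defines "A \<equiv> geo_dist (\<eta> 0) (\<eta> 1)"
  assumes B: "A < B"
  shows "geo_dist (\<eta> s) (\<eta> t) \<le> B * (t - s)
    + (path_action f \<eta> - A powr p) / (p * B powr (p - 1) - p * A powr (p - 1))"
proof -
  have A: "0 \<le> A" unfolding A_def using D by (intro geo_dist_nonneg) auto
  define k where "k = p * B powr (p - 1) - p * A powr (p - 1)"
  have "A powr (p - 1) < B powr (p - 1)" using A B p_gt_1 by (intro powr_less_mono2) auto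
  then have k: "k > 0" unfolding k_def using p_gt_1 by simp
  let ?g = "\<lambda>t. g (\<eta> t) (velocity \<eta> t)"
  define ex where "ex t = f (\<eta> t) (velocity \<eta> t) - A powr p - p * A powr (p - 1) * (?g t - A)" for t
  note E = excess_integral[OF lip D, folded A_def, folded ex_def]
  have exint: "ex integrable_on {0..1}" using E(1) unfolding ex_def .
  have pt: "?g \<tau> \<le> B + ex \<tau> / k" if "\<tau> \<in> {0..1}" for \<tau>
  proof -
    have \<eta>D: "\<eta> \<tau> \<in> D" using D that by auto
    have "A powr p + p * A powr (p - 1) * (B - A) \<le> B powr p"
      using A B p_gt_1 by (intro powr_tangent_le) auto
    moreover have "B powr p + p * B powr (p - 1) * (?g \<tau> - B) \<le> ?g \<tau> powr p"
      using A B p_gt_1 g_nonneg[OF \<eta>D] by (intro powr_tangent_le) auto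
    \<comment> \<open>The tangent at \<open>B\<close>, whose value at \<open>B\<close> lies above the tangent at \<open>A\<close>.\<close>
    ultimately have "k * (?g \<tau> - B) \<le> ex \<tau>"
      unfolding k_def ex_def f_eq[OF \<eta>D] by (simp add: algebra_simps)
    then show ?thesis using k by (simp add: field_simps)
  qed
  have sub: "{s..t} \<subseteq> {0..1}" using st by auto
  have ex_st: "ex integrable_on {s..t}" by (rule integrable_on_subinterval[OF exint sub])
  have "geo_dist (\<eta> s) (\<eta> t) \<le> integral {s..t} ?g" by (rule geo_dist_le_integral[OF lip D st])
  also have "\<dots> \<le> integral {s..t} (\<lambda>\<tau>. B + ex \<tau> / k)"
  proof (rule integral_le)
    show "?g integrable_on {s..t}"
      by (rule integral_along_lipschitz_path(2)[OF lip D g_cont]) (use st in auto)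
    show "(\<lambda>\<tau>. B + ex \<tau> / k) integrable_on {s..t}"
      by (intro integrable_add integrable_on_divide ex_st) auto
  qed (use pt sub in auto)
  also have "\<dots> = B * (t - s) + integral {s..t} ex / k"
    using st by (subst Henstock_Kurzweil_Integration.integral_add) (auto intro!: integrable_on_divide ex_st)
  also have "integral {s..t} ex \<le> integral {0..1} ex"
    using E(2) by (intro integral_subset_le sub ex_st exint) (auto simp: ex_def)
  also have "integral {0..1} ex \<le> path_action f \<eta> - A powr p" using E(3) unfolding ex_def .
  finally show ?thesis using k unfolding k_def[symmetric] by (simp add: divide_right_mono)
qed

text \<open>Conversely the metric speed bounds the Finsler norm of the velocity, by the local comparison
  \<open>geo_dist_local\<close> of the two.\<close>

lemma path_action_le_of_geo_dist_le:
  assumes D: "\<eta> ` {0..1} \<subseteq> D" and B: "0 \<le> B"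
    and le: "\<And>s t. 0 \<le> s \<Longrightarrow> s \<le> t \<Longrightarrow> t \<le> 1 \<Longrightarrow> geo_dist (\<eta> s) (\<eta> t) \<le> B * (t - s)"
  shows "path_action f \<eta> \<le> B powr p"
proof -
  define L where "L = B / c1"
  have lip: "L-lipschitz_on {0..1} \<eta>" unfolding L_def by (rule lipschitz_of_geo_dist_le[OF D B le])
  have L: "0 \<le> L" by (rule lipschitz_on_nonneg[OF lip])
  obtain N where N: "negligible N" "0 \<in> N" "1 \<in> N"
    "\<And>t. t \<in> {0..1} \<Longrightarrow> t \<notin> N \<Longrightarrow> (\<lambda>k. forward_quotient \<eta> k t) \<longlonglongrightarrow> velocity \<eta> t"
    using lipschitz_velocity_ae[OF lip] by metis
  show ?thesis
  proof (rule path_action_le_ae[OF lip D N(1)])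
    fix t assume t: "t \<in> {0..1}" "t \<notin> N"
    then have t1: "t < 1" using N(3) by (cases "t = 1") auto
    have \<eta>D: "\<eta> t \<in> D" using D t by auto
    have "continuous_on UNIV (\<lambda>v. case (\<eta> t, v) of (x, v) \<Rightarrow> g x v)"
      by (rule continuous_on_compose2[OF g_cont]) (use \<eta>D in \<open>auto intro!: continuous_intros\<close>)
    then have "isCont (g (\<eta> t)) (velocity \<eta> t)" by (simp add: continuous_on_eq_continuous_at)
    then have glim: "(\<lambda>k. g (\<eta> t) (forward_quotient \<eta> k t)) \<longlonglongrightarrow> g (\<eta> t) (velocity \<eta> t)"
      using N(4)[OF t] by (rule isCont_tendsto_compose)
    have hlim: "(\<lambda>k. 1 / real (Suc k)) \<longlonglongrightarrow> 0"
      using LIMSEQ_inverse_real_of_nat by (simp add: inverse_eq_divide)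
    have "g (\<eta> t) (velocity \<eta> t) \<le> B"
    proof (rule field_le_epsilon)
      fix e :: real assume e: "0 < e"
      define e' where "e' = e / (L + 1)"
      have e': "e' > 0" "e' * L \<le> e" using e L by (auto simp: e'_def field_simps)
      obtain \<delta> where \<delta>: "0 < \<delta>"
        "\<And>x y. x \<in> D \<Longrightarrow> y \<in> D \<Longrightarrow> dist x y < \<delta> \<Longrightarrow> g x (y - x) \<le> geo_dist x y + e' * norm (y - x)"
        using geo_dist_local[OF e'(1)] by metis
      have "\<forall>\<^sub>F k in sequentially. L * (1 / real (Suc k)) < \<delta>"
        using order_tendstoD(2)[OF tendsto_mult_right_zero[OF hlim] \<delta>(1)] .
      moreover have "\<forall>\<^sub>F k in sequentially. 1 / real (Suc k) < 1 - t"
        using order_tendstoD(2)[OF hlim, of "1 - t"] t1 by simp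
      ultimately have "\<forall>\<^sub>F k in sequentially. g (\<eta> t) (forward_quotient \<eta> k t) \<le> B + e"
      proof eventually_elim
        case (elim k)
        let ?n = "real (Suc k)" and ?d = "1 / real (Suc k)"
        let ?y = "\<eta> (t + ?d)"
        have n: "?n > 0" "?d > 0" "?n * ?d = 1" by auto
        have td: "t + ?d \<in> {0..1}" using elim(2) t n(2) by auto
        have q: "forward_quotient \<eta> k t = ?n *\<^sub>R (?y - \<eta> t)"
          unfolding forward_quotient_def using td t by (simp only: clamp_path_simp)
        have yD: "?y \<in> D" using D td by auto
        have "dist (\<eta> t) ?y \<le> L * ?d"
          using lipschitz_onD[OF lip t(1) td] n by (simp add: dist_real_def)
        then have "g (\<eta> t) (?y - \<eta> t) \<le> geo_dist (\<eta> t) ?y + e' * norm (?y - \<eta> t)"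
          using elim(1) by (intro \<delta>(2) \<eta>D yD) linarith
        also have "geo_dist (\<eta> t) ?y \<le> B * ?d" using le[of t "t + ?d"] t td n by auto
        finally have "?n * g (\<eta> t) (?y - \<eta> t) \<le> ?n * (B * ?d + e' * norm (?y - \<eta> t))"
          by (intro mult_left_mono) auto
        also have "\<dots> = B + e' * norm (forward_quotient \<eta> k t)"
          unfolding q using n by (simp add: distrib_left del: of_nat_Suc)
        also have "\<dots> \<le> B + e' * L"
          using e' norm_forward_quotient_le[OF lip] by (intro add_left_mono mult_left_mono) auto
        also have "\<dots> \<le> B + e" using e' by simp
        finally show ?case unfolding q by (subst g_scale[OF \<eta>D]) auto
      qed
      then show "g (\<eta> t) (velocity \<eta> t) \<le> B + e"
        by (intro tendsto_upperbound[OF glim]) auto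
    qed
    then show "f (\<eta> t) (velocity \<eta> t) \<le> B powr p"
      using f_eq[OF \<eta>D] g_nonneg[OF \<eta>D] p_gt_1 by (simp add: powr_mono2)
  qed
qed

lemma metric_geodesic_minimizes:
  assumes ab: "a \<in> D" "b \<in> D" and \<gamma>: "\<gamma> 0 = a" "\<gamma> 1 = b" "\<gamma> ` {0..1} \<subseteq> D"
    and le: "\<And>s t. 0 \<le> s \<Longrightarrow> s \<le> t \<Longrightarrow> t \<le> 1 \<Longrightarrow> geo_dist (\<gamma> s) (\<gamma> t) \<le> geo_dist a b * (t - s)"
  shows "\<gamma> \<in> lipschitz_paths D a b" "path_action f \<gamma> = geo_dist a b powr p"
proof -
  have lip: "(geo_dist a b / c1)-lipschitz_on {0..1} \<gamma>"
    by (rule lipschitz_of_geo_dist_le[OF \<gamma>(3) geo_dist_nonneg[OF ab] le])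
  then show "\<gamma> \<in> lipschitz_paths D a b" unfolding lipschitz_paths_def using \<gamma> by blast
  show "path_action f \<gamma> = geo_dist a b powr p"
    using path_action_le_of_geo_dist_le[OF \<gamma>(3) geo_dist_nonneg[OF ab] le] path_action_ge_geo_dist[OF lip \<gamma>(3)] \<gamma>(1,2)
    by simp
qed

lemma lipschitz_paths_action_ge:
  assumes "\<eta> \<in> lipschitz_paths D a b"
  shows "geo_dist a b powr p \<le> path_action f \<eta>"
  using assms path_action_ge_geo_dist unfolding lipschitz_paths_def by fastforce

lemma min_path_action:
  assumes ab: "a \<in> D" "b \<in> D"
  shows "(INF \<gamma>\<in>lipschitz_paths D a b. path_action f \<gamma>) = geo_dist a b powr p"
    and "argmin_on (path_action f) (lipschitz_paths D a b)
      = {\<gamma> \<in> lipschitz_paths D a b. path_action f \<gamma> = geo_dist a b powr p}"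
    and "argmin_on (path_action f) (lipschitz_paths D a b) \<noteq> {}"
proof -
  obtain \<gamma> where \<gamma>: "\<gamma> \<in> lipschitz_paths D a b" "path_action f \<gamma> = geo_dist a b powr p"
    using geodesic_exists[OF ab] metric_geodesic_minimizes[OF ab] by metis
  show "(INF \<gamma>\<in>lipschitz_paths D a b. path_action f \<gamma>) = geo_dist a b powr p"
  proof (rule antisym)
    have "bdd_below (path_action f ` lipschitz_paths D a b)"
      using lipschitz_paths_action_ge by (auto intro!: bdd_belowI2)
    then have "(INF \<gamma>\<in>lipschitz_paths D a b. path_action f \<gamma>) \<le> path_action f \<gamma>"
      using \<gamma>(1) by (rule cINF_lower)
    then show "(INF \<gamma>\<in>lipschitz_paths D a b. path_action f \<gamma>) \<le> geo_dist a b powr p" using \<gamma>(2) by simp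
    show "geo_dist a b powr p \<le> (INF \<gamma>\<in>lipschitz_paths D a b. path_action f \<gamma>)"
      using \<gamma>(1) lipschitz_paths_action_ge by (intro cINF_greatest) auto
  qed
  show eq: "argmin_on (path_action f) (lipschitz_paths D a b)
      = {\<gamma> \<in> lipschitz_paths D a b. path_action f \<gamma> = geo_dist a b powr p}"
    unfolding argmin_on_def is_arg_min_def using \<gamma> lipschitz_paths_action_ge by fastforce
  show "argmin_on (path_action f) (lipschitz_paths D a b) \<noteq> {}" unfolding eq using \<gamma> by blast
qed

text \<open>The bound \<open>geo_dist_le_of_excess\<close> does two things. With \<open>B = A + 1\<close> it makes the sequence
  equicontinuous, although the individual Lipschitz constants may be unbounded: the additive error is
  small for large indices, and the finitely many other paths are Lipschitz. With \<open>B\<close> decreasing to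
  \<open>A\<close> it shows that a limit path travels at metric speed at most \<open>A\<close>. So the limit is Lipschitz and,
  by \<open>metric_geodesic_minimizes\<close>, minimal.\<close>

lemma minimizing_sequence_subconverges:
  assumes ab: "a \<in> D" "b \<in> D" and \<gamma>: "\<And>n. \<gamma> n \<in> lipschitz_paths D a b"
    and lim: "(\<lambda>n. path_action f (\<gamma> n)) \<longlonglongrightarrow> geo_dist a b powr p"
  obtains r \<eta> where "strict_mono (r :: nat \<Rightarrow> nat)"
    "\<eta> \<in> argmin_on (path_action f) (lipschitz_paths D a b)"
    "uniform_limit {0..1} (\<lambda>k. \<gamma> (r k)) \<eta> sequentially"
proof -
  define A where "A = geo_dist a b"
  have A0: "0 \<le> A" unfolding A_def by (rule geo_dist_nonneg[OF ab])
  define exc where "exc n = path_action f (\<gamma> n) - A powr p" for n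
  have exc_lim: "exc \<longlonglongrightarrow> 0"
    using tendsto_diff[OF lim tendsto_const[of "geo_dist a b powr p"]] unfolding exc_def A_def by simp
  obtain lp where lp: "\<And>n. (lp n)-lipschitz_on {0..1} (\<gamma> n)"
    using \<gamma> unfolding lipschitz_paths_def by (simp, metis)
  have ends: "\<gamma> n 0 = a" "\<gamma> n 1 = b" and \<gamma>D: "\<gamma> n ` {0..1} \<subseteq> D" for n
    using \<gamma>[of n] unfolding lipschitz_paths_def by auto
  have \<gamma>_in: "\<gamma> n t \<in> D" if "0 \<le> t" "t \<le> 1" for n t using \<gamma>D[of n] that by auto
  define K where "K B = p * B powr (p - 1) - p * A powr (p - 1)" for B
  have geo_dist_le: "geo_dist (\<gamma> n s) (\<gamma> n t) \<le> B * (t - s) + exc n / K B"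
    if "0 \<le> s" "s \<le> t" "t \<le> 1" "A < B" for n s t B
    using geo_dist_le_of_excess[OF lp[of n] \<gamma>D that(1-3)] that(4) unfolding ends exc_def K_def A_def by simp
  have small: "\<forall>\<^sub>F n in sequentially. exc n / K B < e" if "0 < e" for B e
    using order_tendstoD(2)[OF tendsto_divide_zero[OF exc_lim, of "K B"] that] .
  obtain R where R: "\<And>x. x \<in> D \<Longrightarrow> norm x \<le> R"
    using compact_imp_bounded[OF compact_D] unfolding bounded_iff by blast
  obtain \<eta> r where r: "continuous_on {0..1} \<eta>" "strict_mono (r :: nat \<Rightarrow> nat)"
    "\<And>e. 0 < e \<Longrightarrow> \<exists>N. \<forall>n x. n \<ge> N \<and> x \<in> {0..1} \<longrightarrow> norm (\<gamma> (r n) x - \<eta> x) < e"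
  proof (rule Arzela_Ascoli[of "{0..1::real}" \<gamma> R])
    fix x e :: real assume xe: "x \<in> {0..1}" "0 < e"
    have ce: "0 < c1 * e / 2" using c1_pos xe by simp
    obtain n0 where n0: "\<And>n. n \<ge> n0 \<Longrightarrow> exc n / K (A + 1) < c1 * e / 2"
      using small[OF ce, of "A + 1"] unfolding eventually_sequentially by blast
    define d1 where "d1 = c1 * e / (2 * (A + 1))"
    have d1: "d1 > 0" using c1_pos xe A0 unfolding d1_def by simp
    define Lm where "Lm = Max (insert 0 (lp ` {..<n0})) + 1"
    have Lm: "lp n \<le> Lm" if "n < n0" for n
    proof -
      have "lp n \<le> Max (insert 0 (lp ` {..<n0}))" using that by (intro Max_ge) auto
      then show ?thesis unfolding Lm_def by simp
    qed
    have Lm0: "Lm > 0"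
      unfolding Lm_def by (intro add_nonneg_pos Max_ge) auto
    show "\<exists>d>0. \<forall>n y. y \<in> {0..1} \<and> norm (x - y) < d \<longrightarrow> norm (\<gamma> n x - \<gamma> n y) < e"
    proof (intro exI[of _ "min d1 (e / Lm)"] conjI allI impI)
      fix n y assume y: "y \<in> {0..1} \<and> norm (x - y) < min d1 (e / Lm)"
      show "norm (\<gamma> n x - \<gamma> n y) < e"
      proof (cases "n < n0")
        case True
        have "norm (\<gamma> n x - \<gamma> n y) \<le> lp n * norm (x - y)"
          using lipschitz_onD[OF lp[of n] xe(1), of y] y by (simp add: dist_norm)
        also have "\<dots> \<le> Lm * norm (x - y)" using Lm[OF True] by (intro mult_right_mono) auto
        also have "\<dots> < e" using y Lm0 by (simp add: field_simps)
        finally show ?thesis .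
      next
        case False
        have *: "norm (\<gamma> n s - \<gamma> n t) < e" if st: "0 \<le> s" "s \<le> t" "t \<le> 1" "t - s < d1" for s t
        proof -
          have "c1 * dist (\<gamma> n s) (\<gamma> n t) \<le> geo_dist (\<gamma> n s) (\<gamma> n t)"
            using st by (intro geo_dist_lower \<gamma>_in) auto
          also have "\<dots> \<le> (A + 1) * (t - s) + exc n / K (A + 1)" using st by (intro geo_dist_le) auto
          also have "\<dots> < (A + 1) * d1 + c1 * e / 2"
            using n0[of n] False st A0 by (intro add_strict_mono mult_strict_left_mono) auto
          also have "\<dots> = c1 * e" using A0 unfolding d1_def by (simp add: field_simps)
          finally show ?thesis using c1_pos by (simp add: dist_norm)
        qed
        show ?thesis
          using *[of x y] *[of y x] y xe by (cases "x \<le> y") (auto simp: norm_minus_commute abs_if split: if_splits)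
      qed
    qed (use d1 Lm0 xe in simp)
  qed (use R \<gamma>_in in auto)
  have ul: "uniform_limit {0..1} (\<lambda>k. \<gamma> (r k)) \<eta> sequentially"
    unfolding uniform_limit_sequentially_iff dist_norm using r(3) by meson
  have plim: "(\<lambda>k. \<gamma> (r k) t) \<longlonglongrightarrow> \<eta> t" if "0 \<le> t" "t \<le> 1" for t
    using tendsto_uniform_limitI[OF ul, of t] that by simp
  have e0: "\<eta> 0 = a" using LIMSEQ_unique[OF plim[of 0]] by (simp add: ends)
  have e1: "\<eta> 1 = b" using LIMSEQ_unique[OF plim[of 1]] by (simp add: ends)
  have \<eta>D: "\<eta> ` {0..1} \<subseteq> D"
    using closed_sequentially[OF compact_imp_closed[OF compact_D]] plim \<gamma>_in by fastforce
  have "geo_dist (\<eta> s) (\<eta> t) \<le> geo_dist a b * (t - s)" if st: "0 \<le> s" "s \<le> t" "t \<le> 1" for s t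
    unfolding A_def[symmetric]
  proof (rule geo_dist_limit_le[OF plim[of s] plim[of t]])
    fix e :: real assume e: "0 < e"
    have "\<forall>\<^sub>F n in sequentially. exc n / K (A + e / 2) < e / 2" using small[of "e/2"] e by simp
    then have "\<forall>\<^sub>F n in sequentially. exc (r n) / K (A + e / 2) < e / 2"
      using eventually_subseq[OF r(2)] by blast
    then show "\<forall>\<^sub>F n in sequentially. geo_dist (\<gamma> (r n) s) (\<gamma> (r n) t) \<le> A * (t - s) + e"
    proof eventually_elim
      case (elim n)
      have "geo_dist (\<gamma> (r n) s) (\<gamma> (r n) t) \<le> (A + e / 2) * (t - s) + exc (r n) / K (A + e / 2)"
        using st e by (intro geo_dist_le) auto
      also have "(A + e / 2) * (t - s) \<le> A * (t - s) + e / 2"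
        using st e by (simp add: distrib_right mult_left_le)
      finally show ?case using elim by linarith
    qed
  qed (use \<gamma>_in st in auto)
  then have "\<eta> \<in> argmin_on (path_action f) (lipschitz_paths D a b)"
    unfolding min_path_action(2)[OF ab]
    using metric_geodesic_minimizes[OF ab e0 e1 \<eta>D] by blast
  then show ?thesis using that r(2) ul by blast
qed

end

section \<open>Paths in the graph\<close>

lemma unit_interval_segment_index:
  assumes "0 < m" "0 \<le> t" "t \<le> 1"
  obtains i where "i < m" "real i / real m \<le> t" "t \<le> real (Suc i) / real m"
proof (cases "t = 1")
  case True
  then show ?thesis using assms that[of "m - 1"] by (auto simp: field_simps)
next
  case False
  define i where "i = nat \<lfloor>real m * t\<rfloor>"
  have fl: "real i = of_int \<lfloor>real m * t\<rfloor>" using assms unfolding i_def by simp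
  have "real m * t < real m" using False assms by simp
  then have "real i < real m" using fl by linarith
  moreover have "real i \<le> real m * t" "real m * t \<le> real (Suc i)" using fl by linarith+
  ultimately show ?thesis using assms that[of i] by (auto simp: field_simps)
qed

lemma pl_path_endpoints:
  assumes "2 \<le> length vs"
  shows "pl_path vs 0 = hd vs" "pl_path vs 1 = last vs"
proof -
  obtain m where m: "length vs = Suc m" "0 < m" using assms by (cases "length vs") auto
  have ne: "vs \<noteq> []" using assms by auto
  show "pl_path vs 0 = hd vs"
    using pl_path_on_segment[of m vs 0 0] m ne by (simp add: linepath_def hd_conv_nth)
  show "pl_path vs 1 = last vs"
    using pl_path_on_segment[of m vs "m - 1" 1] m ne
    by (simp add: linepath_def last_conv_nth of_nat_diff)
qed

lemma pl_path_in_convex: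
  fixes vs :: "'a::real_normed_vector list"
  assumes "convex D" "set vs \<subseteq> D" "2 \<le> length vs" "0 \<le> t" "t \<le> 1"
  shows "pl_path vs t \<in> D"
proof -
  obtain m where m: "length vs = Suc m" "0 < m" using assms by (cases "length vs") auto
  obtain i where i: "i < m" "real i / real m \<le> t" "t \<le> real (Suc i) / real m"
    using unit_interval_segment_index[OF m(2) assms(4,5)] .
  have "pl_path vs t = linepath (vs ! i) (vs ! Suc i) (real m * t - real i)"
    using m i by (intro pl_path_on_segment) auto
  also have "\<dots> \<in> closed_segment (vs ! i) (vs ! Suc i)"
    using m(2) i(2,3) by (intro linepath_in_path) (auto simp: field_simps)
  also have "closed_segment (vs ! i) (vs ! Suc i) \<subseteq> D"
    using assms(1,2) m(1) i(1) by (intro closed_segment_subset) auto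
  finally show ?thesis .
qed

lemma pl_path_velocity:
  fixes vs :: "'a::real_normed_vector list"
  assumes m: "length vs = Suc m" "i < m" and t: "real i / real m < t" "t < real (Suc i) / real m"
  shows "velocity (pl_path vs) t = real m *\<^sub>R (vs ! Suc i - vs ! i)"
proof -
  let ?l = "\<lambda>t. linepath (vs ! i) (vs ! Suc i) (real m * t - real i)"
  have l: "?l = (\<lambda>t. vs ! i + (real m * t - real i) *\<^sub>R (vs ! Suc i - vs ! i))"
    by (auto simp: linepath_def algebra_simps)
  have "(?l has_vector_derivative real m *\<^sub>R (vs ! Suc i - vs ! i)) (at t)"
    unfolding l by (auto intro!: derivative_eq_intros)
  moreover have "t \<in> {real i / real m<..<real (Suc i) / real m}" using t by simp
  moreover have "?l s = pl_path vs s" if "s \<in> {real i / real m<..<real (Suc i) / real m}" for s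
    using that m by (intro pl_path_on_segment[symmetric]) auto
  ultimately have "(pl_path vs has_vector_derivative real m *\<^sub>R (vs ! Suc i - vs ! i)) (at t)"
    by (rule has_vector_derivative_transform_within_open[OF _ open_greaterThanLessThan])
  then have "(pl_path vs has_vector_derivative real m *\<^sub>R (vs ! Suc i - vs ! i)) (at t within {0..1})"
    by (rule has_vector_derivative_at_within)
  moreover have "0 \<le> t" using t(1) by (meson divide_nonneg_nonneg less_imp_le of_nat_0_le_iff order_trans)
  moreover have "real (Suc i) / real m \<le> 1" using m(2) by (simp add: field_simps)
  then have "t \<le> 1" using t(2) by linarith
  ultimately show ?thesis
    using vector_derivative_within_cbox[of 0 1 t "pl_path vs"] by (simp add: cbox_interval)
qed

lemma pl_path_lipschitz:
  fixes vs :: "'a::real_normed_vector list"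
  assumes "2 \<le> length vs"
  shows "\<exists>L. L-lipschitz_on {0..1} (pl_path vs)"
proof -
  obtain m where m: "length vs = Suc m" "0 < m" using assms by (cases "length vs") auto
  define C where "C = (\<Sum>i<m. norm (vs ! Suc i - vs ! i))"
  have C: "norm (vs ! Suc i - vs ! i) \<le> C" if "i < m" for i
    unfolding C_def using that by (intro member_le_sum) auto
  have C0: "0 \<le> C" unfolding C_def by (intro sum_nonneg) auto
  have "(real m * C)-lipschitz_on {0..1} (pl_path vs)"
  proof (rule lipschitz_on_closed_Union[of "{..<m}"])
    fix i assume i: "i \<in> {..<m}"
    show "(real m * C)-lipschitz_on {real i / real m..real (Suc i) / real m} (pl_path vs)"
    proof (rule lipschitz_onI)
      fix s t assume s: "s \<in> {real i / real m..real (Suc i) / real m}"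
        and t: "t \<in> {real i / real m..real (Suc i) / real m}"
      have e: "pl_path vs r = linepath (vs ! i) (vs ! Suc i) (real m * r - real i)"
        if "r \<in> {real i / real m..real (Suc i) / real m}" for r
        using that m i by (intro pl_path_on_segment) auto
      have "pl_path vs s - pl_path vs t = (real m * (s - t)) *\<^sub>R (vs ! Suc i - vs ! i)"
        unfolding e[OF s] e[OF t] linepath_def by (simp add: algebra_simps)
      then have "dist (pl_path vs s) (pl_path vs t) = real m * \<bar>s - t\<bar> * norm (vs ! Suc i - vs ! i)"
        by (simp add: dist_norm abs_mult)
      also have "\<dots> \<le> real m * \<bar>s - t\<bar> * C" using C i by (intro mult_left_mono) auto
      finally show "dist (pl_path vs s) (pl_path vs t) \<le> real m * C * dist s t"
        by (simp add: dist_real_def mult.assoc mult.left_commute mult.commute)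
    qed (use C0 in simp)
  next
    show "{0..1} \<subseteq> (\<Union>i\<in>{..<m}. {real i / real m..real (Suc i) / real m})"
    proof
      fix t :: real assume "t \<in> {0..1}"
      then obtain i where "i < m" "real i / real m \<le> t" "t \<le> real (Suc i) / real m"
        using unit_interval_segment_index[OF m(2), of t] by auto
      then show "t \<in> (\<Union>i\<in>{..<m}. {real i / real m..real (Suc i) / real m})"
        by (intro UN_I[of i]) simp_all
    qed
  qed (use C0 in auto)
  then show ?thesis by blast
qed

context finsler_action
begin

lemma pl_path_lipschitz_path:
  assumes "2 \<le> length vs" "set vs \<subseteq> D"
  shows "pl_path vs \<in> lipschitz_paths D (hd vs) (last vs)"
  unfolding lipschitz_paths_def
  using pl_path_lipschitz[OF assms(1)] pl_path_endpoints[OF assms(1)]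
    pl_path_in_convex[OF convex_D assms(2,1)] by auto

lemma pl_path_off_grid:
  assumes m: "length vs = Suc m" "0 < m"
  obtains N where "negligible N" "\<And>t. t \<in> {0..1} \<Longrightarrow> t \<notin> N \<Longrightarrow>
    \<exists>i<m. pl_path vs t \<in> closed_segment (vs ! i) (vs ! Suc i) \<and>
      velocity (pl_path vs) t = real m *\<^sub>R (vs ! Suc i - vs ! i)"
proof
  let ?N = "(\<lambda>i. real i / real m) ` {..m}"
  show "negligible ?N" by (intro negligible_finite) auto
  fix t :: real assume t: "t \<in> {0..1}" "t \<notin> ?N"
  obtain i where i: "i < m" "real i / real m \<le> t" "t \<le> real (Suc i) / real m"
    using unit_interval_segment_index[OF m(2), of t] t(1) by auto
  have "t \<noteq> real j / real m" if "j \<le> m" for j using t(2) that by auto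
  from this[of i] this[of "Suc i"] have s: "real i / real m < t" "t < real (Suc i) / real m"
    using i by auto
  have "pl_path vs t = linepath (vs ! i) (vs ! Suc i) (real m * t - real i)"
    using m i by (intro pl_path_on_segment) auto
  also have "\<dots> \<in> closed_segment (vs ! i) (vs ! Suc i)"
    using m(2) i(2,3) by (intro linepath_in_path) (auto simp: field_simps)
  finally show "\<exists>i<m. pl_path vs t \<in> closed_segment (vs ! i) (vs ! Suc i) \<and>
      velocity (pl_path vs) t = real m *\<^sub>R (vs ! Suc i - vs ! i)"
    using i(1) pl_path_velocity[OF m(1) i(1) s] by blast
qed

lemma pl_path_action_le:
  assumes m: "length vs = Suc m" "0 < m" and D: "set vs \<subseteq> D"
    and le: "\<And>i. i < m \<Longrightarrow> real m * seg_cost (vs ! i) (vs ! Suc i) \<le> B"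
  shows "path_action f (pl_path vs) \<le> B powr p"
proof -
  have "pl_path vs \<in> lipschitz_paths D (hd vs) (last vs)"
    using m by (intro pl_path_lipschitz_path D) auto
  then obtain L where L: "L-lipschitz_on {0..1} (pl_path vs)" and in_D: "pl_path vs ` {0..1} \<subseteq> D"
    unfolding lipschitz_paths_def by blast
  obtain N where N: "negligible N" "\<And>t. t \<in> {0..1} \<Longrightarrow> t \<notin> N \<Longrightarrow>
    \<exists>i<m. pl_path vs t \<in> closed_segment (vs ! i) (vs ! Suc i) \<and>
      velocity (pl_path vs) t = real m *\<^sub>R (vs ! Suc i - vs ! i)"
    using pl_path_off_grid[OF m] by blast
  show ?thesis
  proof (rule path_action_le_ae[OF L in_D N(1)])
    fix t :: real assume t: "t \<in> {0..1}" "t \<notin> N"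
    obtain i where i: "i < m" "pl_path vs t \<in> closed_segment (vs ! i) (vs ! Suc i)"
      "velocity (pl_path vs) t = real m *\<^sub>R (vs ! Suc i - vs ! i)" using N(2)[OF t] by blast
    have xD: "pl_path vs t \<in> D" using in_D t by blast
    have "g (pl_path vs t) (velocity (pl_path vs) t) = real m * g (pl_path vs t) (vs ! Suc i - vs ! i)"
      unfolding i(3) by (rule g_scale[OF xD]) simp
    also have "\<dots> \<le> real m * seg_cost (vs ! i) (vs ! Suc i)"
      using D m(1) i(1) by (intro mult_left_mono seg_cost_ge[OF _ _ i(2)]) auto
    also have "\<dots> \<le> B" by (rule le[OF i(1)])
    finally show "f (pl_path vs t) (velocity (pl_path vs) t) \<le> B powr p"
      using f_eq[OF xD] g_nonneg[OF xD] p_gt_1 by (simp add: powr_mono2)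
  qed
qed

lemma pl_path_action_ge:
  assumes m: "length vs = Suc m" "0 < m" and D: "set vs \<subseteq> D" and \<delta>: "0 \<le> \<delta>"
    and le: "\<And>i. i < m \<Longrightarrow> \<delta> \<le> norm (vs ! Suc i - vs ! i)"
  shows "(c1 * real m * \<delta>) powr p \<le> path_action f (pl_path vs)"
proof -
  have "pl_path vs \<in> lipschitz_paths D (hd vs) (last vs)"
    using m by (intro pl_path_lipschitz_path D) auto
  then obtain L where L: "L-lipschitz_on {0..1} (pl_path vs)" and in_D: "pl_path vs ` {0..1} \<subseteq> D"
    unfolding lipschitz_paths_def by blast
  obtain N where N: "negligible N" "\<And>t. t \<in> {0..1} \<Longrightarrow> t \<notin> N \<Longrightarrow>
    \<exists>i<m. pl_path vs t \<in> closed_segment (vs ! i) (vs ! Suc i) \<and>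
      velocity (pl_path vs) t = real m *\<^sub>R (vs ! Suc i - vs ! i)"
    using pl_path_off_grid[OF m] by blast
  show ?thesis
  proof (rule path_action_ge_ae[OF L in_D N(1)])
    fix t :: real assume t: "t \<in> {0..1}" "t \<notin> N"
    obtain i where i: "i < m"
      "velocity (pl_path vs) t = real m *\<^sub>R (vs ! Suc i - vs ! i)" using N(2)[OF t] by blast
    have xD: "pl_path vs t \<in> D" using in_D t by blast
    have "c1 * real m * \<delta> \<le> c1 * real m * norm (vs ! Suc i - vs ! i)"
      using le[OF i(1)] c1_pos by (intro mult_left_mono) auto
    also have "\<dots> = c1 * norm (velocity (pl_path vs) t)" unfolding i(2) by simp
    also have "\<dots> \<le> g (pl_path vs t) (velocity (pl_path vs) t)" by (rule g_lower[OF xD])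
    finally show "(c1 * real m * \<delta>) powr p \<le> f (pl_path vs t) (velocity (pl_path vs) t)"
      using f_eq[OF xD] c1_pos \<delta> p_gt_1 by (simp add: powr_mono2)
  qed
qed

lemma pl_graph_paths_lipschitz:
  assumes "P \<subseteq> D" "a \<in> D" "b \<in> D"
  shows "pl_graph_paths P e a b \<subseteq> lipschitz_paths D a b"
proof
  fix \<gamma> assume "\<gamma> \<in> pl_graph_paths P e a b"
  then obtain vs where vs: "\<gamma> = pl_path vs" "2 \<le> length vs" "set vs \<subseteq> P \<union> {a, b}" "hd vs = a" "last vs = b"
    unfolding pl_graph_paths_def graph_paths_def by auto
  then show "\<gamma> \<in> lipschitz_paths D a b" using pl_path_lipschitz_path[of vs] assms by auto
qed

text \<open>The number of steps of a graph path is unbounded, but distinct vertices are at least some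
  \<open>\<delta> > 0\<close> apart, so a path with \<open>m\<close> steps, each taken in time \<open>1 / m\<close>, has action at least
  \<open>(c1 m \<delta>) powr p\<close>. Only the finitely many short paths compete for the minimum.\<close>

lemma argmin_pl_graph_paths_nonempty:
  assumes P: "finite P" "P \<subseteq> D" and ab: "a \<in> D" "b \<in> D"
    and ne: "graph_paths (P \<union> {a, b}) e a b \<noteq> {}"
  shows "argmin_on (path_action f) (pl_graph_paths P e a b) \<noteq> {}"
proof -
  let ?V = "P \<union> {a, b}" and ?G = "graph_paths (P \<union> {a, b}) e a b"
  let ?F = "\<lambda>vs. path_action f (pl_path vs)"
  \<comment> \<open>The number \<open>1\<close> only keeps the set nonempty.\<close>
  define W where "W = insert 1 {norm (u - v) | u v. u \<in> ?V \<and> v \<in> ?V \<and> u \<noteq> v}"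
  define \<delta> where "\<delta> = Min W"
  have "{norm (u - v) | u v. u \<in> ?V \<and> v \<in> ?V \<and> u \<noteq> v} \<subseteq> (\<lambda>(u, v). norm (u - v)) ` (?V \<times> ?V)" by auto
  then have W: "finite W" unfolding W_def using P(1) by (auto intro: finite_subset)
  have "W \<noteq> {}" unfolding W_def by simp
  then have \<delta>: "\<delta> \<in> W" "\<And>w. w \<in> W \<Longrightarrow> \<delta> \<le> w"
    unfolding \<delta>_def using W Min_in Min_le by auto
  have \<delta>0: "0 < \<delta>" using \<delta>(1) unfolding W_def by auto
  have ge: "(c1 * real (length vs - 1) * \<delta>) powr p \<le> ?F vs" if vs: "vs \<in> ?G" for vs
  proof (rule pl_path_action_ge)
    show "length vs = Suc (length vs - 1)" "0 < length vs - 1" "set vs \<subseteq> D"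
      using vs P ab unfolding graph_paths_def by auto
    fix i assume i: "i < length vs - 1"
    then have "vs ! Suc i \<in> ?V" "vs ! i \<in> ?V" "vs ! Suc i \<noteq> vs ! i"
      using vs unfolding graph_paths_def by (auto simp: subset_iff)
    then have "norm (vs ! Suc i - vs ! i) \<in> W" unfolding W_def by blast
    then show "\<delta> \<le> norm (vs ! Suc i - vs ! i)" by (rule \<delta>(2))
  qed (use \<delta>0 in auto)
  obtain v0 where v0: "v0 \<in> ?G" using ne by blast
  have F0: "0 \<le> ?F v0" using ge[OF v0] by (meson order_trans powr_ge_zero)
  obtain M where M: "(?F v0 + 1) powr (1 / p) / (c1 * \<delta>) < real M" using reals_Archimedean2 by blast
  have short: "length vs \<le> M + 1" if vs: "vs \<in> ?G" "?F vs \<le> ?F v0" for vs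
  proof (rule ccontr)
    assume "\<not> length vs \<le> M + 1"
    then have "real M \<le> real (length vs - 1)" by simp
    have "(?F v0 + 1) powr (1 / p) < c1 * real M * \<delta>" using M c1_pos \<delta>0 by (simp add: field_simps)
    also have "\<dots> \<le> c1 * real (length vs - 1) * \<delta>"
      using \<open>real M \<le> _\<close> c1_pos \<delta>0 by (intro mult_right_mono mult_left_mono) auto
    finally have "((?F v0 + 1) powr (1 / p)) powr p < (c1 * real (length vs - 1) * \<delta>) powr p"
      using p_gt_1 by (intro powr_less_mono2) auto
    also have "\<dots> \<le> ?F v0" using ge[OF vs(1)] vs(2) by linarith
    finally show False using F0 p_gt_1 by (simp add: powr_powr)
  qed
  let ?G' = "{vs \<in> ?G. length vs \<le> M + 1}"
  have G': "?G' \<subseteq> {vs. set vs \<subseteq> ?V \<and> length vs \<le> M + 1}" unfolding graph_paths_def by auto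
  have "finite ?V" using P by simp
  then have fin: "finite ?G'" by (rule finite_subset[OF G' finite_lists_length_le])
  have "v0 \<in> ?G'" using short v0 by auto
  then obtain w where w: "w \<in> ?G'" "\<And>vs. vs \<in> ?G' \<Longrightarrow> ?F w \<le> ?F vs"
    using ex_is_arg_min_if_finite[OF fin, of ?F] unfolding is_arg_min_linorder by auto
  have "?F w \<le> ?F vs" if "vs \<in> ?G" for vs
  proof (cases "?F vs \<le> ?F v0")
    case True
    then show ?thesis using w(2) short that by auto
  next
    case False
    then show ?thesis using w(2)[OF \<open>v0 \<in> ?G'\<close>] by linarith
  qed
  then have "pl_path w \<in> argmin_on (path_action f) (pl_graph_paths P e a b)"
    using w(1) unfolding argmin_on_def pl_graph_paths_def is_arg_min_linorder by auto
  then show ?thesis by blast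
qed

text \<open>For coinciding end points the minimal path is constant, but consecutive vertices of a graph path
  are distinct. A step to a nearby sample point and back has small action. Its target is searched near
  a point \<open>y\<close> at distance \<open>\<epsilon> / 4\<close> from \<^term>\<open>a\<close>, so that it differs from \<^term>\<open>a\<close>.\<close>

lemma recovery_loop:
  assumes a: "a \<in> D" and q: "q \<in> D" "q \<noteq> a" and C: "0 < C"
  shows "\<exists>\<epsilon>0>0. \<forall>\<epsilon> P. 0 < \<epsilon> \<longrightarrow> \<epsilon> < \<epsilon>0 \<longrightarrow> P \<subseteq> D \<longrightarrow> (\<forall>x\<in>D. \<exists>y\<in>P. dist x y < \<epsilon> / 8) \<longrightarrow>
    (\<exists>vs\<in>graph_paths (P \<union> {a, a}) \<epsilon> a a. path_action f (pl_path vs) \<le> C powr p)"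
proof (intro exI[of _ "min (4 * dist a q) (C / c2)"] conjI allI impI)
  show "0 < min (4 * dist a q) (C / c2)" using q C c2_pos by simp
  fix \<epsilon> :: real and P :: "'a set"
  assume \<epsilon>: "0 < \<epsilon>" "\<epsilon> < min (4 * dist a q) (C / c2)" and P: "P \<subseteq> D"
    and dense: "\<forall>x\<in>D. \<exists>y\<in>P. dist x y < \<epsilon> / 8"
  define s where "s = \<epsilon> / (4 * dist a q)"
  have s: "0 \<le> s" "s \<le> 1" using \<epsilon> q unfolding s_def by (auto simp: field_simps)
  define y where "y = linepath a q s"
  have "y \<in> D" unfolding y_def by (intro linepath_in_D a q s)
  then obtain u where u: "u \<in> P" "dist y u < \<epsilon> / 8" using dense by blast
  have "y - a = s *\<^sub>R (q - a)" unfolding y_def linepath_def by (simp add: algebra_simps)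
  then have "dist y a = s * dist a q" using s by (simp add: dist_norm norm_minus_commute)
  also have "\<dots> = \<epsilon> / 4" using q unfolding s_def by simp
  finally have ya: "dist y a = \<epsilon> / 4" .
  have ua: "\<epsilon> / 8 < dist u a" "dist u a < 3 * \<epsilon> / 8"
    using dist_triangle[of y a u] dist_triangle[of u a y] u(2) ya \<epsilon>(1) by (auto simp: dist_commute)
  have uD: "u \<in> D" using u P by blast
  let ?vs = "[a, u, a]"
  have "?vs \<in> graph_paths (P \<union> {a, a}) \<epsilon> a a"
    unfolding graph_paths_def using u(1) ua \<epsilon>(1)
    by (auto simp: less_Suc_eq dist_norm norm_minus_commute nth_Cons split: nat.splits)
  moreover have "path_action f (pl_path ?vs) \<le> C powr p"
  proof (rule pl_path_action_le[of _ 2])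
    fix i :: nat assume "i < 2"
    then have i: "i = 0 \<or> i = 1" by auto
    have "c2 * dist u a \<le> c2 * (3 * \<epsilon> / 8)" using ua c2_pos by (intro mult_left_mono) auto
    also have "\<dots> \<le> C / 2"
    proof -
      have "c2 * \<epsilon> < C" using \<epsilon> c2_pos by (simp add: field_simps)
      moreover have "0 < c2 * \<epsilon>" using \<epsilon> c2_pos by simp
      moreover have "c2 * (3 * \<epsilon> / 8) = 3 * (c2 * \<epsilon>) / 8" by simp
      ultimately show ?thesis by linarith
    qed
    finally have "seg_cost a u \<le> C / 2" "seg_cost u a \<le> C / 2"
      using seg_cost_bounds(2)[OF a uD] seg_cost_bounds(2)[OF uD a] by (auto simp: dist_norm norm_minus_commute)
    then show "real 2 * seg_cost (?vs ! i) (?vs ! Suc i) \<le> C" using i by auto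
  qed (use a uD in auto)
  ultimately show "\<exists>vs\<in>graph_paths (P \<union> {a, a}) \<epsilon> a a. path_action f (pl_path vs) \<le> C powr p" by blast
qed

text \<open>A geodesic \<open>\<gamma>\<close>, sampled at \<open>m\<close> equidistant times, is replaced by nearby sample points. With
  \<open>m\<close> about \<open>4 * L / \<epsilon>\<close> consecutive points of the geodesic are at most \<open>\<epsilon> / 4\<close> apart, which leaves
  room for the displacements, while \<open>m * \<epsilon> \<le> 5 * L\<close> is bounded, so that displacements
  by \<open>\<kappa> * \<epsilon>\<close> change the velocities, which are \<open>m\<close> times the steps, only by a multiple of
  \<open>\<kappa>\<close>. A geodesic moves at constant speed, so its consecutive points are also at least a fixed
  multiple of \<open>\<epsilon>\<close> apart, and their replacements remain distinct.\<close>

lemma recovery_path: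
  assumes ab: "a \<in> D" "b \<in> D" "a \<noteq> b" and C: "geo_dist a b < C"
  shows "\<exists>\<kappa>>0. \<exists>\<epsilon>0>0. \<forall>\<epsilon> P. 0 < \<epsilon> \<longrightarrow> \<epsilon> < \<epsilon>0 \<longrightarrow> P \<subseteq> D \<longrightarrow> (\<forall>x\<in>D. \<exists>y\<in>P. dist x y < \<kappa> * \<epsilon>) \<longrightarrow>
    (\<exists>vs\<in>graph_paths (P \<union> {a, b}) \<epsilon> a b. path_action f (pl_path vs) \<le> C powr p)"
proof -
  define A where "A = geo_dist a b"
  have "0 < c1 * dist a b" using ab c1_pos by simp
  then have A: "0 < A" unfolding A_def using geo_dist_lower[OF ab(1,2)] by linarith
  have AC: "A < C" using C unfolding A_def .
  obtain \<gamma> where \<gamma>: "\<gamma> 0 = a" "\<gamma> 1 = b" "\<gamma> ` {0..1} \<subseteq> D"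
    "\<And>s t. 0 \<le> s \<Longrightarrow> s \<le> t \<Longrightarrow> t \<le> 1 \<Longrightarrow> geo_dist (\<gamma> s) (\<gamma> t) \<le> A * (t - s)"
    using geodesic_exists[OF ab(1,2)] unfolding A_def by metis
  define L where "L = A / c1"
  have L: "0 < L" using A c1_pos by (simp add: L_def)
  have lip: "L-lipschitz_on {0..1} \<gamma>"
    unfolding L_def using A by (intro lipschitz_of_geo_dist_le \<gamma>) auto
  have \<gamma>D: "\<gamma> t \<in> D" if "0 \<le> t" "t \<le> 1" for t using \<gamma>(3) that by auto
  have geo_dist_ge: "A * (t - s) \<le> geo_dist (\<gamma> s) (\<gamma> t)" if st: "0 \<le> s" "s \<le> t" "t \<le> 1" for s t
  proof -
    have "A \<le> geo_dist a (\<gamma> s) + geo_dist (\<gamma> s) (\<gamma> t) + geo_dist (\<gamma> t) b"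
      using geo_dist_triangle[OF ab(1) \<gamma>D ab(2), of s] geo_dist_triangle[OF \<gamma>D \<gamma>D ab(2), of s t] st
      unfolding A_def by auto
    moreover have "geo_dist a (\<gamma> s) \<le> A * (s - 0)" using \<gamma>(4)[of 0 s] \<gamma>(1) st by simp
    moreover have "geo_dist (\<gamma> t) b \<le> A * (1 - t)" using \<gamma>(4)[of t 1] \<gamma>(2) st by simp
    ultimately show ?thesis by (simp add: algebra_simps)
  qed
  \<comment> \<open>The three bounds serve, in turn: steps shorter than \<open>\<epsilon>\<close>; distinct consecutive vertices; and
    half of the admissible increase \<open>C - A\<close> of the speed. The other half goes to the errors
    \<open>e\<close> below.\<close>
  define \<kappa> where "\<kappa> = min (1 / 8) (min (A / (20 * L * c2)) ((C - A) / (20 * L * c2)))"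
  have \<kappa>: "0 < \<kappa>" "\<kappa> \<le> 1 / 8" "20 * L * c2 * \<kappa> \<le> A" "20 * L * c2 * \<kappa> \<le> C - A"
  proof -
    have "0 < 20 * L * c2" using L c2_pos by simp
    moreover have "\<kappa> \<le> A / (20 * L * c2)" "\<kappa> \<le> (C - A) / (20 * L * c2)" unfolding \<kappa>_def by auto
    ultimately show "20 * L * c2 * \<kappa> \<le> A" "20 * L * c2 * \<kappa> \<le> C - A"
      by (simp_all add: pos_le_divide_eq mult.commute)
    show "0 < \<kappa>" "\<kappa> \<le> 1 / 8" using A AC L c2_pos unfolding \<kappa>_def by auto
  qed
  define e where "e = (C - A) / (46 * L)"
  have e: "0 < e" "46 * (e * L) = C - A" using AC L unfolding e_def by auto
  obtain \<delta>1 where \<delta>1: "0 < \<delta>1"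
    "\<And>x y. x \<in> D \<Longrightarrow> y \<in> D \<Longrightarrow> dist x y < \<delta>1 \<Longrightarrow> seg_cost x y \<le> g x (y - x) + e * norm (y - x)"
    using seg_cost_local[OF e(1)] by metis
  obtain \<delta>2 where \<delta>2: "0 < \<delta>2"
    "\<And>x z v. x \<in> D \<Longrightarrow> z \<in> D \<Longrightarrow> dist x z < \<delta>2 \<Longrightarrow> g z v \<le> g x v + e * norm v"
    using g_modulus[OF e(1)] by metis
  obtain \<delta>3 where \<delta>3: "0 < \<delta>3"
    "\<And>x y. x \<in> D \<Longrightarrow> y \<in> D \<Longrightarrow> dist x y < \<delta>3 \<Longrightarrow> g x (y - x) \<le> geo_dist x y + e * norm (y - x)"
    using geo_dist_local[OF e(1)] by metis
  define \<epsilon>0 where "\<epsilon>0 = min L (min \<delta>1 (min \<delta>2 \<delta>3))"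
  have main: "\<exists>vs\<in>graph_paths (P \<union> {a, b}) \<epsilon> a b. path_action f (pl_path vs) \<le> C powr p"
    if \<epsilon>: "0 < \<epsilon>" "\<epsilon> < \<epsilon>0" and P: "P \<subseteq> D" and dense: "\<forall>x\<in>D. \<exists>y\<in>P. dist x y < \<kappa> * \<epsilon>" for \<epsilon> P
  proof -
    have \<epsilon>s: "\<epsilon> < L" "\<epsilon> < \<delta>1" "\<epsilon> < \<delta>2" "\<epsilon> < \<delta>3" using \<epsilon>(2) unfolding \<epsilon>0_def by auto
    define m where "m = nat \<lceil>4 * L / \<epsilon>\<rceil>"
    have m_ge: "4 * L / \<epsilon> \<le> real m" unfolding m_def by linarith
    have "0 < 4 * L / \<epsilon>" using L \<epsilon> by simp
    then have m0: "0 < m" using m_ge by (metis gr0I less_le_not_le of_nat_0)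
    have "real m \<le> 4 * L / \<epsilon> + 1" using \<open>0 < 4 * L / \<epsilon>\<close> unfolding m_def by linarith
    then have "real m * \<epsilon> \<le> (4 * L / \<epsilon> + 1) * \<epsilon>" using \<epsilon> by (intro mult_right_mono) auto
    then have m\<epsilon>: "real m * \<epsilon> \<le> 5 * L" using \<epsilon> \<epsilon>s(1) by (simp add: distrib_right)
    define x where "x i = \<gamma> (real i / real m)" for i
    have xD: "x i \<in> D" if "i \<le> m" for i unfolding x_def using that m0 by (intro \<gamma>D) auto
    have xs: "dist (x i) (x (Suc i)) \<le> L / real m" "geo_dist (x i) (x (Suc i)) \<le> A / real m"
      "A / real m \<le> geo_dist (x i) (x (Suc i))" if "i < m" for i
    proof -
      have r: "0 \<le> real i / real m" "real i / real m \<le> real (Suc i) / real m" "real (Suc i) / real m \<le> 1"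
        "real (Suc i) / real m - real i / real m = 1 / real m"
        using that by (auto simp: field_simps)
      have "dist (x i) (x (Suc i)) \<le> L * dist (real i / real m) (real (Suc i) / real m)"
        unfolding x_def using r by (intro lipschitz_onD[OF lip]) auto
      also have "dist (real i / real m) (real (Suc i) / real m) = 1 / real m"
        using r by (simp add: dist_real_def)
      finally show "dist (x i) (x (Suc i)) \<le> L / real m" by simp
      show "geo_dist (x i) (x (Suc i)) \<le> A / real m" "A / real m \<le> geo_dist (x i) (x (Suc i))"
        using \<gamma>(4)[OF r(1-3)] geo_dist_ge[OF r(1-3)] unfolding r(4) x_def by auto
    qed
    have "\<exists>y\<in>P. dist (x i) y < \<kappa> * \<epsilon>" if "i \<le> m" for i using dense xD[OF that] by blast
    then obtain y where y: "\<And>i. i \<le> m \<Longrightarrow> y i \<in> P" "\<And>i. i \<le> m \<Longrightarrow> dist (x i) (y i) < \<kappa> * \<epsilon>" by metis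
    define v where "v i = (if i = 0 then a else if i = m then b else y i)" for i
    have \<kappa>\<epsilon>: "0 < \<kappa> * \<epsilon>" using \<kappa> \<epsilon> by simp
    have vx: "dist (x i) (v i) < \<kappa> * \<epsilon>" if "i \<le> m" for i
      using y(2)[OF that] \<kappa>\<epsilon> m0 \<gamma>(1,2) unfolding v_def x_def by auto
    have vV: "v i \<in> P \<union> {a, b}" if "i \<le> m" for i using y(1)[OF that] unfolding v_def by auto
    have vD: "v i \<in> D" if "i \<le> m" for i using vV[OF that] P ab by auto
    let ?w = "\<lambda>i. v (Suc i) - v i" and ?d = "\<lambda>i. x (Suc i) - x i"
    have wd: "norm (?w i - ?d i) \<le> 2 * (\<kappa> * \<epsilon>)" if "i < m" for i
    proof -
      have "?w i - ?d i = (v (Suc i) - x (Suc i)) + (x i - v i)" by simp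
      also have "norm \<dots> \<le> norm (v (Suc i) - x (Suc i)) + norm (x i - v i)" by (rule norm_triangle_ineq)
      also have "\<dots> \<le> 2 * (\<kappa> * \<epsilon>)"
        using vx[of i] vx[of "Suc i"] that by (simp add: dist_norm norm_minus_commute)
      finally show ?thesis .
    qed
    have d_le: "norm (?d i) \<le> L / real m" if "i < m" for i
      using xs(1)[OF that] by (simp add: dist_norm norm_minus_commute)
    have L4: "L / real m \<le> \<epsilon> / 4" using m_ge m0 \<epsilon> by (simp add: field_simps)
    have w_le: "norm (?w i) \<le> L / real m + 2 * (\<kappa> * \<epsilon>)" if "i < m" for i
      using norm_triangle_ineq[of "?d i" "?w i - ?d i"] d_le[OF that] wd[OF that] by simp
    have \<kappa>\<epsilon>8: "\<kappa> * \<epsilon> \<le> \<epsilon> / 8" using \<kappa>(2) \<epsilon>(1) by simp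
    have w_lt: "norm (?w i) < \<epsilon>" if "i < m" for i
      using w_le[OF that] L4 \<kappa>\<epsilon>8 \<epsilon>(1) by linarith
    have m\<kappa>: "real m * (\<kappa> * \<epsilon>) \<le> 5 * L * \<kappa>"
      using mult_left_mono[OF m\<epsilon>, of \<kappa>] \<kappa>(1) by (simp add: mult.commute mult.left_commute)
    have w_pos: "0 < norm (?w i)" if i: "i < m" for i
    proof -
      have "A / real m \<le> c2 * norm (?d i)"
        using xs(3)[OF i] geo_dist_upper[of "x i" "x (Suc i)"] xD i by (fastforce simp: dist_norm norm_minus_commute)
      then have "A \<le> real m * (c2 * norm (?d i))" using m0 by (simp add: field_simps)
      moreover have "real m * (c2 * (2 * (\<kappa> * \<epsilon>))) < A"
      proof -
        have "real m * (c2 * (2 * (\<kappa> * \<epsilon>))) = 2 * c2 * (real m * (\<kappa> * \<epsilon>))" by simp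
        also have "\<dots> \<le> 2 * c2 * (5 * L * \<kappa>)" using m\<kappa> c2_pos by (intro mult_left_mono) auto
        also have "\<dots> = 20 * L * c2 * \<kappa> / 2" by simp
        also have "\<dots> < A" using \<kappa>(3) A by linarith
        finally show ?thesis .
      qed
      ultimately have "real m * (c2 * (2 * (\<kappa> * \<epsilon>))) < real m * (c2 * norm (?d i))" by linarith
      then have "2 * (\<kappa> * \<epsilon>) < norm (?d i)" using m0 c2_pos by simp
      then show ?thesis using norm_triangle_ineq4[of "?w i" "?w i - ?d i"] wd[OF i] by auto
    qed
    have cost: "real m * seg_cost (v i) (v (Suc i)) \<le> C" if i: "i < m" for i
    proof -
      have D4: "v i \<in> D" "v (Suc i) \<in> D" "x i \<in> D" "x (Suc i) \<in> D" using vD xD i by auto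
      have "seg_cost (v i) (v (Suc i)) \<le> g (v i) (?w i) + e * norm (?w i)"
        using w_lt[OF i] \<epsilon>s by (intro \<delta>1 D4) (auto simp: dist_norm norm_minus_commute)
      also have "g (v i) (?w i) \<le> g (x i) (?w i) + e * norm (?w i)"
      proof (rule \<delta>2(2)[OF D4(3,1)])
        show "dist (x i) (v i) < \<delta>2" using vx[of i] i \<kappa>\<epsilon>8 \<epsilon>s \<epsilon>(1) by linarith
      qed
      also have "g (x i) (?w i) \<le> g (x i) (?d i) + g (x i) (?w i - ?d i)"
        using g_add[OF D4(3), of "?d i" "?w i - ?d i"] by simp
      also have "g (x i) (?w i - ?d i) \<le> c2 * norm (?w i - ?d i)" by (rule g_upper[OF D4(3)])
      also have "g (x i) (?d i) \<le> geo_dist (x i) (x (Suc i)) + e * norm (?d i)"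
        using xs(1)[OF i] L4 \<epsilon>s \<epsilon>(1) by (intro \<delta>3 D4) linarith
      finally have "seg_cost (v i) (v (Suc i)) \<le> geo_dist (x i) (x (Suc i)) + e * norm (?d i)
          + c2 * norm (?w i - ?d i) + 2 * (e * norm (?w i))" by simp
      also have "\<dots> \<le> A / real m + e * (L / real m) + c2 * (2 * (\<kappa> * \<epsilon>)) + 2 * (e * (L / real m + 2 * (\<kappa> * \<epsilon>)))"
        using xs(2)[OF i] d_le[OF i] wd[OF i] w_le[OF i] e(1) c2_pos by (intro add_mono mult_left_mono) auto
      finally have "real m * seg_cost (v i) (v (Suc i)) \<le> real m * (A / real m + e * (L / real m)
          + c2 * (2 * (\<kappa> * \<epsilon>)) + 2 * (e * (L / real m + 2 * (\<kappa> * \<epsilon>))))"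
        by (intro mult_left_mono) auto
      also have "\<dots> = A + 3 * (e * L) + (2 * c2 + 4 * e) * (real m * (\<kappa> * \<epsilon>))"
        using m0 by (simp add: field_simps)
      also have "\<dots> \<le> A + 3 * (e * L) + (2 * c2 + 4 * e) * (5 * L * \<kappa>)"
        using m\<kappa> c2_pos e(1) by (intro add_left_mono mult_left_mono) auto
      also have "\<dots> = A + 3 * (e * L) + 20 * L * c2 * \<kappa> / 2 + 20 * (e * L) * \<kappa>"
        by (simp add: algebra_simps)
      also have "20 * (e * L) * \<kappa> \<le> 20 * (e * L) * 1"
        using \<kappa>(2) e(1) L by (intro mult_left_mono) auto
      also have "20 * L * c2 * \<kappa> / 2 \<le> (C - A) / 2" by (rule divide_right_mono[OF \<kappa>(4)]) simp
      finally have "real m * seg_cost (v i) (v (Suc i)) \<le> A + 23 * (e * L) + (C - A) / 2" by linarith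
      also have "23 * (e * L) = (C - A) / 2" using e(2) by simp
      also have "A + (C - A) / 2 + (C - A) / 2 = C" by (simp add: field_simps)
      finally show ?thesis .
    qed
    define vs where "vs = map v [0..<Suc m]"
    have len: "length vs = Suc m" and nth: "\<And>i. i \<le> m \<Longrightarrow> vs ! i = v i"
      unfolding vs_def by (auto simp del: upt_Suc)
    have sub: "set vs \<subseteq> P \<union> {a, b}"
    proof
      fix z assume "z \<in> set vs"
      then obtain i where "i \<le> m" "z = v i"
        unfolding vs_def by (auto simp: less_Suc_eq_le simp del: upt_Suc)
      then show "z \<in> P \<union> {a, b}" using vV by blast
    qed
    have "vs \<in> graph_paths (P \<union> {a, b}) \<epsilon> a b"
    proof -
      have ne: "vs \<noteq> []" using len by auto
      have "hd vs = a" "last vs = b"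
        using nth[of 0] nth[of m] len ne m0 by (auto simp: hd_conv_nth last_conv_nth v_def)
      moreover have "0 < norm (vs ! i - vs ! Suc i) \<and> norm (vs ! i - vs ! Suc i) < \<epsilon>" if "i < m" for i
        using w_pos[OF that] w_lt[OF that] nth[of i] nth[of "Suc i"] that by (simp add: norm_minus_commute)
      ultimately show ?thesis unfolding graph_paths_def using sub len m0 by auto
    qed
    moreover have "path_action f (pl_path vs) \<le> C powr p"
      using sub P ab cost nth by (intro pl_path_action_le[OF len m0]) auto
    ultimately show ?thesis by blast
  qed
  have "\<epsilon>0 > 0" using L \<delta>1(1) \<delta>2(1) \<delta>3(1) unfolding \<epsilon>0_def by simp
  then show ?thesis using main \<kappa>(1) by blast
qed

lemma recovery:
  assumes ab: "a \<in> D" "b \<in> D" and q: "q \<in> D" "q \<noteq> a" and C: "geo_dist a b < C"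
  obtains \<kappa> \<epsilon>0 where "0 < \<kappa>" "0 < \<epsilon>0"
    "\<And>\<epsilon> P. 0 < \<epsilon> \<Longrightarrow> \<epsilon> < \<epsilon>0 \<Longrightarrow> P \<subseteq> D \<Longrightarrow> \<forall>x\<in>D. \<exists>y\<in>P. dist x y < \<kappa> * \<epsilon> \<Longrightarrow>
      \<exists>vs\<in>graph_paths (P \<union> {a, b}) \<epsilon> a b. path_action f (pl_path vs) \<le> C powr p"
proof (cases "a = b")
  case True
  have "0 < C" using C geo_dist_nonneg[OF ab] by linarith
  then show ?thesis
    using recovery_loop[OF ab(1) q] that[of "1 / 8"] unfolding True by (simp, metis)
next
  case False
  then show ?thesis using recovery_path[OF ab False C] that by metis
qed

end

section \<open>Random samples are dense at the scale of the graph\<close>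

text \<open>The homothety with centre \<^term>\<open>x\<close> that shrinks \<^term>\<open>D\<close> into the ball of radius
  \<^term>\<open>r\<close> around \<^term>\<open>x\<close> maps the ball around \<^term>\<open>z\<close> into \<^term>\<open>D\<close>, by convexity. In particular
  \<^term>\<open>D\<close> has no thin corners.\<close>

lemma convex_contains_proportional_ball:
  fixes D :: "'a::real_normed_vector set"
  assumes D: "convex D" "bounded D" and z: "ball z R \<subseteq> D" "0 < R"
  obtains c r0 where "0 < c" "0 < r0"
    "\<And>x r. x \<in> D \<Longrightarrow> 0 < r \<Longrightarrow> r \<le> r0 \<Longrightarrow> \<exists>y. ball y (c * r) \<subseteq> D \<inter> ball x r"
proof -
  obtain B where B: "\<And>x. x \<in> D \<Longrightarrow> dist z x \<le> B" using D(2) unfolding bounded_any_center[where a = z] by blast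
  have "z \<in> D" using z by auto
  then have "0 \<le> B" using B[of z] by simp
  define \<Lambda> where "\<Lambda> = B + R"
  have \<Lambda>: "0 < \<Lambda>" using \<open>0 \<le> B\<close> z(2) by (simp add: \<Lambda>_def)
  have "\<exists>y. ball y (R / \<Lambda> * r) \<subseteq> D \<inter> ball x r" if x: "x \<in> D" and r: "0 < r" "r \<le> \<Lambda>" for x r
  proof (intro exI subsetI)
    define \<theta> where "\<theta> = r / \<Lambda>"
    have \<theta>: "0 < \<theta>" "\<theta> \<le> 1" "\<theta> * \<Lambda> = r" using r \<Lambda> by (auto simp: \<theta>_def)
    fix w assume "w \<in> ball (x + \<theta> *\<^sub>R (z - x)) (R / \<Lambda> * r)"
    then have w: "norm (w - (x + \<theta> *\<^sub>R (z - x))) < \<theta> * R"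
      by (simp add: dist_norm norm_minus_commute \<theta>_def mult.commute)
    define u where "u = x + (w - x) /\<^sub>R \<theta>"
    have wu: "w = (1 - \<theta>) *\<^sub>R x + \<theta> *\<^sub>R u" unfolding u_def using \<theta> by (simp add: algebra_simps)
    have "w - (x + \<theta> *\<^sub>R (z - x)) = \<theta> *\<^sub>R (u - z)" unfolding wu by (simp add: algebra_simps)
    then have "\<theta> * norm (u - z) < \<theta> * R" using w \<theta> by simp
    then have uz: "norm (u - z) < R" using \<theta> by simp
    then have uD: "u \<in> D" using z(1) by (auto simp: dist_norm norm_minus_commute)
    have "w \<in> D" unfolding wu using D(1) x uD \<theta> by (intro convexD) auto
    moreover have "norm (u - x) < \<Lambda>"
      using norm_triangle_ineq[of "u - z" "z - x"] uz B[OF x] unfolding \<Lambda>_def by (simp add: dist_norm)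
    then have "\<theta> * norm (u - x) < \<theta> * \<Lambda>" using \<theta>(1) by (rule mult_strict_left_mono)
    then have "dist x w < r"
    proof -
      have "w - x = \<theta> *\<^sub>R (u - x)" unfolding wu by (simp add: algebra_simps)
      then show ?thesis using \<open>\<theta> * norm (u - x) < _\<close> \<theta> by (simp add: dist_norm norm_minus_commute[of x w])
    qed
    ultimately show "w \<in> D \<inter> ball x r" by simp
  qed
  then show ?thesis using that[of "R / \<Lambda>" \<Lambda>] z(2) \<Lambda> by simp
qed

definition grid :: "real \<Rightarrow> nat \<Rightarrow> (real ^ 'd) set" where
  "grid h N = (\<lambda>k. \<chi> i. h * real_of_int (k i)) ` PiE UNIV (\<lambda>_. {- int N..int N})"

lemma finite_grid: "finite (grid h N :: (real ^ 'd) set)"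
  unfolding grid_def by (intro finite_imageI finite_PiE) auto

lemma card_grid_le: "card (grid h N :: (real ^ 'd) set) \<le> (2 * N + 1) ^ CARD('d)"
proof -
  have "card (grid h N :: (real ^ 'd) set) \<le> card (PiE (UNIV :: 'd set) (\<lambda>_. {- int N..int N}))"
    unfolding grid_def by (intro card_image_le finite_PiE) auto
  also have "\<dots> = (2 * N + 1) ^ CARD('d)" by (simp add: card_PiE nat_add_distrib nat_mult_distrib)
  finally show ?thesis .
qed

lemma grid_dense:
  fixes y :: "real ^ 'd"
  assumes h: "0 < h" and y: "norm y \<le> real N * h"
  shows "\<exists>q\<in>grid h N. dist y q \<le> real CARD('d) * h"
proof -
  define k where "k i = \<lfloor>y $ i / h\<rfloor>" for i
  define q :: "real ^ 'd" where "q = (\<chi> i. h * real_of_int (k i))"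
  have yi: "\<bar>y $ i / h\<bar> \<le> real N" for i
  proof -
    have "\<bar>y $ i\<bar> \<le> real N * h" using component_le_norm_cart[of y i] y by linarith
    then show ?thesis using h by (simp add: abs_divide field_simps)
  qed
  have kN: "k i \<in> {- int N..int N}" for i
  proof -
    have "- real N \<le> y $ i / h" "y $ i / h \<le> real N" using yi[of i] by linarith+
    then show ?thesis unfolding k_def by (auto simp: le_floor_iff floor_le_iff)
  qed
  then have q: "q \<in> grid h N" unfolding grid_def q_def by (intro imageI) auto
  have "dist y q \<le> (\<Sum>i\<in>UNIV. \<bar>(y - q) $ i\<bar>)" unfolding dist_norm by (rule norm_le_l1_cart)
  also have "\<dots> \<le> (\<Sum>i\<in>(UNIV :: 'd set). h)"
  proof (rule sum_mono)
    fix i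
    have "(y - q) $ i = h * (y $ i / h - real_of_int (k i))"
      using h unfolding q_def by (simp add: right_diff_distrib)
    moreover have "\<bar>y $ i / h - real_of_int (k i)\<bar> \<le> 1" unfolding k_def by linarith
    ultimately show "\<bar>(y - q) $ i\<bar> \<le> h" using h by (simp add: abs_mult mult_left_le)
  qed
  also have "\<dots> = real CARD('d) * h" by simp
  finally show ?thesis using q by blast
qed

lemma (in prob_space) prob_sample_misses_ball_le:
  fixes X :: "nat \<Rightarrow> 'a \<Rightarrow> 'b::euclidean_space" and \<rho> :: "'b \<Rightarrow> real"
  assumes indep: "indep_vars (\<lambda>_. borel) X {1..}"
    and dens: "\<forall>i\<ge>1. distributed M lborel (X i) (\<lambda>x. ennreal (\<rho> x * indicator D x))"
    and \<rho>: "0 < c0" "\<forall>x\<in>D. c0 \<le> \<rho> x" and B: "ball q s \<subseteq> D" "0 \<le> s" and n: "1 \<le> n"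
  shows "prob {\<omega> \<in> space M. \<forall>i\<in>{1..n}. X i \<omega> \<notin> ball q s}
    \<le> exp (- (real n * (c0 * measure lborel (ball q s))))"
proof -
  let ?v = "c0 * measure lborel (ball q s)"
  have fin: "emeasure lborel (ball q s) < \<infinity>" by (rule emeasure_lborel_ball_finite)
  have p: "prob (X i -` (- ball q s) \<inter> space M) \<le> exp (- ?v)" if i: "i \<in> {1..n}" for i
  proof -
    have d: "distributed M lborel (X i) (\<lambda>x. ennreal (\<rho> x * indicator D x))" using dens i by simp
    have "ennreal ?v = ennreal c0 * emeasure lborel (ball q s)"
      using \<rho> fin by (simp add: ennreal_mult' emeasure_eq_ennreal_measure)
    also have "\<dots> = (\<integral>\<^sup>+x. ennreal c0 * indicator (ball q s) x \<partial>lborel)"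
      by (simp add: nn_integral_cmult_indicator)
    also have "\<dots> \<le> (\<integral>\<^sup>+x. ennreal (\<rho> x * indicator D x) * indicator (ball q s) x \<partial>lborel)"
      using B \<rho> by (intro nn_integral_mono) (auto split: split_indicator intro!: ennreal_leI)
    also have "\<dots> = emeasure M (X i -` ball q s \<inter> space M)"
      by (rule distributed_emeasure[OF d, symmetric]) simp
    finally have "?v \<le> prob (X i -` ball q s \<inter> space M)"
      using \<rho> by (simp add: emeasure_eq_measure)
    moreover have "X i \<in> measurable M borel" using distributed_measurable[OF d] by simp
    then have "X i -` ball q s \<inter> space M \<in> events" by (rule measurable_sets) simp
    then have "prob (space M - (X i -` ball q s \<inter> space M)) = 1 - prob (X i -` ball q s \<inter> space M)"
      by (rule prob_compl)
    moreover have "space M - (X i -` ball q s \<inter> space M) = X i -` (- ball q s) \<inter> space M" by auto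
    ultimately show ?thesis using exp_ge_add_one_self[of "- ?v"] by simp
  qed
  have "{\<omega> \<in> space M. \<forall>i\<in>{1..n}. X i \<omega> \<notin> ball q s} = (\<Inter>i\<in>{1..n}. X i -` (- ball q s) \<inter> space M)"
    using n by auto
  also have "prob \<dots> = (\<Prod>i\<in>{1..n}. prob (X i -` (- ball q s) \<inter> space M))"
    using n by (intro indep_varsD[OF indep]) auto
  also have "\<dots> \<le> (\<Prod>i\<in>{1..n}. exp (- ?v))" using p by (intro prod_mono) auto
  also have "\<dots> = exp (- (real n * ?v))" by (simp add: exp_of_nat_mult[symmetric])
  finally show ?thesis .
qed

lemma eventually_ln_lt_of_limsup:
  fixes d :: nat
  assumes d: "0 < d" and \<epsilon>: "\<forall>n\<ge>1. \<epsilon> n > 0"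
    and rate: "limsup (\<lambda>n. ereal (ln (real n) powr (1 / real d) / real n powr (1 / real d) * (1 / \<epsilon> n))) = 0"
    and \<eta>: "0 < \<eta>"
  shows "\<forall>\<^sub>F n in sequentially. ln (real n) < \<eta> * (real n * \<epsilon> n ^ d)"
proof -
  have "limsup (\<lambda>n. ereal (ln (real n) powr (1 / real d) / real n powr (1 / real d) * (1 / \<epsilon> n)))
      < ereal (\<eta> powr (1 / real d))"
    unfolding rate using \<eta> by simp
  then have "\<forall>\<^sub>F n in sequentially. ereal (ln (real n) powr (1 / real d) / real n powr (1 / real d) * (1 / \<epsilon> n))
      < ereal (\<eta> powr (1 / real d))"
    by (rule Limsup_lessD)
  moreover have "\<forall>\<^sub>F n in sequentially. 2 \<le> (n::nat)" by (rule eventually_ge_at_top)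
  ultimately show ?thesis
  proof eventually_elim
    case (elim n)
    have n: "1 < real n" "0 < ln (real n)" "0 < \<epsilon> n" using elim(2) \<epsilon> by auto
    have r: "(x powr (1 / real d)) ^ d = x" if "0 < x" for x :: real
      using that d by (simp add: powr_realpow[symmetric] powr_powr)
    have "(ln (real n) powr (1 / real d) / real n powr (1 / real d) * (1 / \<epsilon> n)) ^ d < (\<eta> powr (1 / real d)) ^ d"
      using elim(1) n d by (intro power_strict_mono) auto
    then have "ln (real n) / real n * (1 / \<epsilon> n ^ d) < \<eta>"
      using r n \<eta> by (simp add: power_mult_distrib power_divide)
    then show ?case using n by (simp add: field_simps)
  qed
qed

text \<open>A union bound over a grid. For large \<open>n\<close>, every ball of radius \<open>\<kappa> * \<epsilon> n\<close> centred in \<^term>\<open>D\<close>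
  contains a ball that lies in \<^term>\<open>D\<close>, is centred at a grid point, and has radius \<open>s n\<close>, a fixed
  multiple of \<open>\<epsilon> n\<close>. By the growth condition a given such ball is missed by the sample with
  probability at most \<open>n powr - 3\<close>, and the number of grid points, of order \<open>\<epsilon> n powr - d\<close>, is at
  most of order \<open>n\<close>. The probabilities that some ball is missed are thus summable, and the Borel--Cantelli lemma applies.\<close>

lemma (in prob_space) sample_eventually_dense:
  fixes X :: "nat \<Rightarrow> 'a \<Rightarrow> real ^ 'd" and \<rho> :: "real ^ 'd \<Rightarrow> real"
  assumes D: "convex D" "bounded D" "interior D \<noteq> {}"
    and indep: "indep_vars (\<lambda>_. borel) X {1..}"
    and dens: "\<forall>i\<ge>1. distributed M lborel (X i) (\<lambda>x. ennreal (\<rho> x * indicator D x))"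
    and \<rho>: "0 < c0" "\<forall>x\<in>D. c0 \<le> \<rho> x"
    and \<epsilon>_pos: "\<forall>n\<ge>1. \<epsilon> n > 0" and \<epsilon>_lim: "\<epsilon> \<longlonglongrightarrow> 0"
    and rate: "limsup (\<lambda>n. ereal (ln (real n) powr (1 / real CARD('d))
                        / real n powr (1 / real CARD('d)) * (1 / \<epsilon> n))) = 0"
    and \<kappa>: "0 < \<kappa>"
  shows "AE \<omega> in M. \<forall>\<^sub>F n in sequentially. \<forall>x\<in>D. \<exists>i\<in>{1..n}. dist x (X i \<omega>) < \<kappa> * \<epsilon> n"
proof -
  let ?d = "CARD('d)"
  obtain z R where z: "ball z R \<subseteq> D" "0 < R" using D(3) by (meson ex_in_conv mem_interior)
  obtain c r0 where c: "0 < c" "0 < r0"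
    "\<And>x r. x \<in> D \<Longrightarrow> 0 < r \<Longrightarrow> r \<le> r0 \<Longrightarrow> \<exists>y. ball y (c * r) \<subseteq> D \<inter> ball x r"
    using convex_contains_proportional_ball[OF D(1,2) z] by metis
  obtain K where K: "0 < K" "\<And>x. x \<in> D \<Longrightarrow> norm x \<le> K" using D(2) bounded_pos by metis
  \<comment> \<open>Half the radius of the ball that \<open>D\<close> contains near each point at scale \<open>\<kappa> * \<epsilon> n\<close>; the mesh
    is so small that the centre of that ball has a grid point within \<open>s n\<close>.\<close>
  define s where "s n = c * \<kappa> / 2 * \<epsilon> n" for n
  define h where "h n = s n / (2 * real ?d)" for n
  define N where "N n = nat \<lceil>K / h n\<rceil>" for n
  define miss where "miss n q = {\<omega> \<in> space M. \<forall>i\<in>{1..n}. X i \<omega> \<notin> ball q (s n)}" for n and q :: "real ^ 'd"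
  define Q where "Q n = {q \<in> grid (h n) (N n). ball q (s n) \<subseteq> D}" for n
  define B where "B n = (\<Union>q\<in>Q n. miss n q)" for n
  have Xm: "X i \<in> measurable M borel" if "1 \<le> i" for i
    using distributed_measurable[of M lborel "X i"] dens that by auto
  have miss_ev: "miss n q \<in> events" for n q
  proof -
    have "X i -` ball q (s n) \<inter> space M \<in> events" if "i \<in> {1..n}" for i
      using Xm[of i] that by (intro measurable_sets[of _ _ borel]) auto
    then have "space M - (\<Union>i\<in>{1..n}. X i -` ball q (s n) \<inter> space M) \<in> events" by (intro sets.Diff sets.finite_UN) auto
    moreover have "miss n q = space M - (\<Union>i\<in>{1..n}. X i -` ball q (s n) \<inter> space M)" unfolding miss_def by auto
    ultimately show ?thesis by simp
  qed
  have finQ: "finite (Q n)" for n unfolding Q_def by (rule finite_subset[OF _ finite_grid]) auto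
  have B_ev: "B n \<in> events" for n unfolding B_def by (intro sets.finite_UN finQ miss_ev)
  define V where "V = unit_ball_vol (real ?d)"
  have V: "0 < V" unfolding V_def by simp
  have vol: "measure lborel (ball q (s n)) = V * s n ^ ?d" if "0 \<le> s n" for n and q :: "real ^ 'd"
    using content_ball[OF that, of q] unfolding V_def by simp
  define \<beta> where "\<beta> = c0 * V * (c * \<kappa> / 2) ^ ?d"
  have \<beta>: "0 < \<beta>" unfolding \<beta>_def using \<rho>(1) V c(1) \<kappa> by simp
  define C1 where "C1 = ((2 * K + 3) * (4 * real ?d / (c * \<kappa>))) ^ ?d"
  have C1: "0 \<le> C1" unfolding C1_def using K(1) c(1) \<kappa> by simp
  have h_lim: "h \<longlonglongrightarrow> 0"
  proof -
    have "(\<lambda>n. c * \<kappa> / 2 * \<epsilon> n / (2 * real ?d)) \<longlonglongrightarrow> c * \<kappa> / 2 * 0 / (2 * real ?d)"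
      by (intro tendsto_intros \<epsilon>_lim) simp
    then show ?thesis unfolding h_def s_def by simp
  qed
  have large: "\<forall>\<^sub>F n in sequentially. 3 \<le> n \<and> h n < 1 \<and> \<kappa> * \<epsilon> n < r0
      \<and> ln (real n) < \<beta> / 3 * (real n * \<epsilon> n ^ ?d) \<and> ln (real n) < 1 * (real n * \<epsilon> n ^ ?d)"
  proof (intro eventually_conj)
    show "\<forall>\<^sub>F n in sequentially. 3 \<le> (n::nat)" by (rule eventually_ge_at_top)
    show "\<forall>\<^sub>F n in sequentially. h n < 1" by (rule order_tendstoD(2)[OF h_lim]) simp
    show "\<forall>\<^sub>F n in sequentially. \<kappa> * \<epsilon> n < r0"
      by (rule order_tendstoD(2)[OF tendsto_mult_right_zero[OF \<epsilon>_lim] c(2)])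
    show "\<forall>\<^sub>F n in sequentially. ln (real n) < \<beta> / 3 * (real n * \<epsilon> n ^ ?d)"
      using \<beta> by (intro eventually_ln_lt_of_limsup \<epsilon>_pos rate) auto
    show "\<forall>\<^sub>F n in sequentially. ln (real n) < 1 * (real n * \<epsilon> n ^ ?d)"
      by (intro eventually_ln_lt_of_limsup \<epsilon>_pos rate) auto
  qed
  have bound: "\<forall>\<^sub>F n in sequentially. norm (prob (B n)) \<le> C1 * inverse (real n ^ 2)"
    using large
  proof eventually_elim
    case (elim n)
    have n: "3 \<le> n" "0 < real n" "1 \<le> n" using elim by auto
    have \<epsilon>n: "0 < \<epsilon> n" using \<epsilon>_pos n by auto
    have sn: "0 < s n" unfolding s_def using c(1) \<kappa> \<epsilon>n by simp
    have hn: "0 < h n" unfolding h_def using sn by simp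
    have "3 * ln (real n) \<le> real n * (c0 * (V * s n ^ ?d))"
    proof -
      have "s n ^ ?d = (c * \<kappa> / 2) ^ ?d * \<epsilon> n ^ ?d" unfolding s_def by (rule power_mult_distrib)
      then have "real n * (c0 * (V * s n ^ ?d)) = \<beta> * (real n * \<epsilon> n ^ ?d)"
        unfolding \<beta>_def by (simp only: mult.assoc mult.left_commute)
      then show ?thesis using elim by (simp add: field_simps)
    qed
    then have "exp (- (real n * (c0 * (V * s n ^ ?d)))) \<le> exp (- (3 * ln (real n)))" by simp
    also have "\<dots> = inverse (real n ^ 3)"
    proof -
      have "exp (3 * ln (real n)) = exp (ln (real n)) ^ 3" by (simp add: exp_of_nat_mult[symmetric])
      then show ?thesis using n by (simp add: exp_minus)
    qed
    finally have e3: "exp (- (real n * (c0 * (V * s n ^ ?d)))) \<le> inverse (real n ^ 3)" .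
    have pm: "prob (miss n q) \<le> inverse (real n ^ 3)" if "q \<in> Q n" for q
    proof -
      have "prob (miss n q) \<le> exp (- (real n * (c0 * measure lborel (ball q (s n)))))"
        unfolding miss_def using that sn n(3) unfolding Q_def
        by (intro prob_sample_misses_ball_le[OF indep dens \<rho>]) auto
      then show ?thesis using e3 sn by (simp add: vol)
    qed
    have "real (N n) \<le> K / h n + 1" unfolding N_def using K(1) hn by (simp add: of_nat_nat)
    then have "2 * real (N n) + 1 \<le> 2 * (K / h n) + 3" by simp
    also have "\<dots> \<le> 2 * (K / h n) + 3 / h n" using elim hn by (simp add: field_simps)
    also have "\<dots> = (2 * K + 3) * (1 / h n)" by (simp add: add_divide_distrib)
    also have "1 / h n = 4 * real ?d / (c * \<kappa>) * (1 / \<epsilon> n)" unfolding h_def s_def by simp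
    finally have N1: "2 * real (N n) + 1 \<le> (2 * K + 3) * (4 * real ?d / (c * \<kappa>)) * (1 / \<epsilon> n)"
      by (simp only: mult.assoc)
    have "card (Q n) \<le> card (grid (h n) (N n) :: (real ^ 'd) set)"
      unfolding Q_def by (intro card_mono finite_grid) auto
    also have "\<dots> \<le> (2 * N n + 1) ^ ?d" by (rule card_grid_le)
    finally have "real (card (Q n)) \<le> real ((2 * N n + 1) ^ ?d)" by (simp only: of_nat_le_iff)
    also have "\<dots> = (2 * real (N n) + 1) ^ ?d" by (simp add: add.commute)
    also have "\<dots> \<le> ((2 * K + 3) * (4 * real ?d / (c * \<kappa>)) * (1 / \<epsilon> n)) ^ ?d"
      by (rule power_mono[OF N1]) simp
    also have "\<dots> = C1 * (1 / \<epsilon> n ^ ?d)" unfolding C1_def by (simp only: power_mult_distrib power_one_over)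
    also have "\<dots> \<le> C1 * real n"
    proof (rule mult_left_mono[OF _ C1])
      have "1 \<le> ln (real n)" using n exp_le by (subst ln_ge_iff) (auto intro: order_trans[of _ 3])
      then have "1 \<le> real n * \<epsilon> n ^ ?d" using elim by linarith
      then show "1 / \<epsilon> n ^ ?d \<le> real n" using \<epsilon>n by (simp add: field_simps)
    qed
    finally have cQ: "real (card (Q n)) \<le> C1 * real n" .
    have "prob (B n) \<le> (\<Sum>q\<in>Q n. prob (miss n q))"
      unfolding B_def by (rule finite_measure_subadditive_finite[OF finQ]) (use miss_ev in auto)
    also have "\<dots> \<le> (\<Sum>q\<in>Q n. inverse (real n ^ 3))" by (rule sum_mono[OF pm])
    also have "\<dots> = real (card (Q n)) * inverse (real n ^ 3)" by simp
    also have "\<dots> \<le> C1 * real n * inverse (real n ^ 3)" using cQ by (intro mult_right_mono) auto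
    also have "\<dots> = C1 * inverse (real n ^ 2)" using n by (simp add: field_simps power2_eq_square power3_eq_cube)
    finally show "norm (prob (B n)) \<le> C1 * inverse (real n ^ 2)" by simp
  qed
  have "summable (\<lambda>n. C1 * inverse (real n ^ 2))"
    by (intro summable_mult inverse_power_summable) simp
  then have "summable (\<lambda>n. prob (B n))" by (rule summable_comparison_test_ev[OF bound])
  then have "AE \<omega> in M. \<forall>\<^sub>F n in sequentially. \<omega> \<in> space M - B n"
    by (intro borel_cantelli_AE1 B_ev) (auto simp: emeasure_eq_measure)
  then show ?thesis
  proof eventually_elim
    case (elim \<omega>)
    from elim large show ?case
    proof eventually_elim
      case (elim n)
      have \<epsilon>n: "0 < \<epsilon> n" using \<epsilon>_pos elim by auto
      have sn: "0 < s n" unfolding s_def using c(1) \<kappa> \<epsilon>n by simp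
      have hn: "0 < h n" unfolding h_def using sn by simp
      show ?case
      proof
        fix x assume x: "x \<in> D"
        obtain y where y: "ball y (c * (\<kappa> * \<epsilon> n)) \<subseteq> D \<inter> ball x (\<kappa> * \<epsilon> n)"
          using c(3)[OF x, of "\<kappa> * \<epsilon> n"] \<kappa> \<epsilon>n elim by auto
        have s2: "c * (\<kappa> * \<epsilon> n) = 2 * s n" unfolding s_def by simp
        have "y \<in> D" using y sn unfolding s2 by auto
        then have "norm y \<le> K" by (rule K(2))
        also have "K \<le> real (N n) * h n"
        proof -
          have "K / h n \<le> real (N n)" unfolding N_def by linarith
          then show ?thesis using hn by (simp add: field_simps)
        qed
        finally obtain q where q: "q \<in> grid (h n) (N n)" "dist y q \<le> real ?d * h n"
          using grid_dense[OF hn] by blast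
        have "real ?d * h n < s n" unfolding h_def using sn by simp
        then have yq: "dist y q < s n" using q(2) by linarith
        have bq: "ball q (s n) \<subseteq> ball y (2 * s n)"
        proof
          fix w assume "w \<in> ball q (s n)"
          then show "w \<in> ball y (2 * s n)" using yq dist_triangle[of y w q] by simp
        qed
        then have "q \<in> Q n" unfolding Q_def using q(1) y s2 by auto
        then have "\<omega> \<notin> miss n q" using elim(1) unfolding B_def by blast
        then obtain i where i: "i \<in> {1..n}" "X i \<omega> \<in> ball q (s n)"
          using elim(1) unfolding miss_def by blast
        then have "X i \<omega> \<in> ball x (\<kappa> * \<epsilon> n)" using bq y unfolding s2 by blast
        then show "\<exists>i\<in>{1..n}. dist x (X i \<omega>) < \<kappa> * \<epsilon> n" using i(1) by auto
      qed
    qed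
  qed
qed

section \<open>Convergence of the minimal paths\<close>

text \<open>The root of a convex \<^term>\<open>p\<close>-homogeneous function is subadditive, because its unit ball
  \<open>{v. F v \<le> 1}\<close> is convex: \<^term>\<open>u + v\<close> is the sum of the two roots times a convex combination
  of unit vectors.\<close>

lemma powr_root_subadditive:
  fixes F :: "'a::real_vector \<Rightarrow> real"
  assumes p: "0 < p" and nn: "\<And>v. 0 \<le> F v" and F0: "\<And>v. F v = 0 \<Longrightarrow> v = 0"
    and conv: "convex_on UNIV F" and hom: "\<And>c v. 0 < c \<Longrightarrow> F (c *\<^sub>R v) = c powr p * F v"
  shows "F (u + v) powr (1 / p) \<le> F u powr (1 / p) + F v powr (1 / p)"
proof (cases "u = 0 \<or> v = 0")
  case True
  then show ?thesis by auto
next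
  case False
  define s t where "s = F u powr (1 / p)" and "t = F v powr (1 / p)"
  have pos: "0 < F u" "0 < F v" using False F0[of u] F0[of v] nn[of u] nn[of v] by (auto simp: less_le)
  have st: "0 < s" "0 < t" using pos unfolding s_def t_def by auto
  have unit: "F (w /\<^sub>R F w powr (1 / p)) = 1" if "0 < F w" for w
    using that p hom[of "inverse (F w powr (1 / p))" w]
    by (simp add: powr_powr inverse_powr[symmetric] powr_minus[symmetric] powr_minus_divide)
  have "u + v = (s + t) *\<^sub>R ((s / (s + t)) *\<^sub>R (u /\<^sub>R s) + (t / (s + t)) *\<^sub>R (v /\<^sub>R t))"
    using st by (simp add: scaleR_right_distrib)
  then have "F (u + v) = (s + t) powr p * F ((s / (s + t)) *\<^sub>R (u /\<^sub>R s) + (t / (s + t)) *\<^sub>R (v /\<^sub>R t))"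
    using hom st by (metis add_pos_pos)
  also have "\<dots> \<le> (s + t) powr p * 1"
  proof (rule mult_left_mono)
    have "F ((s / (s + t)) *\<^sub>R (u /\<^sub>R s) + (t / (s + t)) *\<^sub>R (v /\<^sub>R t))
        \<le> s / (s + t) * F (u /\<^sub>R s) + t / (s + t) * F (v /\<^sub>R t)"
    proof -
      have eq: "1 - t / (s + t) = s / (s + t)" using st by (simp add: field_simps)
      show ?thesis
        using convex_onD[OF conv, of "t / (s + t)" "u /\<^sub>R s" "v /\<^sub>R t"] st unfolding eq by simp
    qed
    also have "\<dots> = 1" using unit[OF pos(1)] unit[OF pos(2)] st
      unfolding s_def[symmetric] t_def[symmetric] by (simp add: add_divide_distrib[symmetric])
    finally show "F ((s / (s + t)) *\<^sub>R (u /\<^sub>R s) + (t / (s + t)) *\<^sub>R (v /\<^sub>R t)) \<le> 1" .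
  qed simp
  finally have "F (u + v) powr (1 / p) \<le> ((s + t) powr p) powr (1 / p)"
    using nn p by (intro powr_mono2) auto
  also have "\<dots> = s + t" using st p by (simp add: powr_powr)
  finally show ?thesis unfolding s_def t_def .
qed

lemma finsler_action_root:
  fixes D :: "'a::euclidean_space set"
  assumes D: "compact D" "convex D" and p: "1 < p"
    and nonneg: "\<forall>x\<in>D. \<forall>v. 0 \<le> f x v"
    and cont: "continuous_on (D \<times> UNIV) (\<lambda>(x, v). f x v)"
    and conv: "\<forall>x\<in>D. convex_on UNIV (f x)"
    and hom: "\<forall>x\<in>D. \<forall>v. \<forall>c>0. f x (c *\<^sub>R v) = c powr p * f x v"
    and bd: "0 < m1" "0 < m2" "\<forall>x\<in>D. \<forall>v. m1 * norm v powr p \<le> f x v \<and> f x v \<le> m2 * norm v powr p"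
  shows "finsler_action D (\<lambda>x v. f x v powr (1 / p)) (m1 powr (1 / p)) (m2 powr (1 / p)) f p"
proof
  have f0: "f x 0 = 0" if "x \<in> D" for x
    using bd(3) nonneg that p by (metis mult_zero_right norm_zero order_antisym powr_0 mult_eq_0_iff)
  show "compact D" "convex D" "1 < p" by fact+
  show "continuous_on (D \<times> UNIV) (\<lambda>(x, v). f x v)" by fact
  show "0 < m1 powr (1 / p)" "0 < m2 powr (1 / p)" using bd by auto
  have "continuous_on (D \<times> UNIV) (\<lambda>z. (case z of (x, v) \<Rightarrow> f x v) powr (1 / p))"
    using nonneg p by (intro continuous_on_powr' cont continuous_on_const) auto
  then show "continuous_on (D \<times> UNIV) (\<lambda>(x, v). f x v powr (1 / p))"
    by (simp add: case_prod_unfold)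
  fix x assume x: "x \<in> D"
  show "f x v = (f x v powr (1 / p)) powr p" for v
    using nonneg x p by (simp add: powr_powr)
  show "f x (c *\<^sub>R v) powr (1 / p) = c * f x v powr (1 / p)" if "0 \<le> c" for c v
  proof (cases "c = 0")
    case False
    then have "f x (c *\<^sub>R v) = c powr p * f x v" using hom x that by auto
    then show ?thesis using p that nonneg x by (simp add: powr_mult powr_powr)
  qed (simp add: f0[OF x])
  show "f x (u + v) powr (1 / p) \<le> f x u powr (1 / p) + f x v powr (1 / p)" for u v
  proof (rule powr_root_subadditive)
    show "w = 0" if "f x w = 0" for w
    proof (rule ccontr)
      assume "w \<noteq> 0"
      then have "0 < m1 * norm w powr p" using bd(1) by simp
      then show False using bd(3) x that by (metis not_less)
    qed
  qed (use p nonneg conv hom x in auto)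
  have root: "(m * norm v powr p) powr (1 / p) = m powr (1 / p) * norm v" if "0 < m" for m v
    using that p by (simp add: powr_mult powr_powr)
  show "m1 powr (1 / p) * norm v \<le> f x v powr (1 / p)" for v
    unfolding root[OF bd(1), symmetric] using bd x p by (intro powr_mono2) auto
  show "f x v powr (1 / p) \<le> m2 powr (1 / p) * norm v" for v
    unfolding root[OF bd(2), symmetric] using bd x p nonneg by (intro powr_mono2) auto
qed

context finsler_action
begin

text \<open>The deterministic part of the theorem, for vertex sets that are eventually dense at every multiple
  of the scale \<^term>\<open>\<epsilon>\<close>. Graph paths are Lipschitz paths, so their actions are at least
  \<open>geo_dist a b powr p\<close>; by \<open>recovery\<close> some come close to it, and minimal graph paths are then a minimizing
  sequence.\<close>

lemma graph_minima_converge: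
  assumes ab: "a \<in> D" "b \<in> D" and int: "interior D \<noteq> {}"
    and P: "\<And>n. finite (P n)" "\<And>n. P n \<subseteq> D"
    and \<epsilon>: "\<forall>n\<ge>1. \<epsilon> n > 0" "\<epsilon> \<longlonglongrightarrow> 0"
    and dense: "\<forall>\<kappa>>0. \<forall>\<^sub>F n in sequentially. \<forall>x\<in>D. \<exists>y\<in>P n. dist x y < \<kappa> * \<epsilon> n"
  defines "\<Omega> \<equiv> lipschitz_paths D a b" and "\<Omega>l \<equiv> \<lambda>n. pl_graph_paths (P n) (\<epsilon> n) a b"
  shows "\<forall>\<^sub>F n in sequentially. argmin_on (path_action f) (\<Omega>l n) \<noteq> {}"
    and "(\<lambda>n. INF \<gamma>\<in>\<Omega>l n. path_action f \<gamma>) \<longlonglongrightarrow> (INF \<gamma>\<in>\<Omega>. path_action f \<gamma>)"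
    and "\<And>\<gamma>. \<forall>\<^sub>F n in sequentially. \<gamma> n \<in> argmin_on (path_action f) (\<Omega>l n) \<Longrightarrow>
      strict_mono (r :: nat \<Rightarrow> nat) \<Longrightarrow>
      \<exists>s :: nat \<Rightarrow> nat. strict_mono s \<and>
        (\<exists>\<eta>\<in>argmin_on (path_action f) \<Omega>. uniform_limit {0..1} (\<lambda>k. \<gamma> (r (s k))) \<eta> sequentially)"
proof -
  let ?F = "path_action f"
  define A where "A = geo_dist a b"
  have A0: "0 \<le> A" unfolding A_def by (rule geo_dist_nonneg[OF ab])
  have sub: "\<Omega>l n \<subseteq> \<Omega>" for n
    unfolding \<Omega>_def \<Omega>l_def by (rule pl_graph_paths_lipschitz[OF P(2) ab])
  have ge: "A powr p \<le> ?F \<gamma>" if "\<gamma> \<in> \<Omega>" for \<gamma>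
    using that lipschitz_paths_action_ge unfolding \<Omega>_def A_def by blast
  obtain q where q: "q \<in> D" "q \<noteq> a"
  proof (rule ccontr)
    assume "\<not> thesis"
    then have "D \<subseteq> {a}" using that by blast
    then have "interior D \<subseteq> interior {a}" by (rule interior_mono)
    then show False using int by simp
  qed
  have approx: "\<forall>\<^sub>F n in sequentially. \<exists>\<gamma>\<in>\<Omega>l n. ?F \<gamma> \<le> A powr p + e" if e: "0 < e" for e
  proof -
    define C where "C = (A powr p + e) powr (1 / p)"
    have "(A powr p) powr (1 / p) < C"
      unfolding C_def using e p_gt_1 by (intro powr_less_mono2) auto
    then have "geo_dist a b < C" using A0 p_gt_1 unfolding A_def by (simp add: powr_powr)
    then obtain \<kappa> \<epsilon>0 where rec: "0 < \<kappa>" "0 < \<epsilon>0"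
      "\<And>\<epsilon> P. 0 < \<epsilon> \<Longrightarrow> \<epsilon> < \<epsilon>0 \<Longrightarrow> P \<subseteq> D \<Longrightarrow> \<forall>x\<in>D. \<exists>y\<in>P. dist x y < \<kappa> * \<epsilon> \<Longrightarrow>
        \<exists>vs\<in>graph_paths (P \<union> {a, b}) \<epsilon> a b. ?F (pl_path vs) \<le> C powr p"
      using recovery[OF ab q] by metis
    have Cp: "C powr p = A powr p + e" unfolding C_def using e p_gt_1 by (simp add: powr_powr add_nonneg_nonneg)
    have "\<forall>\<^sub>F n in sequentially. \<epsilon> n < \<epsilon>0" by (rule order_tendstoD(2)[OF \<epsilon>(2) rec(2)])
    moreover have "\<forall>\<^sub>F n in sequentially. 1 \<le> (n::nat)" by (rule eventually_ge_at_top)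
    ultimately show ?thesis using dense[THEN spec, THEN mp, OF rec(1)]
    proof eventually_elim
      case (elim n)
      then obtain vs where "vs \<in> graph_paths (P n \<union> {a, b}) (\<epsilon> n) a b" "?F (pl_path vs) \<le> C powr p"
        using rec(3)[of "\<epsilon> n" "P n"] P(2) \<epsilon>(1) by auto
      then show ?case unfolding \<Omega>l_def pl_graph_paths_def Cp by blast
    qed
  qed
  have ne: "\<forall>\<^sub>F n in sequentially. \<Omega>l n \<noteq> {}"
    using approx[of 1] by (auto elim: eventually_mono)
  then show "\<forall>\<^sub>F n in sequentially. argmin_on ?F (\<Omega>l n) \<noteq> {}"
  proof eventually_elim
    case (elim n)
    then show ?case unfolding \<Omega>l_def
      by (intro argmin_pl_graph_paths_nonempty P ab) (auto simp: pl_graph_paths_def)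
  qed
  have bdd: "bdd_below (?F ` \<Omega>l n)" for n using ge sub by (intro bdd_belowI2[of _ "A powr p"]) auto
  have min\<Omega>: "(INF \<gamma>\<in>\<Omega>. ?F \<gamma>) = A powr p"
    unfolding \<Omega>_def A_def by (rule min_path_action(1)[OF ab])
  have lim: "(\<lambda>n. INF \<gamma>\<in>\<Omega>l n. ?F \<gamma>) \<longlonglongrightarrow> A powr p"
  proof (rule order_tendstoI)
    fix y assume y: "y < A powr p"
    show "\<forall>\<^sub>F n in sequentially. y < (INF \<gamma>\<in>\<Omega>l n. ?F \<gamma>)"
      using ne
    proof eventually_elim
      case (elim n)
      have "A powr p \<le> (INF \<gamma>\<in>\<Omega>l n. ?F \<gamma>)" using elim ge sub by (intro cINF_greatest) auto
      then show ?case using y by linarith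
    qed
  next
    fix y assume y: "A powr p < y"
    have "\<forall>\<^sub>F n in sequentially. \<exists>\<gamma>\<in>\<Omega>l n. ?F \<gamma> \<le> A powr p + (y - A powr p) / 2"
      using y by (intro approx) simp
    then show "\<forall>\<^sub>F n in sequentially. (INF \<gamma>\<in>\<Omega>l n. ?F \<gamma>) < y"
    proof eventually_elim
      case (elim n)
      then obtain \<gamma> where \<gamma>: "\<gamma> \<in> \<Omega>l n" "?F \<gamma> \<le> A powr p + (y - A powr p) / 2" by blast
      have "(INF \<gamma>\<in>\<Omega>l n. ?F \<gamma>) \<le> ?F \<gamma>" by (rule cINF_lower[OF bdd \<gamma>(1)])
      moreover have "A powr p + (y - A powr p) / 2 < y" using y by (simp add: field_simps)
      ultimately show ?case using \<gamma>(2) by linarith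
    qed
  qed
  show "(\<lambda>n. INF \<gamma>\<in>\<Omega>l n. ?F \<gamma>) \<longlonglongrightarrow> (INF \<gamma>\<in>\<Omega>. ?F \<gamma>)" unfolding min\<Omega> by (rule lim)
  fix \<gamma> and r :: "nat \<Rightarrow> nat"
  assume \<gamma>: "\<forall>\<^sub>F n in sequentially. \<gamma> n \<in> argmin_on ?F (\<Omega>l n)" and r: "strict_mono r"
  have F\<gamma>: "?F (\<gamma> n) = (INF \<gamma>\<in>\<Omega>l n. ?F \<gamma>)" if "\<gamma> n \<in> argmin_on ?F (\<Omega>l n)" for n
  proof -
    have m: "\<gamma> n \<in> \<Omega>l n" "\<And>\<eta>. \<eta> \<in> \<Omega>l n \<Longrightarrow> ?F (\<gamma> n) \<le> ?F \<eta>"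
      using that unfolding argmin_on_def is_arg_min_linorder by auto
    show ?thesis
    proof (rule antisym)
      show "?F (\<gamma> n) \<le> (INF \<gamma>\<in>\<Omega>l n. ?F \<gamma>)" using m by (intro cINF_greatest) auto
      show "(INF \<gamma>\<in>\<Omega>l n. ?F \<gamma>) \<le> ?F (\<gamma> n)" by (rule cINF_lower[OF bdd m(1)])
    qed
  qed
  have "\<forall>\<^sub>F n in sequentially. (INF \<gamma>\<in>\<Omega>l n. ?F \<gamma>) = ?F (\<gamma> n)"
    using \<gamma> by eventually_elim (simp add: F\<gamma>)
  then have F_lim: "(\<lambda>n. ?F (\<gamma> n)) \<longlonglongrightarrow> A powr p" using lim by (rule Lim_transform_eventually[rotated])
  have "\<forall>\<^sub>F k in sequentially. \<gamma> (r k) \<in> argmin_on ?F (\<Omega>l (r k))" by (rule eventually_subseq[OF r \<gamma>])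
  then obtain K where K: "\<And>k. K \<le> k \<Longrightarrow> \<gamma> (r k) \<in> argmin_on ?F (\<Omega>l (r k))"
    unfolding eventually_sequentially by blast
  \<comment> \<open>The first \<open>K\<close> members of the subsequence may be arbitrary functions.\<close>
  have mono: "strict_mono (\<lambda>k. r (k + K))" using r by (simp add: strict_mono_def)
  have "\<gamma> (r (k + K)) \<in> lipschitz_paths D a b" for k
    using K[of "k + K"] sub unfolding argmin_on_def is_arg_min_def \<Omega>_def by auto
  moreover have "(\<lambda>k. ?F (\<gamma> (r (k + K)))) \<longlonglongrightarrow> geo_dist a b powr p"
    using LIMSEQ_subseq_LIMSEQ[OF F_lim mono] unfolding A_def by (simp add: o_def)
  ultimately obtain s \<eta> where s: "strict_mono (s :: nat \<Rightarrow> nat)"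
    "\<eta> \<in> argmin_on ?F (lipschitz_paths D a b)"
    "uniform_limit {0..1} (\<lambda>k. \<gamma> (r (s k + K))) \<eta> sequentially"
    using minimizing_sequence_subconverges[OF ab, of "\<lambda>k. \<gamma> (r (k + K))"] by metis
  show "\<exists>s :: nat \<Rightarrow> nat. strict_mono s \<and>
      (\<exists>\<eta>\<in>argmin_on ?F \<Omega>. uniform_limit {0..1} (\<lambda>k. \<gamma> (r (s k))) \<eta> sequentially)"
    using s unfolding \<Omega>_def by (intro exI[of _ "\<lambda>k. s k + K"]) (auto simp: strict_mono_def)
qed

end

lemma uniform_limit_of_subsequences:
  fixes \<gamma> :: "nat \<Rightarrow> 'a \<Rightarrow> 'b::metric_space"
  assumes "\<And>r :: nat \<Rightarrow> nat. strict_mono r \<Longrightarrow>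
    \<exists>s :: nat \<Rightarrow> nat. \<exists>\<eta>'. uniform_limit S (\<lambda>k. \<gamma> (r (s k))) \<eta>' sequentially \<and> (\<forall>t\<in>S. \<eta>' t = \<eta> t)"
  shows "uniform_limit S \<gamma> \<eta> sequentially"
proof (rule ccontr)
  assume "\<not> uniform_limit S \<gamma> \<eta> sequentially"
  then obtain e where e: "0 < e" "\<not> (\<forall>\<^sub>F n in sequentially. \<forall>t\<in>S. dist (\<gamma> n t) (\<eta> t) < e)"
    unfolding uniform_limit_iff by blast
  obtain r :: "nat \<Rightarrow> nat" where r: "strict_mono r" "\<And>n. \<not> (\<forall>t\<in>S. dist (\<gamma> (r n) t) (\<eta> t) < e)"
    using not_eventually_sequentiallyD[OF e(2)] by blast
  obtain s :: "nat \<Rightarrow> nat" and \<eta>' where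
    s: "uniform_limit S (\<lambda>k. \<gamma> (r (s k))) \<eta>' sequentially" "\<forall>t\<in>S. \<eta>' t = \<eta> t"
    using assms[OF r(1)] by blast
  have "\<forall>\<^sub>F k in sequentially. \<forall>t\<in>S. dist (\<gamma> (r (s k)) t) (\<eta>' t) < e"
    using s(1) e(1) unfolding uniform_limit_iff by blast
  then obtain k where "\<forall>t\<in>S. dist (\<gamma> (r (s k)) t) (\<eta>' t) < e"
    using eventually_happens'[of sequentially] by auto
  then show False using r(2)[of "s k"] s(2) by auto
qed

theorem theorem2p1:
  fixes D :: "(real ^ 'd) set"
    and f :: "real ^ 'd \<Rightarrow> real ^ 'd \<Rightarrow> real"
    and p m1 m2 c0 :: real
    and a b :: "real ^ 'd"
    and M :: "'w measure"
    and X :: "nat \<Rightarrow> 'w \<Rightarrow> real ^ 'd"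
    and \<rho> :: "real ^ 'd \<Rightarrow> real"
    and \<epsilon> :: "nat \<Rightarrow> real"
  assumes D: "\<exists>U. open U \<and> U \<noteq> {} \<and> bounded U \<and> convex U \<and> D = closure U"
    and p: "p > 1"
    and f_nonneg: "\<forall>x\<in>D. \<forall>v. 0 \<le> f x v"
    and A0_cont: "continuous_on (D \<times> UNIV) (\<lambda>(x, v). f x v)"
    and A0_C1: "C1_on (\<lambda>(x, v). f x v) (D \<times> (UNIV - {0}))"
    and A1: "\<forall>x\<in>D. convex_on UNIV (f x)"
    and A2: "\<forall>x\<in>D. \<forall>v. \<forall>c>0. f x (c *\<^sub>R v) = c powr p * f x v"
    and A3: "m1 > 0" "m2 > 0"
      "\<forall>x\<in>D. \<forall>v. m1 * norm v powr p \<le> f x v \<and> f x v \<le> m2 * norm v powr p"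
    and ab: "a \<in> D" "b \<in> D"
    and M: "prob_space M"
    and X_in: "\<forall>i\<ge>1. \<forall>\<omega>\<in>space M. X i \<omega> \<in> D"
    and X_indep: "prob_space.indep_vars M (\<lambda>_. borel) X {1..}"
    and X_density: "\<forall>i\<ge>1. distributed M lborel (X i) (\<lambda>x. ennreal (\<rho> x * indicator D x))"
    and \<rho>: "c0 > 0" "\<forall>x\<in>D. c0 \<le> \<rho> x \<and> \<rho> x \<le> inverse c0"
    and \<epsilon>_pos: "\<forall>n\<ge>1. \<epsilon> n > 0"
    and \<epsilon>_lim: "\<epsilon> \<longlonglongrightarrow> 0"
    and \<epsilon>_rate: "limsup (\<lambda>n. ereal (ln (real n) powr (1 / real CARD('d))
                        / real n powr (1 / real CARD('d)) * (1 / \<epsilon> n))) = 0"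
  defines "F \<equiv> path_action f"
    and "\<Omega> \<equiv> lipschitz_paths D a b"
    and "\<Omega>l \<equiv> (\<lambda>\<omega> n. pl_graph_paths ((\<lambda>i. X i \<omega>) ` {1..n}) (\<epsilon> n) a b)"
  shows "AE \<omega> in M.
      ((\<forall>\<^sub>F n in sequentially. argmin_on F (\<Omega>l \<omega> n) \<noteq> {}) \<and> argmin_on F \<Omega> \<noteq> {} \<and>
         (\<lambda>n. INF \<gamma>\<in>\<Omega>l \<omega> n. F \<gamma>) \<longlonglongrightarrow> (INF \<gamma>\<in>\<Omega>. F \<gamma>))
      \<and> (\<forall>\<gamma>. (\<forall>\<^sub>F n in sequentially. \<gamma> n \<in> argmin_on F (\<Omega>l \<omega> n)) \<longrightarrow>
           (\<forall>r :: nat \<Rightarrow> nat. strict_mono r \<longrightarrow>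
             (\<exists>s :: nat \<Rightarrow> nat. strict_mono s \<and>
               (\<exists>\<eta>\<in>argmin_on F \<Omega>. uniform_limit {0..1} (\<lambda>k. \<gamma> (r (s k))) \<eta> sequentially))))
      \<and> (\<forall>\<gamma>. (\<forall>\<^sub>F n in sequentially. \<gamma> n \<in> argmin_on F (\<Omega>l \<omega> n)) \<longrightarrow>
           (\<forall>\<eta>\<in>argmin_on F \<Omega>. (\<forall>\<eta>'\<in>argmin_on F \<Omega>. \<forall>t\<in>{0..1}. \<eta>' t = \<eta> t) \<longrightarrow>
             uniform_limit {0..1} \<gamma> \<eta> sequentially))"
proof -
  interpret prob_space M by (rule M)
  obtain U where U: "open U" "U \<noteq> {}" "bounded U" "convex U" "D = closure U" using D by blast
  have cD: "compact D" "convex D" "bounded D"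
    unfolding U(5) using U by (auto intro: convex_closure)
  have "U \<subseteq> interior D" unfolding U(5) using U(1) by (intro interior_maximal closure_subset)
  then have iD: "interior D \<noteq> {}" using U(2) by blast
  interpret finsler_action D "\<lambda>x v. f x v powr (1 / p)" "m1 powr (1 / p)" "m2 powr (1 / p)" f p
    by (rule finsler_action_root[OF cD(1,2) p f_nonneg A0_cont A1 A2 A3])
  have "AE \<omega> in M. \<forall>\<^sub>F n in sequentially. \<forall>x\<in>D. \<exists>i\<in>{1..n}. dist x (X i \<omega>) < 1 / real (Suc k) * \<epsilon> n" for k
    by (rule sample_eventually_dense[OF cD(2,3) iD X_indep X_density \<rho>(1) _ \<epsilon>_pos \<epsilon>_lim \<epsilon>_rate])
      (use \<rho>(2) in auto)
  then have "AE \<omega> in M. \<forall>k. \<forall>\<^sub>F n in sequentially. \<forall>x\<in>D. \<exists>i\<in>{1..n}. dist x (X i \<omega>) < 1 / real (Suc k) * \<epsilon> n"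
    by (subst AE_all_countable) blast
  then show ?thesis
    using AE_space
  proof eventually_elim
    case (elim \<omega>)
    define P where "P n = (\<lambda>i. X i \<omega>) ` {1..n}" for n
    have P: "finite (P n)" "P n \<subseteq> D" for n using X_in elim(2) unfolding P_def by auto
    have dense: "\<forall>\<kappa>>0. \<forall>\<^sub>F n in sequentially. \<forall>x\<in>D. \<exists>y\<in>P n. dist x y < \<kappa> * \<epsilon> n"
    proof (intro allI impI)
      fix \<kappa> :: real assume \<kappa>: "0 < \<kappa>"
      obtain k where k: "1 / real (Suc k) < \<kappa>" using nat_approx_posE[OF \<kappa>] by blast
      have "\<forall>\<^sub>F n in sequentially. \<forall>x\<in>D. \<exists>i\<in>{1..n}. dist x (X i \<omega>) < 1 / real (Suc k) * \<epsilon> n"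
        using elim(1) by blast
      moreover have "\<forall>\<^sub>F n in sequentially. 1 \<le> (n::nat)" by (rule eventually_ge_at_top)
      ultimately show "\<forall>\<^sub>F n in sequentially. \<forall>x\<in>D. \<exists>y\<in>P n. dist x y < \<kappa> * \<epsilon> n"
      proof eventually_elim
        case (elim n)
        have "1 / real (Suc k) * \<epsilon> n \<le> \<kappa> * \<epsilon> n"
          using k \<epsilon>_pos elim(2) by (intro mult_right_mono) (auto intro: less_imp_le)
        then show ?case using elim(1) unfolding P_def by (meson imageI less_le_trans)
      qed
    qed
    have \<Omega>l: "\<Omega>l \<omega> n = pl_graph_paths (P n) (\<epsilon> n) a b" for n unfolding \<Omega>l_def P_def by simp
    note main = graph_minima_converge[OF ab iD P \<epsilon>_pos \<epsilon>_lim dense, folded \<Omega>_def F_def, folded \<Omega>l]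
    have "argmin_on F \<Omega> \<noteq> {}" unfolding F_def \<Omega>_def by (rule min_path_action(3)[OF ab])
    moreover have "uniform_limit {0..1} \<gamma> \<eta> sequentially"
      if \<gamma>: "\<forall>\<^sub>F n in sequentially. \<gamma> n \<in> argmin_on F (\<Omega>l \<omega> n)"
        and \<eta>: "\<forall>\<eta>'\<in>argmin_on F \<Omega>. \<forall>t\<in>{0..1}. \<eta>' t = \<eta> t" for \<gamma> \<eta>
    proof (rule uniform_limit_of_subsequences)
      fix r :: "nat \<Rightarrow> nat" assume "strict_mono r"
      then show "\<exists>s :: nat \<Rightarrow> nat. \<exists>\<eta>'. uniform_limit {0..1} (\<lambda>k. \<gamma> (r (s k))) \<eta>' sequentially
          \<and> (\<forall>t\<in>{0..1}. \<eta>' t = \<eta> t)"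
        using main(3)[OF \<gamma>] \<eta> by blast
    qed
    ultimately show ?case using main by blast
  qed
qed

end
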